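(* Given a field $k$ of $\operatorname{char}(k)=2$, $I_q^nF$ is not linked for $F=k(\!(\alpha_1)\!)\dots(\!(\alpha_{n+1})\!)$, the field of iterated Laurent series in $n+1$ indeterminates over $k$.
   Context: The field of iterated Laurent series is defined recursively: $k(\!(\alpha_1)\!)\dots(\!(\alpha_m)\!)=K(\!(\alpha_m)\!)$ with $K=k(\!(\alpha_1)\!)\dots(\!(\alpha_{m-1})\!)$. Let $F$ be a field of characteristic $2$. For $a,b\in F$, $[a,b]$ denotes the quadratic form $ax^2+xy+by^2$. For $a_1,\dots,a_{n-1}\in F^\times$ and $b\in F$, the quadratic $n$-fold Pfister form is $$\langle\!\langle a_1,\dots,a_{n-1},b]\!]=\langle\!\langle a_1,\dots,a_{n-1}\rangle\!\rangle\otimes[1,b],$$ where $\langle\!\langle a_1,\dots,a_{n-1}\rangle\!\rangle=\langle 1,a_1\rangle\otimes\dots\otimes\langle 1,a_{n-1}\rangle$ is the bilinear $(n-1)$-fold Pfister form. $I_q^nF$ denotes the subgroup generated by the quadratic $n$-fold Pfister forms in the Witt group of nondegenerate even-dimensional quadratic forms over $F$. $I_q^nF$ is said to be linked if every two quadratic $n$-fold Pfister forms over $F$ share an $(n-1)$-fold Pfister factor. *)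

theory Defs
  imports "HOL-Algebra.Algebra" "HOL-Algebra.Algebraic_Closure_Type"
    "HOL-Computational_Algebra.Formal_Laurent_Series"
begin

definition ring_char :: "('a, 'm) ring_scheme \<Rightarrow> nat" where
  "ring_char R =
     (if \<exists>n::nat>0. [n] \<cdot>\<^bsub>R\<^esub> \<one>\<^bsub>R\<^esub> = \<zero>\<^bsub>R\<^esub>
      then LEAST n::nat. n > 0 \<and> [n] \<cdot>\<^bsub>R\<^esub> \<one>\<^bsub>R\<^esub> = \<zero>\<^bsub>R\<^esub> else 0)"


section \<open>Iterated Laurent series\<close>

text \<open>
  The library type of formal Laurent series can only be iterated a fixed number of times, since
  each step changes the type. So we give the Laurent series construction for rings with a carrier,
  as in the library: a series is its coefficient function, with coefficients vanishing below some
  index. The index set of the sum in the product is finite for such series.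
\<close>

definition laurent_ring :: "('a, 'm) ring_scheme \<Rightarrow> (int \<Rightarrow> 'a) ring" where
  "laurent_ring R =
     \<lparr>carrier = {f. (\<forall>i. f i \<in> carrier R) \<and> (\<exists>N. \<forall>i<N. f i = \<zero>\<^bsub>R\<^esub>)},
      monoid.mult = (\<lambda>f g i.
        \<Oplus>\<^bsub>R\<^esub>j\<in>{j. f j \<noteq> \<zero>\<^bsub>R\<^esub> \<and> g (i - j) \<noteq> \<zero>\<^bsub>R\<^esub>}. f j \<otimes>\<^bsub>R\<^esub> g (i - j)),
      monoid.one = (\<lambda>i. if i = 0 then \<one>\<^bsub>R\<^esub> else \<zero>\<^bsub>R\<^esub>),
      ring.zero = (\<lambda>i. \<zero>\<^bsub>R\<^esub>),
      ring.add = (\<lambda>f g i. f i \<oplus>\<^bsub>R\<^esub> g i)\<rparr>"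

lemma laurent_ring_fls:
  "fls_nth \<in> ring_iso (ring_of_type_algebra :: 'a::field fls ring)
     (laurent_ring (ring_of_type_algebra :: 'a ring))"
proof -
  let ?L = "ring_of_type_algebra :: 'a fls ring" and ?R = "ring_of_type_algebra :: 'a ring"
  interpret R: field ?R by (rule field_from_type_algebra)
  have R_simps: "carrier ?R = UNIV" "\<zero>\<^bsub>?R\<^esub> = 0" "\<one>\<^bsub>?R\<^esub> = 1"
    "\<And>x y. x \<otimes>\<^bsub>?R\<^esub> y = x * y" "\<And>x y. x \<oplus>\<^bsub>?R\<^esub> y = x + y"
    by (simp_all add: ring_of_type_algebra_def)
  have finsum: "finsum ?R h A = sum h A" if "finite A" for h :: "int \<Rightarrow> 'a" and A
    using that by (induction A rule: finite_induct) (auto simp: R_simps)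
  have mult: "fls_nth (f * g) i =
      finsum ?R (\<lambda>j. fls_nth f j * fls_nth g (i - j))
        {j. fls_nth f j \<noteq> 0 \<and> fls_nth g (i - j) \<noteq> 0}" for f g :: "'a fls" and i
  proof -
    let ?S = "{j. fls_nth f j \<noteq> 0 \<and> fls_nth g (i - j) \<noteq> 0}"
    have S: "?S \<subseteq> {fls_subdegree f..i - fls_subdegree g}"
      by auto (smt (verit) fls_eq0_below_subdegree)+
    have "fls_nth (f * g) i =
        (\<Sum>j\<in>{fls_subdegree f..i - fls_subdegree g}. fls_nth f j * fls_nth g (i - j))"
      by (simp add: fls_times_nth(2))
    also have "\<dots> = (\<Sum>j\<in>?S. fls_nth f j * fls_nth g (i - j))"
      by (rule sum.mono_neutral_right) (use S in auto)
    finally show ?thesis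
      using finsum[of ?S] finite_subset[OF S] by simp
  qed
  have L_simps: "carrier ?L = UNIV" "\<one>\<^bsub>?L\<^esub> = 1"
    "\<And>x y. x \<otimes>\<^bsub>?L\<^esub> y = x * y" "\<And>x y. x \<oplus>\<^bsub>?L\<^esub> y = x + y"
    by (simp_all add: ring_of_type_algebra_def)
  have bound: "\<exists>N. \<forall>i<N. fls_nth f i = 0" for f :: "'a fls"
    by (rule exI[of _ "fls_subdegree f"]) simp
  moreover have "h \<in> range fls_nth" if "\<forall>i<N. h i = 0" for h :: "int \<Rightarrow> 'a" and N
    using that by (intro image_eqI[of _ _ "Abs_fls h"]) (auto simp: nth_Abs_fls_lower_bound[of N])
  ultimately have "bij_betw fls_nth UNIV {h :: int \<Rightarrow> 'a. \<exists>N. \<forall>i<N. h i = 0}"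
    by (auto simp: bij_betw_def inj_on_def fls_eq_iff)
  then show ?thesis
    by (simp add: ring_iso_def ring_hom_def laurent_ring_def R_simps L_simps mult bound fun_eq_iff)
qed

text \<open>
  The elements of all iterated Laurent series fields over \<open>k\<close> are coded in one type, in order that
  the number of indeterminates can be a variable.
\<close>

datatype 'a iterated = Const 'a | Series "int \<Rightarrow> 'a iterated"

primrec iterated_laurent :: "('a, 'm) ring_scheme \<Rightarrow> nat \<Rightarrow> 'a iterated ring" where
  "iterated_laurent k 0 = image_ring Const k"
| "iterated_laurent k (Suc m) = image_ring Series (laurent_ring (iterated_laurent k m))"


section \<open>Bilinear and quadratic forms\<close>

text \<open>
  A form of dimension \<open>d\<close> is a pair \<open>(d, M)\<close>; only the entries \<open>M i j\<close> with \<open>i, j < d\<close> matter.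
  For a bilinear form, \<open>M\<close> is the Gram matrix. For a quadratic form, \<open>M\<close> holds coefficients:
  the form is the map sending \<open>x\<close> to the sum of the \<open>M i j * x i * x j\<close>. Different
  \<open>M\<close> can give the same quadratic form, which is harmless since isometry only refers to values.
\<close>

type_synonym 'a form = "nat \<times> (nat \<Rightarrow> nat \<Rightarrow> 'a)"

definition coord_space :: "('a, 'm) ring_scheme \<Rightarrow> nat \<Rightarrow> (nat \<Rightarrow> 'a) set" where
  "coord_space F d = {..<d} \<rightarrow>\<^sub>E carrier F"

definition quad_value :: "('a, 'm) ring_scheme \<Rightarrow> 'a form \<Rightarrow> (nat \<Rightarrow> 'a) \<Rightarrow> 'a" where
  "quad_value F q x =
     (\<Oplus>\<^bsub>F\<^esub>i\<in>{..<fst q}. \<Oplus>\<^bsub>F\<^esub>j\<in>{..<fst q}. snd q i j \<otimes>\<^bsub>F\<^esub> x i \<otimes>\<^bsub>F\<^esub> x j)"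

definition linear_bij ::
    "('a, 'm) ring_scheme \<Rightarrow> nat \<Rightarrow> nat \<Rightarrow> ((nat \<Rightarrow> 'a) \<Rightarrow> (nat \<Rightarrow> 'a)) \<Rightarrow> bool" where
  "linear_bij F d e T \<longleftrightarrow>
     bij_betw T (coord_space F d) (coord_space F e) \<and>
     (\<forall>x\<in>coord_space F d. \<forall>y\<in>coord_space F d.
        T (\<lambda>i\<in>{..<d}. x i \<oplus>\<^bsub>F\<^esub> y i) = (\<lambda>i\<in>{..<e}. T x i \<oplus>\<^bsub>F\<^esub> T y i)) \<and>
     (\<forall>c\<in>carrier F. \<forall>x\<in>coord_space F d.
        T (\<lambda>i\<in>{..<d}. c \<otimes>\<^bsub>F\<^esub> x i) = (\<lambda>i\<in>{..<e}. c \<otimes>\<^bsub>F\<^esub> T x i))"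

definition quad_isometric :: "('a, 'm) ring_scheme \<Rightarrow> 'a form \<Rightarrow> 'a form \<Rightarrow> bool" where
  "quad_isometric F q q' \<longleftrightarrow>
     (\<exists>T. linear_bij F (fst q) (fst q') T \<and>
          (\<forall>x\<in>coord_space F (fst q). quad_value F q' (T x) = quad_value F q x))"

text \<open>
  The Kronecker product, serving both for the product of two bilinear forms and for the product
  \<open>B \<otimes> q\<close> of a symmetric bilinear form with a quadratic form, the quadratic form with
  \<open>(B \<otimes> q) (v \<otimes> w) = B (v, v) * q w\<close> and with polar form the product of \<open>B\<close> and the polar form of
  \<open>q\<close>. Indeed, if \<open>M\<close> holds coefficients of \<open>q\<close>, the polar form of \<open>q\<close> has Gram matrix
  \<open>M + M\<^sup>T\<close>, and as \<open>B\<close> is symmetric, \<open>B \<otimes> M + (B \<otimes> M)\<^sup>T = B \<otimes> (M + M\<^sup>T)\<close>.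
\<close>

definition form_tensor :: "('a, 'm) ring_scheme \<Rightarrow> 'a form \<Rightarrow> 'a form \<Rightarrow> 'a form" where
  "form_tensor F A B =
     (fst A * fst B,
      \<lambda>i j. snd A (i div fst B) (j div fst B) \<otimes>\<^bsub>F\<^esub> snd B (i mod fst B) (j mod fst B))"

definition diag_form :: "('a, 'm) ring_scheme \<Rightarrow> 'a list \<Rightarrow> 'a form" where
  "diag_form F as = (length as, \<lambda>i j. if i = j then as ! i else \<zero>\<^bsub>F\<^esub>)"

definition binary_quad :: "('a, 'm) ring_scheme \<Rightarrow> 'a \<Rightarrow> 'a \<Rightarrow> 'a form" where
  "binary_quad F a b =
     (2, \<lambda>i j. if i = 0 \<and> j = 0 then a
               else if i = 0 \<and> j = 1 then \<one>\<^bsub>F\<^esub>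
               else if i = 1 \<and> j = 1 then b
               else \<zero>\<^bsub>F\<^esub>)"


section \<open>Pfister forms and linkage\<close>

definition bil_pfister :: "('a, 'm) ring_scheme \<Rightarrow> 'a list \<Rightarrow> 'a form" where
  "bil_pfister F as = foldr (\<lambda>a. form_tensor F (diag_form F [\<one>\<^bsub>F\<^esub>, a])) as (diag_form F [\<one>\<^bsub>F\<^esub>])"

definition quad_pfister :: "('a, 'm) ring_scheme \<Rightarrow> 'a list \<Rightarrow> 'a \<Rightarrow> 'a form" where
  "quad_pfister F as b = form_tensor F (bil_pfister F as) (binary_quad F \<one>\<^bsub>F\<^esub> b)"

definition is_bil_pfister :: "('a, 'm) ring_scheme \<Rightarrow> nat \<Rightarrow> 'a form \<Rightarrow> bool" where
  "is_bil_pfister F n B \<longleftrightarrow>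
     (\<exists>as. length as = n \<and> set as \<subseteq> carrier F - {\<zero>\<^bsub>F\<^esub>} \<and> B = bil_pfister F as)"

definition is_quad_pfister :: "('a, 'm) ring_scheme \<Rightarrow> nat \<Rightarrow> 'a form \<Rightarrow> bool" where
  "is_quad_pfister F n q \<longleftrightarrow>
     (\<exists>as b. Suc (length as) = n \<and> set as \<subseteq> carrier F - {\<zero>\<^bsub>F\<^esub>} \<and> b \<in> carrier F \<and>
             q = quad_pfister F as b)"

text \<open>
  A factor shared by two quadratic \<open>n\<close>-fold Pfister forms may be quadratic, with bilinear 1-fold
  Pfister forms as cofactors, or bilinear, with quadratic 1-fold Pfister forms as cofactors.
\<close>

definition share_quad_factor ::
    "('a, 'm) ring_scheme \<Rightarrow> nat \<Rightarrow> 'a form \<Rightarrow> 'a form \<Rightarrow> bool" where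
  "share_quad_factor F n q1 q2 \<longleftrightarrow>
     (\<exists>p C1 C2. is_quad_pfister F (n - 1) p \<and> is_bil_pfister F 1 C1 \<and> is_bil_pfister F 1 C2 \<and>
        quad_isometric F q1 (form_tensor F C1 p) \<and> quad_isometric F q2 (form_tensor F C2 p))"

definition share_bil_factor ::
    "('a, 'm) ring_scheme \<Rightarrow> nat \<Rightarrow> 'a form \<Rightarrow> 'a form \<Rightarrow> bool" where
  "share_bil_factor F n q1 q2 \<longleftrightarrow>
     (\<exists>B r1 r2. is_bil_pfister F (n - 1) B \<and> is_quad_pfister F 1 r1 \<and> is_quad_pfister F 1 r2 \<and>
        quad_isometric F q1 (form_tensor F B r1) \<and> quad_isometric F q2 (form_tensor F B r2))"

text \<open>
  Linkage of \<open>I_q\<^sup>n F\<close> is a condition on the quadratic \<open>n\<close>-fold Pfister forms generating it, so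
  the Witt group itself is not needed.
\<close>

definition Iq_linked :: "('a, 'm) ring_scheme \<Rightarrow> nat \<Rightarrow> bool" where
  "Iq_linked F n \<longleftrightarrow>
     (\<forall>q1 q2. is_quad_pfister F n q1 \<longrightarrow> is_quad_pfister F n q2 \<longrightarrow>
        share_quad_factor F n q1 q2 \<or> share_bil_factor F n q1 q2)"

end

theory Submission
  imports Defs
begin

text \<open>
  Let \<open>u\<^sub>i\<close> be the inverse of the \<open>i\<close>-th indeterminate. The forms
  \<open>\<pi>\<^sub>1 = \<langle>\<langle>u\<^sub>1, \<dots>, u\<^bsub>n-1\<^esub>, u\<^sub>n]]\<close> and \<open>\<pi>\<^sub>2 = \<langle>\<langle>u\<^sub>2, \<dots>, u\<^sub>n, u\<^bsub>n+1\<^esub>]]\<close> are not linked.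
  If they were, with a quadratic or a bilinear common factor, they would share a subform of dimension
  \<open>2\<^sup>n\<^sup>-\<^sup>1\<close>. Consider orders with respect to the last indeterminate. The form \<open>\<pi>\<^sub>1\<close> is unramified with
  anisotropic residue form, so it only takes values of even order, and on
  \<open>\<pi>\<^sub>2 = \<Sum> d\<^sub>s (x\<^sub>s\<^sup>2 + x\<^sub>s y\<^sub>s + u\<^bsub>n+1\<^esub> y\<^sub>s\<^sup>2)\<close> the value of even order comes from the \<open>x\<^sub>s\<close> alone.
  Hence the common subform reduces to the totally singular form \<open>\<Sum> d\<^sub>s x\<^sub>s\<^sup>2\<close> inside the residue form of
  \<open>\<pi>\<^sub>1\<close>. In particular that residue form has two orthogonal vectors with values \<open>1\<close> and \<open>u\<^sub>n\<close> up to
  squares. Comparing leading terms with respect to the \<open>n\<close>-th indeterminate, such vectors cannot be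
  orthogonal.
\<close>

section \<open>Laurent series over a domain\<close>

text \<open>The clash lies in u_n. It is the quadratic slot of pi_1, and in [1, u_n] the basis
  vectors with values 1 and u_n have polar value 1. In pi_2 it is a bilinear slot, and there vectors
  with values 1 and u_n are orthogonal. Inverses of the indeterminates are used because [1, b] is
  hyperbolic for b of positive order. For b of order -1 the terms x^2 and b y^2 have orders of
  different parity, and x y has larger order than the smaller of the two, so lowest terms never
  cancel. The dimension 2^(n-1) is exactly the number of coordinates x_s of pi_2: once the passage
  from the common subform to these coordinates is injective, it reaches every basis vector up to a
  factor. A smaller common subform could miss the coefficients 1 and u_n. All rings are treated as
  integral domains. Linear systems are therefore solved without division, and basis vectors are hit
  only up to a nonzero factor, which changes a value by a square.\<close>

lemma (in abelian_monoid) finsum_swap: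
  assumes "finite A" "finite B" "\<And>a b. a \<in> A \<Longrightarrow> b \<in> B \<Longrightarrow> f a b \<in> carrier G"
  shows "(\<Oplus>a\<in>A. \<Oplus>b\<in>B. f a b) = (\<Oplus>b\<in>B. \<Oplus>a\<in>A. f a b)"
  using assms(1,3)
proof (induction A rule: finite_induct)
  case (insert x A)
  have "(\<Oplus>a\<in>insert x A. \<Oplus>b\<in>B. f a b) = (\<Oplus>b\<in>B. f x b) \<oplus> (\<Oplus>b\<in>B. \<Oplus>a\<in>A. f a b)"
    using insert by (subst finsum_insert) (auto intro!: finsum_closed)
  also have "\<dots> = (\<Oplus>b\<in>B. f x b \<oplus> (\<Oplus>a\<in>A. f a b))"
    using insert by (subst finsum_addf) (auto intro!: finsum_closed)
  also have "\<dots> = (\<Oplus>b\<in>B. \<Oplus>a\<in>insert x A. f a b)"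
    using insert by (intro finsum_cong') (auto intro!: finsum_closed)
  finally show ?case .
qed (simp add: finsum_zero)

lemma (in abelian_monoid) finsum_eq_single:
  assumes "finite A" "a \<in> A" "f a \<in> carrier G" "\<And>i. i \<in> A \<Longrightarrow> i \<noteq> a \<Longrightarrow> f i = \<zero>"
  shows "(\<Oplus>i\<in>A. f i) = f a"
proof -
  have "(\<Oplus>i\<in>A. f i) = (\<Oplus>i\<in>{a}. f i)"
    using assms by (intro add.finprod_mono_neutral_cong_right) (auto simp: Pi_iff, metis zero_closed)
  then show ?thesis using assms by simp
qed

section \<open>Convolution of Laurent series and the ring laws\<close>

lemma laurent_ring_simps:
  "carrier (laurent_ring R) =
     {f. (\<forall>i. f i \<in> carrier R) \<and> (\<exists>N. \<forall>i<N. f i = \<zero>\<^bsub>R\<^esub>)}"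
  "f \<otimes>\<^bsub>laurent_ring R\<^esub> g = (\<lambda>i. \<Oplus>\<^bsub>R\<^esub>j\<in>{j. f j \<noteq> \<zero>\<^bsub>R\<^esub> \<and> g (i - j) \<noteq> \<zero>\<^bsub>R\<^esub>}. f j \<otimes>\<^bsub>R\<^esub> g (i - j))"
  "\<one>\<^bsub>laurent_ring R\<^esub> = (\<lambda>i. if i = 0 then \<one>\<^bsub>R\<^esub> else \<zero>\<^bsub>R\<^esub>)"
  "\<zero>\<^bsub>laurent_ring R\<^esub> = (\<lambda>i. \<zero>\<^bsub>R\<^esub>)"
  "f \<oplus>\<^bsub>laurent_ring R\<^esub> g = (\<lambda>i. f i \<oplus>\<^bsub>R\<^esub> g i)"
  by (simp_all add: laurent_ring_def)

context cring
begin

text \<open>The index set in the definition of the product varies with both factors and the index.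
  Beyond the order bounds all terms vanish, so an interval can replace it; the slack in
  \<open>A\<close> and \<open>C\<close> lets several products share one interval.\<close>

lemma laurent_mult_nth:
  assumes "\<And>i. f i \<in> carrier R" "\<And>i. g i \<in> carrier R"
    and "\<And>i. i < M \<Longrightarrow> f i = \<zero>" "\<And>i. i < N \<Longrightarrow> g i = \<zero>" "A \<le> M" "i - N \<le> C"
  shows "(f \<otimes>\<^bsub>laurent_ring R\<^esub> g) i = (\<Oplus>j\<in>{A..C}. f j \<otimes> g (i - j))"
proof -
  have "A \<le> j" "j \<le> C" if "f j \<noteq> \<zero>" "g (i - j) \<noteq> \<zero>" for j
    using that assms(3)[of j] assms(4)[of "i - j"] assms(5,6) by force+
  then show ?thesis unfolding laurent_ring_simps
    by (intro add.finprod_mono_neutral_cong_left) (use assms in auto)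
qed

lemma laurent_mult_lead:
  assumes "\<And>i. f i \<in> carrier R" "\<And>i. g i \<in> carrier R"
    and "\<And>i. i < M \<Longrightarrow> f i = \<zero>" "\<And>i. i < N \<Longrightarrow> g i = \<zero>"
  shows "(f \<otimes>\<^bsub>laurent_ring R\<^esub> g) (M + N) = f M \<otimes> g N"
    and "i < M + N \<Longrightarrow> (f \<otimes>\<^bsub>laurent_ring R\<^esub> g) i = \<zero>"
  \<comment> \<open>With \<open>C = M\<close> the interval is the single index \<open>M\<close>;
    below \<open>M + N\<close>, \<open>C = M - 1\<close> makes it empty.\<close>
  using laurent_mult_nth[OF assms order_refl, where i = "M + N" and C = M]
    laurent_mult_nth[OF assms order_refl, where i = i and C = "M - 1"] assms(1,2) by auto

lemma laurent_mult_closed: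
  assumes "f \<in> carrier (laurent_ring R)" "g \<in> carrier (laurent_ring R)"
  shows "f \<otimes>\<^bsub>laurent_ring R\<^esub> g \<in> carrier (laurent_ring R)"
proof -
  obtain M N where MN: "\<And>i. i < M \<Longrightarrow> f i = \<zero>" "\<And>i. i < N \<Longrightarrow> g i = \<zero>"
    and fg: "\<And>i. f i \<in> carrier R" "\<And>i. g i \<in> carrier R"
    using assms by (auto simp: laurent_ring_simps)
  have "(f \<otimes>\<^bsub>laurent_ring R\<^esub> g) i \<in> carrier R" for i
    by (subst laurent_mult_nth[of f g M N M i "i - N"]) (use fg MN in \<open>auto intro!: finsum_closed\<close>)
  then show ?thesis
    using laurent_mult_lead(2)[of f g M N] fg MN unfolding laurent_ring_simps(1) by blast
qed

lemma laurent_mult_assoc: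
  assumes "f \<in> carrier (laurent_ring R)" "g \<in> carrier (laurent_ring R)" "h \<in> carrier (laurent_ring R)"
  shows "f \<otimes>\<^bsub>laurent_ring R\<^esub> g \<otimes>\<^bsub>laurent_ring R\<^esub> h = f \<otimes>\<^bsub>laurent_ring R\<^esub> (g \<otimes>\<^bsub>laurent_ring R\<^esub> h)"
proof
  fix i
  let ?m = "\<lambda>f g. f \<otimes>\<^bsub>laurent_ring R\<^esub> g"
  have cl: "f j \<in> carrier R" "g j \<in> carrier R" "h j \<in> carrier R" for j
    using assms by (auto simp: laurent_ring_simps)
  obtain L M N where LMN: "\<And>i. i < L \<Longrightarrow> f i = \<zero>" "\<And>i. i < M \<Longrightarrow> g i = \<zero>" "\<And>i. i < N \<Longrightarrow> h i = \<zero>"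
    using assms by (auto simp: laurent_ring_simps)
  define B where "B = min L (min M N)"
  have B: "f j = \<zero>" "g j = \<zero>" "h j = \<zero>" if "j < B" for j
    using that by (auto simp: B_def LMN)
  have clm: "?m f g j \<in> carrier R" "?m g h j \<in> carrier R" for j
    using laurent_mult_closed[OF assms(1,2)] laurent_mult_closed[OF assms(2,3)]
    by (auto simp: laurent_ring_simps(1))
  \<comment> \<open>The partial products have order at least \<open>B + B\<close>. These two
    intervals contain all relevant indices and do not depend on each other, so the double sum runs
    over a rectangle and can be swapped.\<close>
  let ?J = "{B + B..i - B}" and ?L = "{B..i - (B + B)}"
  have fg: "?m f g j = (\<Oplus>l\<in>?L. f l \<otimes> g (j - l))" if "j \<in> ?J" for j
    using that by (intro laurent_mult_nth[of _ _ B B] cl B) auto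
  have gh: "?m g h (i - l) = (\<Oplus>j\<in>?J. g (j - l) \<otimes> h (i - j))" if "l \<in> ?L" for l
  proof -
    have "?m g h (i - l) = (\<Oplus>j\<in>{B + B - l..i - B - l}. g j \<otimes> h (i - l - j))"
      using that by (intro laurent_mult_nth[of _ _ B B] cl B) auto
    also have "{B + B - l..i - B - l} = (\<lambda>j. j - l) ` ?J"
      by (simp add: image_diff_atLeastAtMost)
    also have "(\<Oplus>j\<in>(\<lambda>j. j - l) ` ?J. g j \<otimes> h (i - l - j)) = (\<Oplus>j\<in>?J. g (j - l) \<otimes> h (i - l - (j - l)))"
      using cl by (intro finsum_reindex) (auto simp: inj_on_def)
    finally show ?thesis by simp
  qed
  have "?m (?m f g) h i = (\<Oplus>j\<in>?J. ?m f g j \<otimes> h (i - j))"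
    using laurent_mult_lead(2)[OF cl(1,2) B(1,2)]
    by (intro laurent_mult_nth[of _ _ "B + B" B] cl clm B) auto
  also have "\<dots> = (\<Oplus>j\<in>?J. \<Oplus>l\<in>?L. f l \<otimes> g (j - l) \<otimes> h (i - j))"
    using cl by (intro finsum_cong') (auto simp: fg finsum_ldistr intro!: finsum_closed)
  also have "\<dots> = (\<Oplus>l\<in>?L. \<Oplus>j\<in>?J. f l \<otimes> g (j - l) \<otimes> h (i - j))"
    using cl by (intro finsum_swap) auto
  also have "\<dots> = (\<Oplus>l\<in>?L. f l \<otimes> ?m g h (i - l))"
    using cl by (intro finsum_cong') (auto simp: gh finsum_rdistr m_assoc intro!: finsum_closed)
  also have "\<dots> = ?m f (?m g h) i"
    using laurent_mult_lead(2)[OF cl(2,3) B(2,3)]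
    by (intro laurent_mult_nth[of _ _ B "B + B", symmetric] cl clm B) auto
  finally show "?m (?m f g) h i = ?m f (?m g h) i" .
qed

lemma laurent_mult_comm:
  assumes "f \<in> carrier (laurent_ring R)" "g \<in> carrier (laurent_ring R)"
  shows "f \<otimes>\<^bsub>laurent_ring R\<^esub> g = g \<otimes>\<^bsub>laurent_ring R\<^esub> f"
proof
  fix i
  obtain M N where MN: "\<And>i. i < M \<Longrightarrow> f i = \<zero>" "\<And>i. i < N \<Longrightarrow> g i = \<zero>"
    and fg: "\<And>i. f i \<in> carrier R" "\<And>i. g i \<in> carrier R"
    using assms by (auto simp: laurent_ring_simps)
  have "(f \<otimes>\<^bsub>laurent_ring R\<^esub> g) i = (\<Oplus>j\<in>{M..i - N}. f j \<otimes> g (i - j))"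
    by (intro laurent_mult_nth[OF fg MN]) auto
  also have "{M..i - N} = (\<lambda>j. i - j) ` {N..i - M}"
    by (simp add: image_diff_atLeastAtMost)
  also have "(\<Oplus>j\<in>(\<lambda>j. i - j) ` {N..i - M}. f j \<otimes> g (i - j)) =
      (\<Oplus>j\<in>{N..i - M}. f (i - j) \<otimes> g (i - (i - j)))"
    using fg by (intro finsum_reindex) (auto simp: inj_on_def)
  also have "\<dots> = (\<Oplus>j\<in>{N..i - M}. g j \<otimes> f (i - j))"
    using fg by (intro finsum_cong') (auto simp: m_comm)
  also have "\<dots> = (g \<otimes>\<^bsub>laurent_ring R\<^esub> f) i"
    by (intro laurent_mult_nth[OF fg(2,1) MN(2,1), symmetric]) auto
  finally show "(f \<otimes>\<^bsub>laurent_ring R\<^esub> g) i = (g \<otimes>\<^bsub>laurent_ring R\<^esub> f) i" .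
qed

lemma laurent_mult_distr:
  assumes "f \<in> carrier (laurent_ring R)" "g \<in> carrier (laurent_ring R)" "h \<in> carrier (laurent_ring R)"
  shows "(f \<oplus>\<^bsub>laurent_ring R\<^esub> g) \<otimes>\<^bsub>laurent_ring R\<^esub> h =
    f \<otimes>\<^bsub>laurent_ring R\<^esub> h \<oplus>\<^bsub>laurent_ring R\<^esub> g \<otimes>\<^bsub>laurent_ring R\<^esub> h"
proof
  fix i
  let ?m = "\<lambda>f g. f \<otimes>\<^bsub>laurent_ring R\<^esub> g"
  have cl: "f j \<in> carrier R" "g j \<in> carrier R" "h j \<in> carrier R" for j
    using assms by (auto simp: laurent_ring_simps)
  obtain L M N where LMN: "\<And>i. i < L \<Longrightarrow> f i = \<zero>" "\<And>i. i < M \<Longrightarrow> g i = \<zero>" "\<And>i. i < N \<Longrightarrow> h i = \<zero>"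
    using assms by (auto simp: laurent_ring_simps)
  define B where "B = min L (min M N)"
  have B: "f j = \<zero>" "g j = \<zero>" "h j = \<zero>" if "j < B" for j
    using that by (auto simp: B_def LMN)
  have "?m (f \<oplus>\<^bsub>laurent_ring R\<^esub> g) h i = (\<Oplus>j\<in>{B..i - B}. (f j \<oplus> g j) \<otimes> h (i - j))"
    using cl B by (subst laurent_mult_nth[of _ _ B B B _ "i - B"]) (auto simp: laurent_ring_simps(5))
  also have "\<dots> = (\<Oplus>j\<in>{B..i - B}. f j \<otimes> h (i - j) \<oplus> g j \<otimes> h (i - j))"
    using cl by (intro finsum_cong') (auto simp: l_distr)
  also have "\<dots> = (\<Oplus>j\<in>{B..i - B}. f j \<otimes> h (i - j)) \<oplus> (\<Oplus>j\<in>{B..i - B}. g j \<otimes> h (i - j))"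
    using cl by (intro finsum_addf) auto
  also have "\<dots> = ?m f h i \<oplus> ?m g h i"
    using cl B by (simp add: laurent_mult_nth[of _ _ B B B _ "i - B"])
  finally show "?m (f \<oplus>\<^bsub>laurent_ring R\<^esub> g) h i =
      (?m f h \<oplus>\<^bsub>laurent_ring R\<^esub> ?m g h) i" by (simp add: laurent_ring_simps(5))
qed

lemma laurent_add_closed:
  assumes "f \<in> carrier (laurent_ring R)" "g \<in> carrier (laurent_ring R)"
  shows "f \<oplus>\<^bsub>laurent_ring R\<^esub> g \<in> carrier (laurent_ring R)"
proof -
  obtain M N where "\<And>i. i < M \<Longrightarrow> f i = \<zero>" "\<And>i. i < N \<Longrightarrow> g i = \<zero>"
    using assms by (auto simp: laurent_ring_simps)
  then have "\<forall>i<min M N. f i \<oplus> g i = \<zero>" by simp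
  then show ?thesis
    using assms unfolding laurent_ring_simps by (auto intro!: exI[of _ "min M N"])
qed

lemma laurent_cring: "cring (laurent_ring R)"
proof (intro cringI abelian_groupI comm_monoidI)
  show "\<exists>g\<in>carrier (laurent_ring R). g \<oplus>\<^bsub>laurent_ring R\<^esub> f = \<zero>\<^bsub>laurent_ring R\<^esub>"
    if "f \<in> carrier (laurent_ring R)" for f
  proof (rule bexI[of _ "\<lambda>i. \<ominus> f i"])
    show "(\<lambda>i. \<ominus> f i) \<in> carrier (laurent_ring R)"
      using that by (auto simp: laurent_ring_simps)
  qed (use that in \<open>auto simp: laurent_ring_simps l_neg\<close>)
  show "\<one>\<^bsub>laurent_ring R\<^esub> \<otimes>\<^bsub>laurent_ring R\<^esub> f = f" if fL: "f \<in> carrier (laurent_ring R)" for f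
  proof
    fix i
    obtain N where N: "\<And>i. i < N \<Longrightarrow> f i = \<zero>" and f: "\<And>i. f i \<in> carrier R"
      using fL unfolding laurent_ring_simps(1) by blast
    \<comment> \<open>The upper end is raised to 0 because the interval must contain the index 0,
      where the unit lives, even when \<open>i < N\<close>.\<close>
    have "(\<one>\<^bsub>laurent_ring R\<^esub> \<otimes>\<^bsub>laurent_ring R\<^esub> f) i =
        (\<Oplus>j\<in>{0..max 0 (i - N)}. \<one>\<^bsub>laurent_ring R\<^esub> j \<otimes> f (i - j))"
      using f N by (intro laurent_mult_nth[of _ _ 0 N]) (auto simp: laurent_ring_simps)
    also have "\<dots> = \<one>\<^bsub>laurent_ring R\<^esub> 0 \<otimes> f (i - 0)"
      using f by (intro finsum_eq_single) (auto simp: laurent_ring_simps)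
    finally show "(\<one>\<^bsub>laurent_ring R\<^esub> \<otimes>\<^bsub>laurent_ring R\<^esub> f) i = f i"
      using f by (simp add: laurent_ring_simps)
  qed
  show "\<one>\<^bsub>laurent_ring R\<^esub> \<in> carrier (laurent_ring R)"
    by (auto simp: laurent_ring_simps intro!: exI[of _ 0])
  show "\<zero>\<^bsub>laurent_ring R\<^esub> \<in> carrier (laurent_ring R)"
    by (auto simp: laurent_ring_simps)
  have nth: "f i \<in> carrier R" if "f \<in> carrier (laurent_ring R)" for f i
    using that by (auto simp: laurent_ring_simps)
  show "f \<oplus>\<^bsub>laurent_ring R\<^esub> g \<oplus>\<^bsub>laurent_ring R\<^esub> h = f \<oplus>\<^bsub>laurent_ring R\<^esub> (g \<oplus>\<^bsub>laurent_ring R\<^esub> h)"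
    if "f \<in> carrier (laurent_ring R)" "g \<in> carrier (laurent_ring R)" "h \<in> carrier (laurent_ring R)"
    for f g h using that by (simp add: laurent_ring_simps(5) nth a_assoc)
  show "f \<oplus>\<^bsub>laurent_ring R\<^esub> g = g \<oplus>\<^bsub>laurent_ring R\<^esub> f"
    if "f \<in> carrier (laurent_ring R)" "g \<in> carrier (laurent_ring R)" for f g
    using that by (simp add: laurent_ring_simps(5) nth a_comm)
  show "\<zero>\<^bsub>laurent_ring R\<^esub> \<oplus>\<^bsub>laurent_ring R\<^esub> f = f" if "f \<in> carrier (laurent_ring R)" for f
    using that by (simp add: laurent_ring_simps(4,5) nth)
qed (rule laurent_add_closed laurent_mult_closed laurent_mult_assoc laurent_mult_comm
      laurent_mult_distr; assumption)+

end

lemma laurent_order: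
  assumes "f \<in> carrier (laurent_ring R)" "f \<noteq> \<zero>\<^bsub>laurent_ring R\<^esub>"
  shows "\<exists>N. (\<forall>i<N. f i = \<zero>\<^bsub>R\<^esub>) \<and> f N \<noteq> \<zero>\<^bsub>R\<^esub>"
proof -
  obtain M where M: "\<And>i. i < M \<Longrightarrow> f i = \<zero>\<^bsub>R\<^esub>"
    using assms(1) by (auto simp: laurent_ring_simps)
  obtain j where j: "f j \<noteq> \<zero>\<^bsub>R\<^esub>"
    using assms(2) unfolding laurent_ring_simps(4) by blast
  have "M \<le> j" using M[of j] j by force
  \<comment> \<open>The least index is sought as a natural offset from the lower bound
    \<open>M\<close>, since the integers are not well-ordered.\<close>
  define n where "n = (LEAST n. f (M + int n) \<noteq> \<zero>\<^bsub>R\<^esub>)"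
  have ex: "f (M + int (nat (j - M))) \<noteq> \<zero>\<^bsub>R\<^esub>" using \<open>M \<le> j\<close> j by simp
  have 1: "f (M + int n) \<noteq> \<zero>\<^bsub>R\<^esub>"
    unfolding n_def by (rule LeastI[of "\<lambda>n. f (M + int n) \<noteq> \<zero>\<^bsub>R\<^esub>", OF ex])
  have 2: "f i = \<zero>\<^bsub>R\<^esub>" if "i < M + int n" for i
  proof (cases "i < M")
    case False
    with that have "nat (i - M) < n" by simp
    from not_less_Least[OF this[unfolded n_def]] False show ?thesis by simp
  qed (use M in auto)
  show ?thesis using 1 2 by blast
qed

text \<open>The product of the lowest coefficients of two nonzero series is a coefficient of their
  product.\<close>

lemma (in domain) laurent_domain: "domain (laurent_ring R)"
proof -
  interpret L: cring "laurent_ring R" by (rule laurent_cring)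
  show ?thesis
  proof
    show "\<one>\<^bsub>laurent_ring R\<^esub> \<noteq> \<zero>\<^bsub>laurent_ring R\<^esub>"
      by (auto simp: laurent_ring_simps dest: fun_cong[of _ _ 0])
    fix f g
    assume prod: "f \<otimes>\<^bsub>laurent_ring R\<^esub> g = \<zero>\<^bsub>laurent_ring R\<^esub>"
      and f: "f \<in> carrier (laurent_ring R)" and g: "g \<in> carrier (laurent_ring R)"
    show "f = \<zero>\<^bsub>laurent_ring R\<^esub> \<or> g = \<zero>\<^bsub>laurent_ring R\<^esub>"
    proof (rule ccontr)
      assume "\<not> ?thesis"
      then have nz: "f \<noteq> \<zero>\<^bsub>laurent_ring R\<^esub>" "g \<noteq> \<zero>\<^bsub>laurent_ring R\<^esub>" by auto
      obtain M where M: "\<And>i. i < M \<Longrightarrow> f i = \<zero>" "f M \<noteq> \<zero>"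
        using laurent_order[OF f nz(1)] by blast
      obtain N where N: "\<And>i. i < N \<Longrightarrow> g i = \<zero>" "g N \<noteq> \<zero>"
        using laurent_order[OF g nz(2)] by blast
      have cl: "f i \<in> carrier R" "g i \<in> carrier R" for i
        using f g by (simp_all add: laurent_ring_simps(1))
      have "f M \<otimes> g N = (f \<otimes>\<^bsub>laurent_ring R\<^esub> g) (M + N)"
        by (rule laurent_mult_lead(1)[symmetric]) (use cl M(1) N(1) in auto)
      also have "\<dots> = \<zero>" by (simp add: prod laurent_ring_simps(4))
      finally show False using integral cl M(2) N(2) by blast
    qed
  qed
qed

section \<open>Orders of the values of Pfister forms\<close>

text \<open>Of the multiplication of series, the argument only needs the lowest coefficient of a product.\<close>

locale laurent_extension = K: "domain" K + F: "domain" F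
  for K :: "('a, 'm) ring_scheme" (structure) and F :: "('b, 'n) ring_scheme" +
  fixes coeff :: "'b \<Rightarrow> int \<Rightarrow> 'a" and monom :: "'a \<Rightarrow> int \<Rightarrow> 'b"
  assumes coeff_closed [simp]: "f \<in> carrier F \<Longrightarrow> coeff f i \<in> carrier K"
    and coeff_add [simp]: "f \<in> carrier F \<Longrightarrow> g \<in> carrier F \<Longrightarrow>
      coeff (f \<oplus>\<^bsub>F\<^esub> g) i = coeff f i \<oplus>\<^bsub>K\<^esub> coeff g i"
    and coeff_bounded_below: "f \<in> carrier F \<Longrightarrow> \<exists>N. \<forall>i<N. coeff f i = \<zero>\<^bsub>K\<^esub>"
    and coeff_eq_zero_imp: "f \<in> carrier F \<Longrightarrow> (\<And>i. coeff f i = \<zero>\<^bsub>K\<^esub>) \<Longrightarrow> f = \<zero>\<^bsub>F\<^esub>"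
    and coeff_mult: "f \<in> carrier F \<Longrightarrow> g \<in> carrier F \<Longrightarrow>
      (\<And>i. i < M \<Longrightarrow> coeff f i = \<zero>\<^bsub>K\<^esub>) \<Longrightarrow> (\<And>i. i < N \<Longrightarrow> coeff g i = \<zero>\<^bsub>K\<^esub>) \<Longrightarrow>
      coeff (f \<otimes>\<^bsub>F\<^esub> g) (M + N) = coeff f M \<otimes>\<^bsub>K\<^esub> coeff g N \<and>
      (\<forall>i<M + N. coeff (f \<otimes>\<^bsub>F\<^esub> g) i = \<zero>\<^bsub>K\<^esub>)"
    and monom_closed [simp]: "a \<in> carrier K \<Longrightarrow> monom a i \<in> carrier F"
    and coeff_monom [simp]: "a \<in> carrier K \<Longrightarrow> coeff (monom a i) j = (if j = i then a else \<zero>\<^bsub>K\<^esub>)"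
    and monom_one: "monom \<one>\<^bsub>K\<^esub> 0 = \<one>\<^bsub>F\<^esub>"

text \<open>In characteristic 2 this is a totally singular quadratic form: its polar form is
  zero.\<close>

definition sq_form :: "('a, 'm) ring_scheme \<Rightarrow> (nat \<Rightarrow> 'a) \<Rightarrow> nat \<Rightarrow> (nat \<Rightarrow> 'a) \<Rightarrow> 'a" where
  "sq_form R d n x = (\<Oplus>\<^bsub>R\<^esub>s\<in>{..<n}. d s \<otimes>\<^bsub>R\<^esub> (x s \<otimes>\<^bsub>R\<^esub> x s))"

definition sq_anisotropic :: "('a, 'm) ring_scheme \<Rightarrow> (nat \<Rightarrow> 'a) \<Rightarrow> nat \<Rightarrow> bool" where
  "sq_anisotropic R d n \<longleftrightarrow> (\<forall>x\<in>{..<n} \<rightarrow> carrier R.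
     sq_form R d n x = \<zero>\<^bsub>R\<^esub> \<longrightarrow> (\<forall>s<n. x s = \<zero>\<^bsub>R\<^esub>))"

definition block ::
    "('a, 'm) ring_scheme \<Rightarrow> 'a \<Rightarrow> 'a \<Rightarrow> 'a \<Rightarrow> 'a \<Rightarrow> 'a \<Rightarrow> 'a" where
  "block R d e b x y =
     d \<otimes>\<^bsub>R\<^esub> (x \<otimes>\<^bsub>R\<^esub> x \<oplus>\<^bsub>R\<^esub> e \<otimes>\<^bsub>R\<^esub> (x \<otimes>\<^bsub>R\<^esub> y) \<oplus>\<^bsub>R\<^esub> b \<otimes>\<^bsub>R\<^esub> (y \<otimes>\<^bsub>R\<^esub> y))"

text \<open>For \<open>e = 1\<close> these are the values of a quadratic Pfister form with bilinear factor
  \<open>\<langle>d 0, d 1, \<dots>\<rangle>\<close>; \<open>e = 0\<close> serves to multiply a diagonal form by \<open>\<langle>1, b\<rangle>\<close>.\<close>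

definition block_form ::
    "('a, 'm) ring_scheme \<Rightarrow> (nat \<Rightarrow> 'a) \<Rightarrow> 'a \<Rightarrow> 'a \<Rightarrow> nat \<Rightarrow> (nat \<Rightarrow> 'a) \<Rightarrow> (nat \<Rightarrow> 'a) \<Rightarrow> 'a" where
  "block_form R d e b n x y = (\<Oplus>\<^bsub>R\<^esub>s\<in>{..<n}. block R (d s) e b (x s) (y s))"

lemma (in cring) block_closed [simp]:
  "\<lbrakk>d \<in> carrier R; e \<in> carrier R; b \<in> carrier R; x \<in> carrier R; y \<in> carrier R\<rbrakk> \<Longrightarrow>
    block R d e b x y \<in> carrier R"
  by (simp add: block_def)

section \<open>Lower bounds on orders, and lowest coefficients of values\<close>

context laurent_extension
begin

text \<open>A bound on the order replaces the order itself: zero satisfies every bound and needs no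
  separate value such as infinity.\<close>

definition ord_ge :: "int \<Rightarrow> 'b \<Rightarrow> bool" where
  "ord_ge N f \<longleftrightarrow> f \<in> carrier F \<and> (\<forall>i<N. coeff f i = \<zero>\<^bsub>K\<^esub>)"

lemma ord_ge_closed: "ord_ge N f \<Longrightarrow> f \<in> carrier F"
  by (simp add: ord_ge_def)

lemma ord_ge_mono: "ord_ge N f \<Longrightarrow> M \<le> N \<Longrightarrow> ord_ge M f"
  by (simp add: ord_ge_def)

lemma ord_ge_add: "ord_ge N f \<Longrightarrow> ord_ge N g \<Longrightarrow> ord_ge N (f \<oplus>\<^bsub>F\<^esub> g)"
  by (simp add: ord_ge_def)

lemma ord_ge_mult: "ord_ge M f \<Longrightarrow> ord_ge N g \<Longrightarrow> ord_ge (M + N) (f \<otimes>\<^bsub>F\<^esub> g)"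
  using coeff_mult[of f g M N] by (simp add: ord_ge_def)

lemma coeff_mult_lead:
  "ord_ge M f \<Longrightarrow> ord_ge N g \<Longrightarrow> coeff (f \<otimes>\<^bsub>F\<^esub> g) (M + N) = coeff f M \<otimes>\<^bsub>K\<^esub> coeff g N"
  using coeff_mult[of f g M N] by (simp add: ord_ge_def)

lemma coeff_eq_zero: "ord_ge N f \<Longrightarrow> i < N \<Longrightarrow> coeff f i = \<zero>\<^bsub>K\<^esub>"
  by (simp add: ord_ge_def)

lemma ord_ge_step:
  assumes "ord_ge N f" "coeff f N = \<zero>\<^bsub>K\<^esub>" shows "ord_ge (N + 1) f"
  using assms unfolding ord_ge_def by (metis zless_add1_eq)

lemma ord_ge_ex: "f \<in> carrier F \<Longrightarrow> \<exists>N. ord_ge N f"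
  using coeff_bounded_below by (simp add: ord_ge_def)

lemma ord_ge_all: "(\<And>N. ord_ge N f) \<Longrightarrow> f = \<zero>\<^bsub>F\<^esub>"
  by (rule coeff_eq_zero_imp) (auto simp: ord_ge_def, meson zless_add1_eq)

lemma coeff_zero [simp]: "coeff \<zero>\<^bsub>F\<^esub> i = \<zero>\<^bsub>K\<^esub>"
  using coeff_add[of "\<zero>\<^bsub>F\<^esub>" "\<zero>\<^bsub>F\<^esub>" i] by (simp del: coeff_add)

lemma ord_ge_zero [simp]: "ord_ge N \<zero>\<^bsub>F\<^esub>"
  by (simp add: ord_ge_def)

lemma ord_ge_monom [simp]: "a \<in> carrier K \<Longrightarrow> ord_ge N (monom a N)"
  by (simp add: ord_ge_def)

lemma coeff_one: "coeff \<one>\<^bsub>F\<^esub> i = (if i = 0 then \<one>\<^bsub>K\<^esub> else \<zero>\<^bsub>K\<^esub>)"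
  by (simp flip: monom_one)

lemma ord_ge_one [simp]: "ord_ge 0 \<one>\<^bsub>F\<^esub>"
  by (simp add: ord_ge_def coeff_one)

lemma coeff_finsum:
  "(\<And>s. s \<in> A \<Longrightarrow> f s \<in> carrier F) \<Longrightarrow>
    coeff (\<Oplus>\<^bsub>F\<^esub>s\<in>A. f s) i = (\<Oplus>\<^bsub>K\<^esub>s\<in>A. coeff (f s) i)"
proof (induction A rule: infinite_finite_induct)
  case (insert a A)
  then show ?case by (simp add: Pi_iff)
qed simp_all

lemma ord_ge_finsum:
  assumes "\<And>s. s \<in> A \<Longrightarrow> ord_ge N (f s)" shows "ord_ge N (\<Oplus>\<^bsub>F\<^esub>s\<in>A. f s)"
  using assms by (auto simp: ord_ge_def coeff_finsum intro!: F.finsum_closed K.add.finprod_one_eqI)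

lemma ord_ge_ex_family:
  fixes x :: "nat \<Rightarrow> 'b"
  assumes "\<And>s. s < n \<Longrightarrow> x s \<in> carrier F" shows "\<exists>N. \<forall>s<n. ord_ge N (x s)"
  using assms
proof (induction n)
  case (Suc n)
  then obtain M where M: "\<forall>s<n. ord_ge M (x s)" by auto
  obtain N where N: "ord_ge N (x n)" using ord_ge_ex Suc.prems by blast
  have "\<forall>s<Suc n. ord_ge (min M N) (x s)"
    using M N by (auto simp: less_Suc_eq intro: ord_ge_mono)
  then show ?case by blast
qed simp

text \<open>The three terms have orders at least \<open>2 * N\<close>, \<open>2 * N + 1\<close> and
  \<open>-1 + 2 * (N + 1)\<close>, so only the square of \<open>x\<close> reaches the index
  \<open>2 * N\<close>.\<close>

lemma block_even:
  assumes "ord_ge 0 d" "ord_ge 0 e" "ord_ge (-1) b" "ord_ge N x" "ord_ge (N + 1) y"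
  shows "ord_ge (2 * N) (block F d e b x y)"
    and "coeff (block F d e b x y) (2 * N) = coeff d 0 \<otimes>\<^bsub>K\<^esub> (coeff x N \<otimes>\<^bsub>K\<^esub> coeff x N)"
proof -
  have xx: "ord_ge (2 * N) (x \<otimes>\<^bsub>F\<^esub> x)" "coeff (x \<otimes>\<^bsub>F\<^esub> x) (2 * N) = coeff x N \<otimes>\<^bsub>K\<^esub> coeff x N"
    using ord_ge_mult[OF assms(4,4)] coeff_mult_lead[OF assms(4,4)]
    by (simp_all only: mult_2)
  have xy: "ord_ge (2 * N + 1) (e \<otimes>\<^bsub>F\<^esub> (x \<otimes>\<^bsub>F\<^esub> y))"
    using ord_ge_mult[OF assms(2) ord_ge_mult[OF assms(4,5)]]
    by (simp only: mult_2 add.assoc add_0)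
  have yy: "ord_ge (2 * N + 1) (b \<otimes>\<^bsub>F\<^esub> (y \<otimes>\<^bsub>F\<^esub> y))"
    using ord_ge_mult[OF assms(3) ord_ge_mult[OF assms(5,5)]] by (rule ord_ge_mono) simp
  let ?s = "x \<otimes>\<^bsub>F\<^esub> x \<oplus>\<^bsub>F\<^esub> e \<otimes>\<^bsub>F\<^esub> (x \<otimes>\<^bsub>F\<^esub> y) \<oplus>\<^bsub>F\<^esub> b \<otimes>\<^bsub>F\<^esub> (y \<otimes>\<^bsub>F\<^esub> y)"
  have s: "ord_ge (2 * N) ?s"
    using xx xy yy by (auto intro!: ord_ge_add elim: ord_ge_mono)
  have "coeff ?s (2 * N) = coeff x N \<otimes>\<^bsub>K\<^esub> coeff x N"
    using xx xy yy by (simp add: ord_ge_closed[OF xx(1)] ord_ge_closed[OF xy] ord_ge_closed[OF yy]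
        coeff_eq_zero[OF xy] coeff_eq_zero[OF yy] ord_ge_closed[OF assms(4)])
  then show "ord_ge (2 * N) (block F d e b x y)"
    and "coeff (block F d e b x y) (2 * N) = coeff d 0 \<otimes>\<^bsub>K\<^esub> (coeff x N \<otimes>\<^bsub>K\<^esub> coeff x N)"
    using ord_ge_mult[OF assms(1) s] coeff_mult_lead[OF assms(1) s] by (simp_all add: block_def)
qed

text \<open>With equal bounds on \<open>x\<close> and \<open>y\<close>, the first two terms start at
  \<open>2 * N\<close>, and the factor \<open>b\<close> of order -1 puts the square of
  \<open>y\<close> alone at \<open>2 * N - 1\<close>.\<close>

lemma block_odd:
  assumes "ord_ge 0 d" "ord_ge 0 e" "ord_ge (-1) b" "ord_ge N x" "ord_ge N y"
  shows "ord_ge (2 * N - 1) (block F d e b x y)"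
    and "coeff (block F d e b x y) (2 * N - 1) =
      coeff d 0 \<otimes>\<^bsub>K\<^esub> (coeff b (-1) \<otimes>\<^bsub>K\<^esub> (coeff y N \<otimes>\<^bsub>K\<^esub> coeff y N))"
proof -
  have xx: "ord_ge (2 * N) (x \<otimes>\<^bsub>F\<^esub> x)"
    using ord_ge_mult[OF assms(4,4)] by (simp only: mult_2)
  have xy: "ord_ge (2 * N) (e \<otimes>\<^bsub>F\<^esub> (x \<otimes>\<^bsub>F\<^esub> y))"
    using ord_ge_mult[OF assms(2) ord_ge_mult[OF assms(4,5)]] by (simp only: mult_2 add_0)
  have N: "2 * N - 1 = -1 + (N + N)" by simp
  have yy: "ord_ge (2 * N - 1) (b \<otimes>\<^bsub>F\<^esub> (y \<otimes>\<^bsub>F\<^esub> y))"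
    "coeff (b \<otimes>\<^bsub>F\<^esub> (y \<otimes>\<^bsub>F\<^esub> y)) (2 * N - 1) = coeff b (-1) \<otimes>\<^bsub>K\<^esub> (coeff y N \<otimes>\<^bsub>K\<^esub> coeff y N)"
    using ord_ge_mult[OF assms(3) ord_ge_mult[OF assms(5,5)]]
      coeff_mult_lead[OF assms(3) ord_ge_mult[OF assms(5,5)]] coeff_mult_lead[OF assms(5,5)]
    by (simp_all only: N)
  let ?s = "x \<otimes>\<^bsub>F\<^esub> x \<oplus>\<^bsub>F\<^esub> e \<otimes>\<^bsub>F\<^esub> (x \<otimes>\<^bsub>F\<^esub> y) \<oplus>\<^bsub>F\<^esub> b \<otimes>\<^bsub>F\<^esub> (y \<otimes>\<^bsub>F\<^esub> y)"
  have s: "ord_ge (2 * N - 1) ?s"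
    using xx xy yy by (auto intro!: ord_ge_add elim: ord_ge_mono)
  have "coeff ?s (2 * N - 1) = coeff b (-1) \<otimes>\<^bsub>K\<^esub> (coeff y N \<otimes>\<^bsub>K\<^esub> coeff y N)"
    using xx xy yy by (simp add: ord_ge_closed[OF xx] ord_ge_closed[OF xy] ord_ge_closed[OF yy(1)]
        coeff_eq_zero[OF xx] coeff_eq_zero[OF xy] ord_ge_closed[OF assms(3)] ord_ge_closed[OF assms(5)])
  then show "ord_ge (2 * N - 1) (block F d e b x y)"
    and "coeff (block F d e b x y) (2 * N - 1) =
      coeff d 0 \<otimes>\<^bsub>K\<^esub> (coeff b (-1) \<otimes>\<^bsub>K\<^esub> (coeff y N \<otimes>\<^bsub>K\<^esub> coeff y N))"
    using ord_ge_mult[OF assms(1) s] coeff_mult_lead[OF assms(1) s] by (simp_all add: block_def)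
qed

text \<open>For \<open>b\<close> of order at least 0 all three terms start at \<open>2 * N\<close>,
  so the lowest coefficient is the value of the residue block.\<close>

lemma block_unramified:
  assumes "ord_ge 0 d" "ord_ge 0 e" "ord_ge 0 b" "ord_ge N x" "ord_ge N y"
  shows "ord_ge (2 * N) (block F d e b x y)"
    and "coeff (block F d e b x y) (2 * N) =
      block K (coeff d 0) (coeff e 0) (coeff b 0) (coeff x N) (coeff y N)"
proof -
  note cl = assms[THEN ord_ge_closed]
  note xx = ord_ge_mult[OF assms(4,4)] and xy = ord_ge_mult[OF assms(4,5)]
    and yy = ord_ge_mult[OF assms(5,5)]
  note exy = ord_ge_mult[OF assms(2) xy] and byy = ord_ge_mult[OF assms(3) yy]
  let ?s = "x \<otimes>\<^bsub>F\<^esub> x \<oplus>\<^bsub>F\<^esub> e \<otimes>\<^bsub>F\<^esub> (x \<otimes>\<^bsub>F\<^esub> y) \<oplus>\<^bsub>F\<^esub> b \<otimes>\<^bsub>F\<^esub> (y \<otimes>\<^bsub>F\<^esub> y)"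
  have s: "ord_ge (N + N) ?s"
    using xx exy byy by (auto intro!: ord_ge_add)
  show "ord_ge (2 * N) (block F d e b x y)"
    using ord_ge_mult[OF assms(1) s] by (simp only: block_def mult_2 add_0)
  show "coeff (block F d e b x y) (2 * N) =
      block K (coeff d 0) (coeff e 0) (coeff b 0) (coeff x N) (coeff y N)"
    using coeff_mult_lead[OF assms(1) s] coeff_mult_lead[OF assms(2) xy]
      coeff_mult_lead[OF assms(3) yy] coeff_mult_lead[OF assms(4,4)] coeff_mult_lead[OF assms(4,5)]
      coeff_mult_lead[OF assms(5,5)] cl
    by (simp add: block_def)
qed

lemma block_form_even:
  assumes "\<And>s. s < n \<Longrightarrow> ord_ge 0 (d s)" "ord_ge 0 e" "ord_ge (-1) b"
    and "\<And>s. s < n \<Longrightarrow> ord_ge N (x s)" "\<And>s. s < n \<Longrightarrow> ord_ge (N + 1) (y s)"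
  shows "ord_ge (2 * N) (block_form F d e b n x y)"
    and "coeff (block_form F d e b n x y) (2 * N) =
      sq_form K (\<lambda>s. coeff (d s) 0) n (\<lambda>s. coeff (x s) N)"
proof -
  have b: "ord_ge (2 * N) (block F (d s) e b (x s) (y s))"
    "coeff (block F (d s) e b (x s) (y s)) (2 * N) =
      coeff (d s) 0 \<otimes>\<^bsub>K\<^esub> (coeff (x s) N \<otimes>\<^bsub>K\<^esub> coeff (x s) N)" if "s < n" for s
    using block_even[OF assms(1)[OF that] assms(2,3) assms(4,5)[OF that]] by auto
  show "ord_ge (2 * N) (block_form F d e b n x y)"
    using b(1) by (auto simp: block_form_def intro: ord_ge_finsum)
  show "coeff (block_form F d e b n x y) (2 * N) =
      sq_form K (\<lambda>s. coeff (d s) 0) n (\<lambda>s. coeff (x s) N)"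
    unfolding block_form_def sq_form_def using assms(1,4)[THEN ord_ge_closed]
    by (subst coeff_finsum) (auto simp: b ord_ge_closed[OF b(1)] intro!: K.finsum_cong')
qed

lemma block_form_odd:
  assumes "\<And>s. s < n \<Longrightarrow> ord_ge 0 (d s)" "ord_ge 0 e" "ord_ge (-1) b" "coeff b (-1) = \<one>\<^bsub>K\<^esub>"
    and "\<And>s. s < n \<Longrightarrow> ord_ge N (x s)" "\<And>s. s < n \<Longrightarrow> ord_ge N (y s)"
  shows "ord_ge (2 * N - 1) (block_form F d e b n x y)"
    and "coeff (block_form F d e b n x y) (2 * N - 1) =
      sq_form K (\<lambda>s. coeff (d s) 0) n (\<lambda>s. coeff (y s) N)"
proof -
  have b: "ord_ge (2 * N - 1) (block F (d s) e b (x s) (y s))"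
    "coeff (block F (d s) e b (x s) (y s)) (2 * N - 1) =
      coeff (d s) 0 \<otimes>\<^bsub>K\<^esub> (coeff b (-1) \<otimes>\<^bsub>K\<^esub> (coeff (y s) N \<otimes>\<^bsub>K\<^esub> coeff (y s) N))" if "s < n" for s
    using block_odd[OF assms(1)[OF that] assms(2,3) assms(5,6)[OF that]] by auto
  show "ord_ge (2 * N - 1) (block_form F d e b n x y)"
    using b(1) by (auto simp: block_form_def intro: ord_ge_finsum)
  show "coeff (block_form F d e b n x y) (2 * N - 1) =
      sq_form K (\<lambda>s. coeff (d s) 0) n (\<lambda>s. coeff (y s) N)"
    unfolding block_form_def sq_form_def using assms(4) assms(1,6)[THEN ord_ge_closed]
    by (subst coeff_finsum) (auto simp: b ord_ge_closed[OF b(1)] intro!: K.finsum_cong')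
qed

lemma block_form_unramified:
  assumes "\<And>s. s < n \<Longrightarrow> ord_ge 0 (d s)" "ord_ge 0 e" "ord_ge 0 b"
    and "\<And>s. s < n \<Longrightarrow> ord_ge N (x s)" "\<And>s. s < n \<Longrightarrow> ord_ge N (y s)"
  shows "ord_ge (2 * N) (block_form F d e b n x y)"
    and "coeff (block_form F d e b n x y) (2 * N) =
      block_form K (\<lambda>s. coeff (d s) 0) (coeff e 0) (coeff b 0) n
        (\<lambda>s. coeff (x s) N) (\<lambda>s. coeff (y s) N)"
proof -
  have b: "ord_ge (2 * N) (block F (d s) e b (x s) (y s))"
    "coeff (block F (d s) e b (x s) (y s)) (2 * N) =
      block K (coeff (d s) 0) (coeff e 0) (coeff b 0) (coeff (x s) N) (coeff (y s) N)" if "s < n" for s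
    using block_unramified[OF assms(1)[OF that] assms(2,3) assms(4,5)[OF that]] by auto
  show "ord_ge (2 * N) (block_form F d e b n x y)"
    using b(1) by (auto simp: block_form_def intro: ord_ge_finsum)
  show "coeff (block_form F d e b n x y) (2 * N) =
      block_form K (\<lambda>s. coeff (d s) 0) (coeff e 0) (coeff b 0) n
        (\<lambda>s. coeff (x s) N) (\<lambda>s. coeff (y s) N)"
    unfolding block_form_def using assms(2,3)[THEN ord_ge_closed] assms(1,4,5)[THEN ord_ge_closed]
    by (subst coeff_finsum) (auto simp: b ord_ge_closed[OF b(1)] intro!: K.finsum_cong')
qed

end

definition block_anisotropic ::
    "('a, 'm) ring_scheme \<Rightarrow> (nat \<Rightarrow> 'a) \<Rightarrow> 'a \<Rightarrow> 'a \<Rightarrow> nat \<Rightarrow> bool" where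
  "block_anisotropic R d e b n \<longleftrightarrow>
     (\<forall>x\<in>{..<n} \<rightarrow> carrier R. \<forall>y\<in>{..<n} \<rightarrow> carrier R.
        block_form R d e b n x y = \<zero>\<^bsub>R\<^esub> \<longrightarrow> (\<forall>s<n. x s = \<zero>\<^bsub>R\<^esub> \<and> y s = \<zero>\<^bsub>R\<^esub>))"

lemma block_anisotropicD:
  assumes "block_anisotropic R d e b n" "block_form R d e b n x y = \<zero>\<^bsub>R\<^esub>"
    and "\<And>s. s < n \<Longrightarrow> x s \<in> carrier R" "\<And>s. s < n \<Longrightarrow> y s \<in> carrier R" "s < n"
  shows "x s = \<zero>\<^bsub>R\<^esub> \<and> y s = \<zero>\<^bsub>R\<^esub>"
proof -
  have "x \<in> {..<n} \<rightarrow> carrier R" "y \<in> {..<n} \<rightarrow> carrier R" using assms(3,4) by auto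
  then show ?thesis using assms(1,2,5) unfolding block_anisotropic_def by blast
qed

lemma sq_anisotropicD:
  assumes "sq_anisotropic R d n" "sq_form R d n x = \<zero>\<^bsub>R\<^esub>"
    and "\<And>s. s < n \<Longrightarrow> x s \<in> carrier R" "s < n"
  shows "x s = \<zero>\<^bsub>R\<^esub>"
proof -
  have "x \<in> {..<n} \<rightarrow> carrier R" using assms(3) by auto
  then show ?thesis using assms(1,2,4) unfolding sq_anisotropic_def by blast
qed

text \<open>Made for raising order bounds one by one. The initial bound \<open>L\<close> comes from
  boundedness below and may already exceed the target \<open>N\<close>; then the downward closure of
  \<open>P\<close> applies.\<close>

lemma int_ascending_induct:
  fixes P :: "int \<Rightarrow> bool"
  assumes "P L" "\<And>M M'. P M \<Longrightarrow> M' \<le> M \<Longrightarrow> P M'" "\<And>M. M < N \<Longrightarrow> P M \<Longrightarrow> P (M + 1)"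
  shows "P N"
proof (cases "L \<le> N")
  case True
  then have "N \<le> N \<longrightarrow> P N"
    by (induction N rule: int_ge_induct[where P = "\<lambda>i. i \<le> N \<longrightarrow> P i"]) (use assms in auto)
  then show ?thesis by simp
qed (use assms(1,2) in auto)

lemma (in abelian_monoid) finsum_lessThan_add:
  fixes f :: "nat \<Rightarrow> 'a"
  assumes "\<And>i. i < m + n \<Longrightarrow> f i \<in> carrier G"
  shows "(\<Oplus>i\<in>{..<m + n}. f i) = (\<Oplus>i\<in>{..<m}. f i) \<oplus> (\<Oplus>i\<in>{..<n}. f (m + i))"
  using assms
proof (induction n)
  case (Suc n)
  then show ?case
    by (simp add: lessThan_Suc Pi_iff a_lcomm a_assoc)
qed (simp add: Pi_iff)

section \<open>From the order of a value to the orders of the coordinates\<close>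

context laurent_extension
begin

context
  fixes d :: "nat \<Rightarrow> 'b" and e b :: 'b and n :: nat
  assumes d: "\<And>s. s < n \<Longrightarrow> ord_ge 0 (d s)" and e: "ord_ge 0 e"
    and b: "ord_ge (-1) b" "coeff b (-1) = \<one>\<^bsub>K\<^esub>"
    and aniso: "sq_anisotropic K (\<lambda>s. coeff (d s) 0) n"
begin

text \<open>A common bound \<open>M < N\<close> can be raised in two half steps. The coefficient of
  the value at \<open>2 * M - 1\<close> is the anisotropic residue form at the \<open>y\<close>, so
  these gain one order; after that the coefficient at \<open>2 * M\<close> is the residue form at
  the \<open>x\<close>.\<close>

lemma block_form_ord_odd:
  assumes "\<And>s. s < n \<Longrightarrow> x s \<in> carrier F" "\<And>s. s < n \<Longrightarrow> y s \<in> carrier F"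
    and G: "ord_ge (2 * N - 1) (block_form F d e b n x y)"
  shows "\<forall>s<n. ord_ge N (x s) \<and> ord_ge N (y s)"
proof -
  let ?P = "\<lambda>N. \<forall>s<n. ord_ge N (x s) \<and> ord_ge N (y s)"
  obtain L M where "\<forall>s<n. ord_ge L (x s)" "\<forall>s<n. ord_ge M (y s)"
    using ord_ge_ex_family[of n x] ord_ge_ex_family[of n y] assms by blast
  then have "?P (min L M)" by (auto intro: ord_ge_mono)
  then show "?P N"
  proof (rule int_ascending_induct[where P = ?P])
    fix M assume "M < N" and P: "?P M"
    have "sq_form K (\<lambda>s. coeff (d s) 0) n (\<lambda>s. coeff (y s) M) = \<zero>\<^bsub>K\<^esub>"
      using block_form_odd(2)[of n d e b M x y] d e b P coeff_eq_zero[OF G, of "2 * M - 1"] \<open>M < N\<close> by simp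
    then have "\<forall>s<n. coeff (y s) M = \<zero>\<^bsub>K\<^esub>"
      using aniso assms(2) by (auto simp: sq_anisotropic_def)
    then have y: "\<forall>s<n. ord_ge (M + 1) (y s)" using P ord_ge_step by blast
    have "sq_form K (\<lambda>s. coeff (d s) 0) n (\<lambda>s. coeff (x s) M) = \<zero>\<^bsub>K\<^esub>"
      using block_form_even(2)[of n d e b M x y] d e b P y coeff_eq_zero[OF G, of "2 * M"] \<open>M < N\<close> by simp
    then have "\<forall>s<n. coeff (x s) M = \<zero>\<^bsub>K\<^esub>"
      using aniso assms(1) by (auto simp: sq_anisotropic_def)
    then show "?P (M + 1)" using P y ord_ge_step by blast
  qed (use ord_ge_mono in blast)
qed

text \<open>One half step beyond \<open>block_form_ord_odd\<close>: the index
  \<open>2 * N - 1\<close> now lies below the order of the value, and this affects the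
  \<open>y\<close> only.\<close>

lemma block_form_ord_even:
  assumes "\<And>s. s < n \<Longrightarrow> x s \<in> carrier F" "\<And>s. s < n \<Longrightarrow> y s \<in> carrier F"
    and G: "ord_ge (2 * N) (block_form F d e b n x y)"
  shows "\<forall>s<n. ord_ge N (x s) \<and> ord_ge (N + 1) (y s)"
proof -
  have P: "\<forall>s<n. ord_ge N (x s) \<and> ord_ge N (y s)"
    by (rule block_form_ord_odd) (use assms(1,2) ord_ge_mono[OF G] in auto)
  have "sq_form K (\<lambda>s. coeff (d s) 0) n (\<lambda>s. coeff (y s) N) = \<zero>\<^bsub>K\<^esub>"
    using block_form_odd(2)[of n d e b N x y] d e b P coeff_eq_zero[OF G, of "2 * N - 1"] by simp
  then have "\<forall>s<n. coeff (y s) N = \<zero>\<^bsub>K\<^esub>"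
    using aniso assms(2) by (auto simp: sq_anisotropic_def)
  then show ?thesis using P ord_ge_step by blast
qed

text \<open>The value zero satisfies every order bound, hence so do all coordinates.\<close>

lemma block_form_anisotropic: "block_anisotropic F d e b n"
  unfolding block_anisotropic_def
proof (intro ballI impI)
  fix x y assume xy: "x \<in> {..<n} \<rightarrow> carrier F" "y \<in> {..<n} \<rightarrow> carrier F"
    and "block_form F d e b n x y = \<zero>\<^bsub>F\<^esub>"
  then have "\<forall>s<n. ord_ge N (x s) \<and> ord_ge N (y s)" for N
    by (intro block_form_ord_odd) auto
  then show "\<forall>s<n. x s = \<zero>\<^bsub>F\<^esub> \<and> y s = \<zero>\<^bsub>F\<^esub>" using ord_ge_all by blast
qed

end

text \<open>On the first half of the coordinates the values have even order, on the second half odd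
  order. Formally the halves are the \<open>x\<close> and \<open>y\<close> of a block form with
  \<open>e = 0\<close>.\<close>

lemma sq_anisotropic_extend:
  assumes d: "\<And>s. s < n \<Longrightarrow> ord_ge 0 (d s)"
    and b: "ord_ge (-1) b" "coeff b (-1) = \<one>\<^bsub>K\<^esub>"
    and aniso: "sq_anisotropic K (\<lambda>s. coeff (d s) 0) n"
    and d': "\<And>s. s < n \<Longrightarrow> d' s = d s" "\<And>s. s < n \<Longrightarrow> d' (n + s) = b \<otimes>\<^bsub>F\<^esub> d s"
  shows "sq_anisotropic F d' (n + n)"
  unfolding sq_anisotropic_def
proof (intro ballI impI)
  fix x assume x: "x \<in> {..<n + n} \<rightarrow> carrier F" and zero: "sq_form F d' (n + n) x = \<zero>\<^bsub>F\<^esub>"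
  note cl = d[THEN ord_ge_closed] b(1)[THEN ord_ge_closed]
  have xcl: "x s \<in> carrier F" "x (n + s) \<in> carrier F" if "s < n" for s
    using x that by auto
  have d'cl: "d' s \<in> carrier F" if "s < n + n" for s
    using d'(1)[of s] d'(2)[of "s - n"] cl that by (cases "s < n") auto
  have "sq_form F d' (n + n) x =
      (\<Oplus>\<^bsub>F\<^esub>s\<in>{..<n}. d' s \<otimes>\<^bsub>F\<^esub> (x s \<otimes>\<^bsub>F\<^esub> x s)) \<oplus>\<^bsub>F\<^esub>
      (\<Oplus>\<^bsub>F\<^esub>s\<in>{..<n}. d' (n + s) \<otimes>\<^bsub>F\<^esub> (x (n + s) \<otimes>\<^bsub>F\<^esub> x (n + s)))"
    unfolding sq_form_def using x d'cl by (intro F.finsum_lessThan_add) auto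
  also have "\<dots> = (\<Oplus>\<^bsub>F\<^esub>s\<in>{..<n}. d' s \<otimes>\<^bsub>F\<^esub> (x s \<otimes>\<^bsub>F\<^esub> x s) \<oplus>\<^bsub>F\<^esub>
      d' (n + s) \<otimes>\<^bsub>F\<^esub> (x (n + s) \<otimes>\<^bsub>F\<^esub> x (n + s)))"
    using xcl d'cl by (intro F.finsum_addf[symmetric]) auto
  also have "\<dots> = block_form F d \<zero>\<^bsub>F\<^esub> b n x (\<lambda>s. x (n + s))"
    unfolding block_form_def
  proof (intro F.finsum_cong')
    fix s assume "s \<in> {..<n}"
    then have s: "s < n" by simp
    show "d' s \<otimes>\<^bsub>F\<^esub> (x s \<otimes>\<^bsub>F\<^esub> x s) \<oplus>\<^bsub>F\<^esub> d' (n + s) \<otimes>\<^bsub>F\<^esub> (x (n + s) \<otimes>\<^bsub>F\<^esub> x (n + s)) =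
        block F (d s) \<zero>\<^bsub>F\<^esub> b (x s) (x (n + s))"
      using s cl xcl[OF s] by (simp add: d' block_def F.r_distr F.m_assoc F.m_lcomm)
  qed (use cl xcl in auto)
  finally have "block_form F d \<zero>\<^bsub>F\<^esub> b n x (\<lambda>s. x (n + s)) = \<zero>\<^bsub>F\<^esub>" using zero by simp
  with block_form_anisotropic[OF d ord_ge_zero b aniso] xcl
  have *: "\<forall>s<n. x s = \<zero>\<^bsub>F\<^esub> \<and> x (n + s) = \<zero>\<^bsub>F\<^esub>"
    by (auto simp: block_anisotropic_def Pi_iff)
  show "\<forall>s<n + n. x s = \<zero>\<^bsub>F\<^esub>"
  proof (intro allI impI)
    fix s assume "s < n + n"
    then show "x s = \<zero>\<^bsub>F\<^esub>" using * spec[OF *, of "s - n"] by (cases "s < n") auto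
  qed
qed

text \<open>The coefficient at \<open>2 * M\<close> is the residue form at both families of
  coordinates at once. The odd bound \<open>2 * N - 1\<close> already yields \<open>N\<close>, since
  no value has odd order; this rounding up drives \<open>unramified_eq_ramified\<close>.\<close>

lemma block_form_ord_unramified:
  assumes d: "\<And>s. s < n \<Longrightarrow> ord_ge 0 (d s)" and e: "ord_ge 0 e" and b: "ord_ge 0 b"
    and aniso: "block_anisotropic K (\<lambda>s. coeff (d s) 0) (coeff e 0) (coeff b 0) n"
    and xy: "\<And>s. s < n \<Longrightarrow> x s \<in> carrier F" "\<And>s. s < n \<Longrightarrow> y s \<in> carrier F"
    and G: "ord_ge (2 * N - 1) (block_form F d e b n x y)"
  shows "\<forall>s<n. ord_ge N (x s) \<and> ord_ge N (y s)"
proof -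
  let ?P = "\<lambda>N. \<forall>s<n. ord_ge N (x s) \<and> ord_ge N (y s)"
  obtain L M where "\<forall>s<n. ord_ge L (x s)" "\<forall>s<n. ord_ge M (y s)"
    using ord_ge_ex_family[of n x] ord_ge_ex_family[of n y] xy by blast
  then have "?P (min L M)" by (auto intro: ord_ge_mono)
  then show "?P N"
  proof (rule int_ascending_induct[where P = ?P])
    fix M assume "M < N" and P: "?P M"
    have "block_form K (\<lambda>s. coeff (d s) 0) (coeff e 0) (coeff b 0) n
        (\<lambda>s. coeff (x s) M) (\<lambda>s. coeff (y s) M) = \<zero>\<^bsub>K\<^esub>"
      using block_form_unramified(2)[of n d e b M x y] d e b P coeff_eq_zero[OF G, of "2 * M"] \<open>M < N\<close> by simp
    then have "\<forall>s<n. coeff (x s) M = \<zero>\<^bsub>K\<^esub> \<and> coeff (y s) M = \<zero>\<^bsub>K\<^esub>"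
      by (intro allI impI block_anisotropicD[OF aniso]) (use xy in auto)
    then show "?P (M + 1)" using P ord_ge_step by blast
  qed (use ord_ge_mono in blast)
qed

text \<open>The two sides raise each other's bounds. If \<open>x\<close> and \<open>y\<close> have
  order at least \<open>M\<close>, the common value has order at least \<open>2 * M\<close>, so
  \<open>y'\<close> has order at least \<open>M + 1\<close> and only \<open>x'\<close> is seen at
  \<open>2 * M\<close>. For \<open>M < L\<close> that coefficient vanishes, and the unramified side
  rounds \<open>2 * M + 1\<close> up to \<open>2 * (M + 1)\<close>. The climb stops at
  \<open>L\<close>, where the coefficients at \<open>2 * L\<close> are compared.\<close>

lemma unramified_eq_ramified:
  assumes d: "\<And>s. s < n \<Longrightarrow> ord_ge 0 (d s)" and b: "ord_ge 0 b"
    and aniso: "block_anisotropic K (\<lambda>s. coeff (d s) 0) \<one>\<^bsub>K\<^esub> (coeff b 0) n"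
    and d': "\<And>s. s < n \<Longrightarrow> ord_ge 0 (d' s)" and b': "ord_ge (-1) b'" "coeff b' (-1) = \<one>\<^bsub>K\<^esub>"
    and aniso': "sq_anisotropic K (\<lambda>s. coeff (d' s) 0) n"
    and xy: "\<And>s. s < n \<Longrightarrow> x s \<in> carrier F" "\<And>s. s < n \<Longrightarrow> y s \<in> carrier F"
    and x'y': "\<And>s. s < n \<Longrightarrow> ord_ge L (x' s)" "\<And>s. s < n \<Longrightarrow> y' s \<in> carrier F"
    and eq: "block_form F d \<one>\<^bsub>F\<^esub> b n x y = block_form F d' \<one>\<^bsub>F\<^esub> b' n x' y'"
  shows "\<forall>s<n. ord_ge L (x s) \<and> ord_ge L (y s)"
    and "block_form K (\<lambda>s. coeff (d s) 0) \<one>\<^bsub>K\<^esub> (coeff b 0) n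
        (\<lambda>s. coeff (x s) L) (\<lambda>s. coeff (y s) L) =
      sq_form K (\<lambda>s. coeff (d' s) 0) n (\<lambda>s. coeff (x' s) L)"
proof -
  note x'cl = x'y'(1)[THEN ord_ge_closed]
  let ?P = "\<lambda>N. \<forall>s<n. ord_ge N (x s) \<and> ord_ge N (y s)"
  have aniso1: "block_anisotropic K (\<lambda>s. coeff (d s) 0) (coeff \<one>\<^bsub>F\<^esub> 0) (coeff b 0) n"
    using aniso by (simp add: coeff_one)
  have step: "\<forall>s<n. ord_ge M (x' s) \<and> ord_ge (M + 1) (y' s)" if "?P M" for M
  proof -
    have "ord_ge (2 * M) (block_form F d' \<one>\<^bsub>F\<^esub> b' n x' y')"
      unfolding eq[symmetric] using that by (intro block_form_unramified(1) d b) auto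
    then show ?thesis by (intro block_form_ord_even[OF d' ord_ge_one b' aniso' x'cl x'y'(2)])
  qed
  obtain A B where "\<forall>s<n. ord_ge A (x s)" "\<forall>s<n. ord_ge B (y s)"
    using ord_ge_ex_family[of n x] ord_ge_ex_family[of n y] xy by blast
  then have "?P (min A B)" by (auto intro: ord_ge_mono)
  then show P: "?P L"
  proof (rule int_ascending_induct[where P = ?P])
    fix M assume "M < L" and P: "?P M"
    have "ord_ge (2 * M) (block_form F d' \<one>\<^bsub>F\<^esub> b' n x' y')"
      using step[OF P] by (intro block_form_even(1) d' b') auto
    moreover have "coeff (block_form F d' \<one>\<^bsub>F\<^esub> b' n x' y') (2 * M) = \<zero>\<^bsub>K\<^esub>"
    proof -
      have "coeff (block_form F d' \<one>\<^bsub>F\<^esub> b' n x' y') (2 * M) =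
          sq_form K (\<lambda>s. coeff (d' s) 0) n (\<lambda>s. coeff (x' s) M)"
        using step[OF P] by (intro block_form_even(2) d' b') auto
      also have "\<dots> = \<zero>\<^bsub>K\<^esub>"
        unfolding sq_form_def using coeff_eq_zero[OF x'y'(1) \<open>M < L\<close>] d'[THEN ord_ge_closed]
        by (intro K.add.finprod_one_eqI) simp
      finally show ?thesis .
    qed
    ultimately have "ord_ge (2 * M + 1) (block_form F d' \<one>\<^bsub>F\<^esub> b' n x' y')" by (rule ord_ge_step)
    \<comment> \<open>The bound \<open>2 * M + 1\<close> equals \<open>2 * (M + 1) - 1\<close>, the
      form required by \<open>block_form_ord_unramified\<close>.\<close>
    then show "?P (M + 1)"
      unfolding eq[symmetric]
      by (intro block_form_ord_unramified[OF d ord_ge_one b aniso1 xy]) (auto simp: algebra_simps)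
  qed (use ord_ge_mono in blast)
  have "coeff (block_form F d \<one>\<^bsub>F\<^esub> b n x y) (2 * L) =
      block_form K (\<lambda>s. coeff (d s) 0) (coeff \<one>\<^bsub>F\<^esub> 0) (coeff b 0) n
        (\<lambda>s. coeff (x s) L) (\<lambda>s. coeff (y s) L)"
    using P by (intro block_form_unramified(2) d b) auto
  moreover have "coeff (block_form F d' \<one>\<^bsub>F\<^esub> b' n x' y') (2 * L) =
      sq_form K (\<lambda>s. coeff (d' s) 0) n (\<lambda>s. coeff (x' s) L)"
    using step[OF P] by (intro block_form_even(2) d' b') auto
  ultimately show "block_form K (\<lambda>s. coeff (d s) 0) \<one>\<^bsub>K\<^esub> (coeff b 0) n
        (\<lambda>s. coeff (x s) L) (\<lambda>s. coeff (y s) L) =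
      sq_form K (\<lambda>s. coeff (d' s) 0) n (\<lambda>s. coeff (x' s) L)"
    using eq by (simp add: coeff_one)
qed

end

section \<open>Linear maps and homogeneous systems\<close>

definition linear_map ::
    "('a, 'm) ring_scheme \<Rightarrow> nat \<Rightarrow> nat \<Rightarrow> ((nat \<Rightarrow> 'a) \<Rightarrow> (nat \<Rightarrow> 'a)) \<Rightarrow> bool" where
  "linear_map F d e T \<longleftrightarrow>
     T \<in> coord_space F d \<rightarrow> coord_space F e \<and>
     (\<forall>x\<in>coord_space F d. \<forall>y\<in>coord_space F d.
        T (\<lambda>i\<in>{..<d}. x i \<oplus>\<^bsub>F\<^esub> y i) = (\<lambda>i\<in>{..<e}. T x i \<oplus>\<^bsub>F\<^esub> T y i)) \<and>
     (\<forall>c\<in>carrier F. \<forall>x\<in>coord_space F d.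
        T (\<lambda>i\<in>{..<d}. c \<otimes>\<^bsub>F\<^esub> x i) = (\<lambda>i\<in>{..<e}. c \<otimes>\<^bsub>F\<^esub> T x i))"

lemma coord_space_nth: "x \<in> coord_space F d \<Longrightarrow> i < d \<Longrightarrow> x i \<in> carrier F"
  by (auto simp: coord_space_def)

lemma coord_space_restrict: "(\<And>i. i < d \<Longrightarrow> x i \<in> carrier F) \<Longrightarrow> (\<lambda>i\<in>{..<d}. x i) \<in> coord_space F d"
  by (auto simp: coord_space_def)

lemma linear_map_closed: "linear_map F d e T \<Longrightarrow> x \<in> coord_space F d \<Longrightarrow> T x \<in> coord_space F e"
  by (auto simp: linear_map_def)

lemma linear_map_add:
  "linear_map F d e T \<Longrightarrow> x \<in> coord_space F d \<Longrightarrow> y \<in> coord_space F d \<Longrightarrow> i < e \<Longrightarrow>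
    T (\<lambda>i\<in>{..<d}. x i \<oplus>\<^bsub>F\<^esub> y i) i = T x i \<oplus>\<^bsub>F\<^esub> T y i"
  by (simp add: linear_map_def)

lemma linear_map_scale:
  "linear_map F d e T \<Longrightarrow> c \<in> carrier F \<Longrightarrow> x \<in> coord_space F d \<Longrightarrow> i < e \<Longrightarrow>
    T (\<lambda>i\<in>{..<d}. c \<otimes>\<^bsub>F\<^esub> x i) i = c \<otimes>\<^bsub>F\<^esub> T x i"
  by (simp add: linear_map_def)

text \<open>The vector is built up by its truncations to the first \<open>m\<close> coordinates,
  each adding a multiple of one unit vector.\<close>

lemma (in cring) linear_map_matrix:
  assumes T: "linear_map R d e T" and x: "x \<in> coord_space R d" and i: "i < e"
  shows "T x i = (\<Oplus>j\<in>{..<d}. T (\<lambda>l\<in>{..<d}. if l = j then \<one> else \<zero>) i \<otimes> x j)"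
proof -
  let ?u = "\<lambda>j. \<lambda>l\<in>{..<d}. if l = j then \<one> else \<zero>"
  have u: "?u j \<in> coord_space R d" for j by (rule coord_space_restrict) simp
  have Tu: "T (?u j) i \<in> carrier R" for j
    using coord_space_nth[OF linear_map_closed[OF T u] i] .
  have "T (\<lambda>l\<in>{..<d}. if l < m then x l else \<zero>) i = (\<Oplus>j\<in>{..<m}. T (?u j) i \<otimes> x j)"
    if "m \<le> d" for m
    using that
  proof (induction m)
    case 0
    \<comment> \<open>The zero vector is written as a zero multiple, so that homogeneity gives its
      image.\<close>
    have "(\<lambda>l\<in>{..<d}. \<zero> \<otimes> ?u 0 l) = (\<lambda>l\<in>{..<d}. \<zero>)" by (auto simp: restrict_def)
    then have "T (\<lambda>l\<in>{..<d}. \<zero>) i = \<zero> \<otimes> T (?u 0) i"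
      using linear_map_scale[OF T zero_closed u i, of 0] by simp
    moreover have "(\<lambda>l\<in>{..<d}. if l < 0 then x l else \<zero>) = (\<lambda>l\<in>{..<d}. \<zero>)" by simp
    ultimately show ?case using Tu by (simp only:) simp
  next
    case (Suc m)
    have xm: "x m \<in> carrier R" using Suc.prems coord_space_nth[OF x, of m] by simp
    have cl: "(\<lambda>l\<in>{..<d}. if l < m then x l else \<zero>) \<in> coord_space R d"
      "(\<lambda>l\<in>{..<d}. x m \<otimes> ?u m l) \<in> coord_space R d"
      using coord_space_nth[OF x] xm by (auto intro!: coord_space_restrict)
    have split: "(\<lambda>l\<in>{..<d}. if l < Suc m then x l else \<zero>) =
        (\<lambda>l\<in>{..<d}. (\<lambda>l\<in>{..<d}. if l < m then x l else \<zero>) l \<oplus> (\<lambda>l\<in>{..<d}. x m \<otimes> ?u m l) l)"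
      using coord_space_nth[OF x] xm by (auto simp: fun_eq_iff less_Suc_eq)
    have IH: "T (\<lambda>l\<in>{..<d}. if l < m then x l else \<zero>) i = (\<Oplus>j\<in>{..<m}. T (?u j) i \<otimes> x j)"
      using Suc.prems by (intro Suc.IH) simp
    have "T (\<lambda>l\<in>{..<d}. if l < Suc m then x l else \<zero>) i =
        (\<Oplus>j\<in>{..<m}. T (?u j) i \<otimes> x j) \<oplus> x m \<otimes> T (?u m) i"
      by (simp only: split linear_map_add[OF T cl i] linear_map_scale[OF T xm u i, of m] IH)
    also have "\<dots> = (\<Oplus>j\<in>{..<Suc m}. T (?u j) i \<otimes> x j)"
    proof -
      define t where "t j = T (?u j) i" for j
      have t: "t j \<in> carrier R" for j using Tu by (simp only: t_def)
      have xj: "x j \<in> carrier R" if "j \<le> m" for j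
        using Suc.prems that coord_space_nth[OF x, of j] by simp
      have "(\<Oplus>j\<in>{..<Suc m}. t j \<otimes> x j) = t m \<otimes> x m \<oplus> (\<Oplus>j\<in>{..<m}. t j \<otimes> x j)"
        unfolding lessThan_Suc using t xj by (intro finsum_insert) auto
      also have "\<dots> = (\<Oplus>j\<in>{..<m}. t j \<otimes> x j) \<oplus> x m \<otimes> t m"
        using t xj by (simp add: a_comm m_comm Pi_iff)
      finally show ?thesis by (simp only: t_def)
    qed
    finally show ?case .
  qed
  from this[of d] have "T (\<lambda>l\<in>{..<d}. if l < d then x l else \<zero>) i = (\<Oplus>j\<in>{..<d}. T (?u j) i \<otimes> x j)"
    by simp
  moreover have "(\<lambda>l\<in>{..<d}. if l < d then x l else \<zero>) = x"
    using x by (auto simp: coord_space_def PiE_def extensional_def restrict_def fun_eq_iff)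
  ultimately show ?thesis by simp
qed

text \<open>Gaussian elimination without division: the rows are multiplied by the pivot
  \<open>A m p\<close> of the last row before the column \<open>p\<close> is cleared.\<close>

lemma (in domain) homogeneous_system_solution:
  assumes "finite J" "m < card J" "\<And>i j. i < m \<Longrightarrow> j \<in> J \<Longrightarrow> A i j \<in> carrier R"
  shows "\<exists>x. (\<forall>j\<in>J. x j \<in> carrier R) \<and> (\<exists>j\<in>J. x j \<noteq> \<zero>) \<and> (\<forall>i<m. (\<Oplus>j\<in>J. A i j \<otimes> x j) = \<zero>)"
  using assms
proof (induction m arbitrary: J A)
  case 0
  then have "J \<noteq> {}" by auto
  then show ?case by (intro exI[of _ "\<lambda>_. \<one>"]) auto
next
  case (Suc m)
  show ?case
  proof (cases "\<forall>j\<in>J. A m j = \<zero>")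
    case True
    obtain x where x: "\<forall>j\<in>J. x j \<in> carrier R" "\<exists>j\<in>J. x j \<noteq> \<zero>"
      "\<forall>i<m. (\<Oplus>j\<in>J. A i j \<otimes> x j) = \<zero>"
      using Suc.IH[of J A] Suc.prems by auto
    have "(\<Oplus>j\<in>J. A m j \<otimes> x j) = \<zero>"
      using True x(1) by (intro add.finprod_one_eqI) auto
    then show ?thesis using x by (auto simp: less_Suc_eq)
  next
    case False
    then obtain p where p: "p \<in> J" "A m p \<noteq> \<zero>" by blast
    let ?J = "J - {p}" and ?A = "\<lambda>i j. A m p \<otimes> A i j \<ominus> A i p \<otimes> A m j"
    have Acl: "A i j \<in> carrier R" if "i \<le> m" "j \<in> J" for i j
      using Suc.prems(3) that by simp
    obtain y where y: "\<And>j. j \<in> ?J \<Longrightarrow> y j \<in> carrier R" "\<exists>j\<in>?J. y j \<noteq> \<zero>"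
      "\<And>i. i < m \<Longrightarrow> (\<Oplus>j\<in>?J. ?A i j \<otimes> y j) = \<zero>"
    proof -
      have "m < card ?J" using Suc.prems(1,2) p by simp
      then have "\<exists>x. (\<forall>j\<in>?J. x j \<in> carrier R) \<and> (\<exists>j\<in>?J. x j \<noteq> \<zero>) \<and>
          (\<forall>i<m. (\<Oplus>j\<in>?J. ?A i j \<otimes> x j) = \<zero>)"
        using Suc.prems(1) Acl p by (intro Suc.IH) auto
      then show thesis using that by blast
    qed
    \<comment> \<open>Eliminating the last row with itself gives a zero row; with
      \<open>i = m\<close> included, all original equations can be checked by one
      computation.\<close>
    have ym: "(\<Oplus>j\<in>?J. ?A i j \<otimes> y j) = \<zero>" if "i \<le> m" for i
    proof (cases "i = m")
      case True
      have "?A m j \<otimes> y j = \<zero>" if "j \<in> ?J" for j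
        using Acl[of m j] Acl[of m p] p y(1)[OF that] that by (simp add: r_neg minus_eq)
      then show ?thesis using True by (intro add.finprod_one_eqI) auto
    qed (use y(3) that in auto)
    \<comment> \<open>Over the fraction field the last equation would be solved for the coordinate
      \<open>p\<close> by dividing by the pivot. Here the other coordinates are multiplied by the
      pivot instead.\<close>
    define x where "x j = (if j = p then \<ominus> (\<Oplus>j\<in>?J. A m j \<otimes> y j) else A m p \<otimes> y j)" for j
    have S: "(\<Oplus>j\<in>?J. A m j \<otimes> y j) \<in> carrier R"
      using Acl y(1) by (intro finsum_closed) auto
    have xcl: "x j \<in> carrier R" if "j \<in> J" for j
      using that S y(1)[of j] Acl[of m p] p by (simp add: x_def)
    have "(\<Oplus>j\<in>J. A i j \<otimes> x j) = \<zero>" if i: "i < Suc m" for i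
    proof -
      have Aip: "A i p \<in> carrier R" using Acl[of i p] i p by simp
      have "J = insert p ?J" using p by blast
      then have "(\<Oplus>j\<in>J. A i j \<otimes> x j) = (\<Oplus>j\<in>insert p ?J. A i j \<otimes> x j)" by simp
      also have "\<dots> = A i p \<otimes> x p \<oplus> (\<Oplus>j\<in>?J. A i j \<otimes> x j)"
        using Suc.prems(1) xcl Acl[of i] i p by (intro finsum_insert) auto
      also have "A i p \<otimes> x p = (\<Oplus>j\<in>?J. (\<ominus> A i p) \<otimes> (A m j \<otimes> y j))"
        using Suc.prems(1) S Aip y(1) Acl[of m]
        by (simp add: x_def r_minus l_minus finsum_rdistr[symmetric] Pi_iff)
      also have "\<dots> \<oplus> (\<Oplus>j\<in>?J. A i j \<otimes> x j) =
          (\<Oplus>j\<in>?J. (\<ominus> A i p) \<otimes> (A m j \<otimes> y j) \<oplus> A i j \<otimes> x j)"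
        using xcl Acl i y(1) p Aip by (intro finsum_addf[symmetric]) auto
      also have "\<dots> = (\<Oplus>j\<in>?J. ?A i j \<otimes> y j)"
      proof (intro finsum_cong')
        fix j assume j: "j \<in> ?J"
        then have "x j = A m p \<otimes> y j" by (simp add: x_def)
        moreover have "A m j \<in> carrier R" "A i j \<in> carrier R" "A m p \<in> carrier R" "y j \<in> carrier R"
          using Acl i p j y(1) by auto
        ultimately show "(\<ominus> A i p) \<otimes> (A m j \<otimes> y j) \<oplus> A i j \<otimes> x j = ?A i j \<otimes> y j"
          using Aip by algebra
      qed (use Acl i y(1) p Aip in auto)
      finally show ?thesis using ym i by simp
    qed
    moreover have "\<exists>j\<in>J. x j \<noteq> \<zero>"
    proof -
      obtain j where j: "j \<in> ?J" "y j \<noteq> \<zero>" using y(2) by blast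
      then have "A m p \<otimes> y j \<noteq> \<zero>" using integral[of "A m p" "y j"] p Acl[of m p] y(1) by auto
      then show ?thesis using j by (intro bexI[of _ j]) (auto simp: x_def)
    qed
    ultimately show ?thesis using xcl by blast
  qed
qed

text \<open>With the axis vector as an additional column there are \<open>n\<close> equations in
  \<open>n + 1\<close> unknowns. In a nontrivial solution the additional unknown is nonzero, for
  otherwise the remaining ones would contradict injectivity; its negative is
  \<open>c\<close>.\<close>

lemma (in domain) injective_matrix_hits_axis:
  fixes A :: "nat \<Rightarrow> nat \<Rightarrow> 'a"
  assumes A: "\<And>i j. i < n \<Longrightarrow> j < n \<Longrightarrow> A i j \<in> carrier R"
    and inj: "\<And>x. (\<And>j. j < n \<Longrightarrow> x j \<in> carrier R) \<Longrightarrow>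
      (\<And>i. i < n \<Longrightarrow> (\<Oplus>j\<in>{..<n}. A i j \<otimes> x j) = \<zero>) \<Longrightarrow> \<forall>j<n. x j = \<zero>"
  shows "\<exists>x c. (\<forall>j<n. x j \<in> carrier R) \<and> c \<in> carrier R \<and> c \<noteq> \<zero> \<and>
    (\<forall>i<n. (\<Oplus>j\<in>{..<n}. A i j \<otimes> x j) = (if i = k then c else \<zero>))"
proof -
  let ?B = "\<lambda>i j. if j = n then if i = k then \<one> else \<zero> else A i j"
  obtain x where x: "\<forall>j\<in>{..n}. x j \<in> carrier R" "\<exists>j\<in>{..n}. x j \<noteq> \<zero>"
    "\<forall>i<n. (\<Oplus>j\<in>{..n}. ?B i j \<otimes> x j) = \<zero>"
  proof -
    have "\<exists>x. (\<forall>j\<in>{..n}. x j \<in> carrier R) \<and> (\<exists>j\<in>{..n}. x j \<noteq> \<zero>) \<and>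
        (\<forall>i<n. (\<Oplus>j\<in>{..n}. ?B i j \<otimes> x j) = \<zero>)"
      using A by (intro homogeneous_system_solution) auto
    then show thesis using that by blast
  qed
  have xcl: "x j \<in> carrier R" if "j \<le> n" for j using x(1) that by simp
  have S: "(\<Oplus>j\<in>{..<n}. A i j \<otimes> x j) = \<ominus> (?B i n \<otimes> x n)" if i: "i < n" for i
  proof -
    have cl: "(\<Oplus>j\<in>{..<n}. A i j \<otimes> x j) \<in> carrier R"
      using A i xcl by (intro finsum_closed) auto
    have "(\<Oplus>j\<in>{..n}. ?B i j \<otimes> x j) = (\<Oplus>j\<in>insert n {..<n}. ?B i j \<otimes> x j)"
      by (metis lessThan_Suc lessThan_Suc_atMost)
    also have "\<dots> = ?B i n \<otimes> x n \<oplus> (\<Oplus>j\<in>{..<n}. ?B i j \<otimes> x j)"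
      using A i xcl by (intro finsum_insert) auto
    also have "(\<Oplus>j\<in>{..<n}. ?B i j \<otimes> x j) = (\<Oplus>j\<in>{..<n}. A i j \<otimes> x j)"
      using A i xcl by (intro finsum_cong') auto
    finally have "?B i n \<otimes> x n \<oplus> (\<Oplus>j\<in>{..<n}. A i j \<otimes> x j) = \<zero>" using x(3) i by simp
    moreover have B: "?B i n \<otimes> x n \<in> carrier R" using xcl[of n] by simp
    ultimately have "(\<Oplus>j\<in>{..<n}. A i j \<otimes> x j) \<oplus> ?B i n \<otimes> x n = \<zero>"
      by (subst a_comm[OF cl B])
    then show ?thesis by (rule sum_zero_eq_neg[OF cl B])
  qed
  have "x n \<noteq> \<zero>"
  proof
    assume "x n = \<zero>"
    then have "(\<Oplus>j\<in>{..<n}. A i j \<otimes> x j) = \<zero>" if "i < n" for i using S[OF that] by simp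
    then have "\<forall>j<n. x j = \<zero>" using xcl by (intro inj) auto
    then have "x j = \<zero>" if "j \<le> n" for j using that \<open>x n = \<zero>\<close> by (cases "j = n") simp_all
    then show False using x(2) by blast
  qed
  then have "\<ominus> x n \<noteq> \<zero>" using xcl[of n] by simp
  moreover have "(\<Oplus>j\<in>{..<n}. A i j \<otimes> x j) = (if i = k then \<ominus> x n else \<zero>)" if "i < n" for i
    using S[OF that] xcl[of n] by simp
  ultimately show ?thesis
    using xcl by (intro exI[of _ x] exI[of _ "\<ominus> x n"]) simp
qed

section \<open>Residues of common subforms\<close>

context cring
begin

context
  assumes two: "\<one> \<oplus> \<one> = \<zero>"
begin

lemma add_self: "x \<in> carrier R \<Longrightarrow> x \<oplus> x = \<zero>"
  using l_distr[OF one_closed one_closed, of x] two by simp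

lemma add_eq_zero_iff: "x \<in> carrier R \<Longrightarrow> y \<in> carrier R \<Longrightarrow> x \<oplus> y = \<zero> \<Longrightarrow> x = y"
  by (metis add_self add.l_cancel)

lemma square_add:
  assumes "x \<in> carrier R" "y \<in> carrier R"
  shows "(x \<oplus> y) \<otimes> (x \<oplus> y) = x \<otimes> x \<oplus> y \<otimes> y"
proof -
  have "(x \<oplus> y) \<otimes> (x \<oplus> y) = x \<otimes> x \<oplus> y \<otimes> y \<oplus> (x \<otimes> y \<oplus> x \<otimes> y)"
    using assms by algebra
  then show ?thesis using assms by (simp add: add_self)
qed

lemma sq_form_add:
  assumes "\<And>s. s < n \<Longrightarrow> d s \<in> carrier R" "\<And>s. s < n \<Longrightarrow> x s \<in> carrier R" "\<And>s. s < n \<Longrightarrow> y s \<in> carrier R"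
  shows "sq_form R d n (\<lambda>s. x s \<oplus> y s) = sq_form R d n x \<oplus> sq_form R d n y"
proof -
  have "sq_form R d n (\<lambda>s. x s \<oplus> y s) =
      (\<Oplus>s\<in>{..<n}. d s \<otimes> (x s \<otimes> x s) \<oplus> d s \<otimes> (y s \<otimes> y s))"
    unfolding sq_form_def
  proof (intro finsum_cong')
    fix s assume "s \<in> {..<n}"
    then have cl: "d s \<in> carrier R" "x s \<in> carrier R" "y s \<in> carrier R" using assms by auto
    show "d s \<otimes> ((x s \<oplus> y s) \<otimes> (x s \<oplus> y s)) = d s \<otimes> (x s \<otimes> x s) \<oplus> d s \<otimes> (y s \<otimes> y s)"
      unfolding square_add[OF cl(2,3)] using cl by (simp add: r_distr)
  qed (use assms in auto)
  also have "\<dots> = sq_form R d n x \<oplus> sq_form R d n y"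
    unfolding sq_form_def using assms by (intro finsum_addf) auto
  finally show ?thesis .
qed

lemma sq_form_axis:
  assumes "\<And>s. s < n \<Longrightarrow> d s \<in> carrier R" "a \<in> carrier R" "i < n"
  shows "sq_form R d n (\<lambda>s. if s = i then a else \<zero>) = d i \<otimes> (a \<otimes> a)"
  unfolding sq_form_def using assms by (subst finsum_eq_single[of _ i]) auto

text \<open>Additivity turns anisotropy into injectivity: adding the axis vector to \<open>x\<close>
  gives a vector of value zero.\<close>

lemma sq_form_eq_axis:
  assumes aniso: "sq_anisotropic R d n"
    and cl: "\<And>s. s < n \<Longrightarrow> d s \<in> carrier R" "\<And>s. s < n \<Longrightarrow> x s \<in> carrier R" "a \<in> carrier R" "i < n"
    and eq: "sq_form R d n x = d i \<otimes> (a \<otimes> a)" and s: "s < n"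
  shows "x s = (if s = i then a else \<zero>)"
proof -
  let ?z = "\<lambda>s. x s \<oplus> (if s = i then a else \<zero>)"
  have "sq_form R d n ?z = sq_form R d n x \<oplus> sq_form R d n (\<lambda>s. if s = i then a else \<zero>)"
    using cl by (intro sq_form_add) auto
  also have "\<dots> = \<zero>" using cl by (simp add: eq sq_form_axis add_self)
  finally have "?z s = \<zero>"
    by (rule sq_anisotropicD[OF aniso]) (use cl s in auto)
  then show ?thesis using cl(2)[OF s] cl(3) add_eq_zero_iff[of "x s" "if s = i then a else \<zero>"] by auto
qed

text \<open>The last summand is the polar form of the block. The squares contribute nothing to it,
  so it does not involve \<open>b\<close>.\<close>

lemma block_add:
  assumes "d \<in> carrier R" "b \<in> carrier R" "x \<in> carrier R" "y \<in> carrier R" "x' \<in> carrier R" "y' \<in> carrier R"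
  shows "block R d \<one> b (x \<oplus> x') (y \<oplus> y') =
    (block R d \<one> b x y \<oplus> block R d \<one> b x' y') \<oplus> d \<otimes> (x \<otimes> y' \<oplus> x' \<otimes> y)"
proof -
  have "block R d \<one> b (x \<oplus> x') (y \<oplus> y') =
      d \<otimes> ((x \<oplus> x') \<otimes> (x \<oplus> x') \<oplus> (x \<oplus> x') \<otimes> (y \<oplus> y') \<oplus> b \<otimes> ((y \<oplus> y') \<otimes> (y \<oplus> y')))"
    using assms by (simp add: block_def)
  also have "\<dots> = d \<otimes> ((x \<otimes> x \<oplus> x' \<otimes> x') \<oplus> (x \<oplus> x') \<otimes> (y \<oplus> y') \<oplus> b \<otimes> (y \<otimes> y \<oplus> y' \<otimes> y'))"
    using assms by (simp only: square_add)
  also have "\<dots> = (d \<otimes> (x \<otimes> x \<oplus> x \<otimes> y \<oplus> b \<otimes> (y \<otimes> y)) \<oplus> d \<otimes> (x' \<otimes> x' \<oplus> x' \<otimes> y' \<oplus> b \<otimes> (y' \<otimes> y')))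
      \<oplus> d \<otimes> (x \<otimes> y' \<oplus> x' \<otimes> y)"
    using assms by algebra
  finally show ?thesis using assms by (simp add: block_def)
qed

lemma block_form_add:
  assumes "\<And>s. s < n \<Longrightarrow> d s \<in> carrier R" "b \<in> carrier R"
    "\<And>s. s < n \<Longrightarrow> x s \<in> carrier R" "\<And>s. s < n \<Longrightarrow> y s \<in> carrier R"
    "\<And>s. s < n \<Longrightarrow> x' s \<in> carrier R" "\<And>s. s < n \<Longrightarrow> y' s \<in> carrier R"
  shows "block_form R d \<one> b n (\<lambda>s. x s \<oplus> x' s) (\<lambda>s. y s \<oplus> y' s) =
    block_form R d \<one> b n x y \<oplus> block_form R d \<one> b n x' y' \<oplus>
    (\<Oplus>s\<in>{..<n}. d s \<otimes> (x s \<otimes> y' s \<oplus> x' s \<otimes> y s))"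
proof -
  have "block_form R d \<one> b n (\<lambda>s. x s \<oplus> x' s) (\<lambda>s. y s \<oplus> y' s) =
      (\<Oplus>s\<in>{..<n}. (block R (d s) \<one> b (x s) (y s) \<oplus> block R (d s) \<one> b (x' s) (y' s)) \<oplus>
        d s \<otimes> (x s \<otimes> y' s \<oplus> x' s \<otimes> y s))"
    unfolding block_form_def using assms by (intro finsum_cong') (auto simp: block_add)
  also have "\<dots> = (\<Oplus>s\<in>{..<n}. block R (d s) \<one> b (x s) (y s) \<oplus> block R (d s) \<one> b (x' s) (y' s)) \<oplus>
      (\<Oplus>s\<in>{..<n}. d s \<otimes> (x s \<otimes> y' s \<oplus> x' s \<otimes> y s))"
    using assms by (intro finsum_addf) auto
  also have "(\<Oplus>s\<in>{..<n}. block R (d s) \<one> b (x s) (y s) \<oplus> block R (d s) \<one> b (x' s) (y' s)) =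
      block_form R d \<one> b n x y \<oplus> block_form R d \<one> b n x' y'"
    unfolding block_form_def using assms by (intro finsum_addf) auto
  finally show ?thesis .
qed

end

end

section \<open>Leading terms of orthogonal vectors and of common subforms\<close>

context laurent_extension
begin

text \<open>If no such \<open>N\<close> existed, every order bound could be raised by one, and
  \<open>f\<close> would be zero.\<close>

lemma ord_ge_lead_ex:
  assumes "f \<in> carrier F" "f \<noteq> \<zero>\<^bsub>F\<^esub>"
  obtains N where "ord_ge N f" "coeff f N \<noteq> \<zero>\<^bsub>K\<^esub>"
proof (rule ccontr)
  assume none: "\<not> thesis"
  obtain L where L: "ord_ge L f" using ord_ge_ex assms(1) by blast
  have "ord_ge N f" for N
  proof (rule int_ascending_induct[where P = "\<lambda>N. ord_ge N f", OF L])
    show "ord_ge (M + 1) f" if "ord_ge M f" for M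
      using that none ord_ge_step[OF that] \<open>\<And>N. ord_ge N f \<Longrightarrow> coeff f N \<noteq> \<zero>\<^bsub>K\<^esub> \<Longrightarrow> thesis\<close> by blast
  qed (rule ord_ge_mono)
  then show False using ord_ge_all assms(2) by blast
qed

text \<open>If \<open>a\<close> and \<open>a'\<close> have orders \<open>p\<close> and \<open>q\<close>, the two values force the vectors to be
  \<open>a\<close> and \<open>a'\<close> times the two basis vectors of the first block, up to higher order. The polar form
  of these is \<open>a a'\<close>, while additivity of the form makes it vanish.\<close>

lemma no_orthogonal_pair:
  assumes two: "\<one>\<^bsub>K\<^esub> \<oplus>\<^bsub>K\<^esub> \<one>\<^bsub>K\<^esub> = \<zero>\<^bsub>K\<^esub>" "\<one>\<^bsub>F\<^esub> \<oplus>\<^bsub>F\<^esub> \<one>\<^bsub>F\<^esub> = \<zero>\<^bsub>F\<^esub>"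
    and d: "\<And>s. s < n \<Longrightarrow> ord_ge 0 (d s)"
    and b: "ord_ge (-1) b" "coeff b (-1) = \<one>\<^bsub>K\<^esub>"
    and aniso: "sq_anisotropic K (\<lambda>s. coeff (d s) 0) n"
    and n: "0 < n" "coeff (d 0) 0 = \<one>\<^bsub>K\<^esub>"
    and xy: "\<And>s. s < n \<Longrightarrow> x s \<in> carrier F" "\<And>s. s < n \<Longrightarrow> y s \<in> carrier F"
      "\<And>s. s < n \<Longrightarrow> x' s \<in> carrier F" "\<And>s. s < n \<Longrightarrow> y' s \<in> carrier F"
    and a: "a \<in> carrier F" "a \<noteq> \<zero>\<^bsub>F\<^esub>" "a' \<in> carrier F" "a' \<noteq> \<zero>\<^bsub>F\<^esub>"
    and eq: "block_form F d \<one>\<^bsub>F\<^esub> b n x y = a \<otimes>\<^bsub>F\<^esub> a"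
      "block_form F d \<one>\<^bsub>F\<^esub> b n x' y' = b \<otimes>\<^bsub>F\<^esub> (a' \<otimes>\<^bsub>F\<^esub> a')"
    and eq_add: "block_form F d \<one>\<^bsub>F\<^esub> b n (\<lambda>s. x s \<oplus>\<^bsub>F\<^esub> x' s) (\<lambda>s. y s \<oplus>\<^bsub>F\<^esub> y' s) =
      a \<otimes>\<^bsub>F\<^esub> a \<oplus>\<^bsub>F\<^esub> b \<otimes>\<^bsub>F\<^esub> (a' \<otimes>\<^bsub>F\<^esub> a')"
  shows False
proof -
  note dcl = d[THEN ord_ge_closed] and bcl = b(1)[THEN ord_ge_closed]
  have d0cl: "coeff (d s) 0 \<in> carrier K" if "s < n" for s using dcl that by simp
  obtain p where p: "ord_ge p a" "coeff a p \<noteq> \<zero>\<^bsub>K\<^esub>" using ord_ge_lead_ex a(1,2) by blast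
  obtain q where q: "ord_ge q a'" "coeff a' q \<noteq> \<zero>\<^bsub>K\<^esub>" using ord_ge_lead_ex a(3,4) by blast
  have aa: "ord_ge (2 * p) (a \<otimes>\<^bsub>F\<^esub> a)" "coeff (a \<otimes>\<^bsub>F\<^esub> a) (2 * p) = coeff a p \<otimes>\<^bsub>K\<^esub> coeff a p"
    using ord_ge_mult[OF p(1) p(1)] coeff_mult_lead[OF p(1) p(1)] by (simp_all only: mult_2)
  have "2 * q - 1 = -1 + (q + q)" by simp
  then have aa': "ord_ge (2 * q - 1) (b \<otimes>\<^bsub>F\<^esub> (a' \<otimes>\<^bsub>F\<^esub> a'))"
    "coeff (b \<otimes>\<^bsub>F\<^esub> (a' \<otimes>\<^bsub>F\<^esub> a')) (2 * q - 1) = \<one>\<^bsub>K\<^esub> \<otimes>\<^bsub>K\<^esub> (coeff a' q \<otimes>\<^bsub>K\<^esub> coeff a' q)"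
    using ord_ge_mult[OF b(1) ord_ge_mult[OF q(1) q(1)]] coeff_mult_lead[OF q(1) q(1)]
      coeff_mult_lead[OF b(1) ord_ge_mult[OF q(1) q(1)]] by (simp_all only: b(2))
  \<comment> \<open>The first value has even order bound \<open>2 * p\<close>, which makes the
    \<open>y\<close> one order smaller in size than the \<open>x\<close>; the second has odd order
    bound \<open>2 * q - 1\<close>, whose coefficient is determined by the
    \<open>y'\<close>.\<close>
  have ord: "\<forall>s<n. ord_ge p (x s) \<and> ord_ge (p + 1) (y s)"
    by (rule block_form_ord_even[OF d ord_ge_one b aniso xy(1,2)]) (simp_all only: eq aa)
  have ord': "\<forall>s<n. ord_ge q (x' s) \<and> ord_ge q (y' s)"
    by (rule block_form_ord_odd[OF d ord_ge_one b aniso xy(3,4)]) (simp_all only: eq aa')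
  have "sq_form K (\<lambda>s. coeff (d s) 0) n (\<lambda>s. coeff (x s) p) = coeff (d 0) 0 \<otimes>\<^bsub>K\<^esub> (coeff a p \<otimes>\<^bsub>K\<^esub> coeff a p)"
  proof -
    have "sq_form K (\<lambda>s. coeff (d s) 0) n (\<lambda>s. coeff (x s) p) =
        coeff (block_form F d \<one>\<^bsub>F\<^esub> b n x y) (2 * p)"
      by (rule block_form_even(2)[symmetric]) (use d b ord in auto)
    then show ?thesis using a n by (simp add: eq aa)
  qed
  then have x: "coeff (x s) p = (if s = 0 then coeff a p else \<zero>\<^bsub>K\<^esub>)" if "s < n" for s
    by (rule K.sq_form_eq_axis[OF two(1) aniso, rotated -2]) (use that d0cl xy a n in auto)
  have "sq_form K (\<lambda>s. coeff (d s) 0) n (\<lambda>s. coeff (y' s) q) = coeff (d 0) 0 \<otimes>\<^bsub>K\<^esub> (coeff a' q \<otimes>\<^bsub>K\<^esub> coeff a' q)"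
  proof -
    have "sq_form K (\<lambda>s. coeff (d s) 0) n (\<lambda>s. coeff (y' s) q) =
        coeff (block_form F d \<one>\<^bsub>F\<^esub> b n x' y') (2 * q - 1)"
      by (rule block_form_odd(2)[symmetric]) (use d b ord' in auto)
    then show ?thesis using a n by (simp add: eq aa')
  qed
  then have y': "coeff (y' s) q = (if s = 0 then coeff a' q else \<zero>\<^bsub>K\<^esub>)" if "s < n" for s
    by (rule K.sq_form_eq_axis[OF two(1) aniso, rotated -2]) (use that d0cl xy a n in auto)
  define P where "P = (\<Oplus>\<^bsub>F\<^esub>s\<in>{..<n}. d s \<otimes>\<^bsub>F\<^esub> (x s \<otimes>\<^bsub>F\<^esub> y' s \<oplus>\<^bsub>F\<^esub> x' s \<otimes>\<^bsub>F\<^esub> y s))"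
  have Pcl: "P \<in> carrier F" unfolding P_def using dcl xy by (intro F.finsum_closed) auto
  \<comment> \<open>\<open>P\<close> is the polar value of the two vectors, hence the defect of
    additivity, which \<open>eq_add\<close> says is absent.\<close>
  have "a \<otimes>\<^bsub>F\<^esub> a \<oplus>\<^bsub>F\<^esub> b \<otimes>\<^bsub>F\<^esub> (a' \<otimes>\<^bsub>F\<^esub> a') \<oplus>\<^bsub>F\<^esub> P = a \<otimes>\<^bsub>F\<^esub> a \<oplus>\<^bsub>F\<^esub> b \<otimes>\<^bsub>F\<^esub> (a' \<otimes>\<^bsub>F\<^esub> a')"
    using F.block_form_add[OF two(2), of n d b x y x' y'] dcl bcl xy
    by (simp add: eq eq_add P_def)
  then have "P = \<zero>\<^bsub>F\<^esub>" using Pcl a bcl by simp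
  have summand: "d s \<otimes>\<^bsub>F\<^esub> (x s \<otimes>\<^bsub>F\<^esub> y' s \<oplus>\<^bsub>F\<^esub> x' s \<otimes>\<^bsub>F\<^esub> y s) \<in> carrier F"
    "coeff (d s \<otimes>\<^bsub>F\<^esub> (x s \<otimes>\<^bsub>F\<^esub> y' s \<oplus>\<^bsub>F\<^esub> x' s \<otimes>\<^bsub>F\<^esub> y s)) (p + q) =
      coeff (d s) 0 \<otimes>\<^bsub>K\<^esub> (coeff (x s) p \<otimes>\<^bsub>K\<^esub> coeff (y' s) q)" if s: "s < n" for s
  proof -
    have o: "ord_ge p (x s)" "ord_ge (p + 1) (y s)" "ord_ge q (x' s)" "ord_ge q (y' s)"
      using ord ord' s by auto
    have xy': "ord_ge (p + q) (x s \<otimes>\<^bsub>F\<^esub> y' s)" by (rule ord_ge_mult[OF o(1,4)])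
    \<comment> \<open>The bound \<open>p + 1\<close> for \<open>y\<close> keeps this mixed term out
      of the coefficient at \<open>p + q\<close>; the other mixed term survives there only for
      \<open>s = 0\<close>.\<close>
    have x'y: "ord_ge (q + (p + 1)) (x' s \<otimes>\<^bsub>F\<^esub> y s)" by (rule ord_ge_mult[OF o(3,2)])
    have sum: "ord_ge (p + q) (x s \<otimes>\<^bsub>F\<^esub> y' s \<oplus>\<^bsub>F\<^esub> x' s \<otimes>\<^bsub>F\<^esub> y s)"
      by (intro ord_ge_add xy' ord_ge_mono[OF x'y]) simp
    show "d s \<otimes>\<^bsub>F\<^esub> (x s \<otimes>\<^bsub>F\<^esub> y' s \<oplus>\<^bsub>F\<^esub> x' s \<otimes>\<^bsub>F\<^esub> y s) \<in> carrier F"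
      using dcl[OF s] ord_ge_closed[OF sum] by simp
    have "coeff (x' s \<otimes>\<^bsub>F\<^esub> y s) (p + q) = \<zero>\<^bsub>K\<^esub>" by (rule coeff_eq_zero[OF x'y]) simp
    then show "coeff (d s \<otimes>\<^bsub>F\<^esub> (x s \<otimes>\<^bsub>F\<^esub> y' s \<oplus>\<^bsub>F\<^esub> x' s \<otimes>\<^bsub>F\<^esub> y s)) (p + q) =
        coeff (d s) 0 \<otimes>\<^bsub>K\<^esub> (coeff (x s) p \<otimes>\<^bsub>K\<^esub> coeff (y' s) q)"
      using coeff_mult_lead[OF d[OF s] sum] coeff_mult_lead[OF o(1,4)]
        ord_ge_closed[OF xy'] ord_ge_closed[OF x'y] xy s by simp
  qed
  have "coeff P (p + q) = (\<Oplus>\<^bsub>K\<^esub>s\<in>{..<n}. coeff (d s \<otimes>\<^bsub>F\<^esub> (x s \<otimes>\<^bsub>F\<^esub> y' s \<oplus>\<^bsub>F\<^esub> x' s \<otimes>\<^bsub>F\<^esub> y s)) (p + q))"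
    unfolding P_def by (rule coeff_finsum) (use summand in simp)
  also have "\<dots> = coeff (d 0 \<otimes>\<^bsub>F\<^esub> (x 0 \<otimes>\<^bsub>F\<^esub> y' 0 \<oplus>\<^bsub>F\<^esub> x' 0 \<otimes>\<^bsub>F\<^esub> y 0)) (p + q)"
  proof (rule K.finsum_eq_single)
    show "coeff (d s \<otimes>\<^bsub>F\<^esub> (x s \<otimes>\<^bsub>F\<^esub> y' s \<oplus>\<^bsub>F\<^esub> x' s \<otimes>\<^bsub>F\<^esub> y s)) (p + q) = \<zero>\<^bsub>K\<^esub>"
      if "s \<in> {..<n}" "s \<noteq> 0" for s
      using that d0cl by (simp add: summand(2) x y')
  qed (use summand(1)[of 0] n in auto)
  also have "\<dots> = coeff a p \<otimes>\<^bsub>K\<^esub> coeff a' q"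
    using n a by (simp add: summand(2) x y')
  finally show False
    using \<open>P = \<zero>\<^bsub>F\<^esub>\<close> K.integral[of "coeff a p" "coeff a' q"] p q a by simp
qed

text \<open>By \<open>unramified_eq_ramified\<close> the \<open>x\<close>-part of \<open>T'\<close> is injective, hence up to scaling it hits the
  basis vectors \<open>i\<close> and \<open>j\<close>; the residues of the corresponding vectors of the unramified form have
  the values of a totally singular form.\<close>

lemma common_subform_residue:
  assumes two: "\<one>\<^bsub>K\<^esub> \<oplus>\<^bsub>K\<^esub> \<one>\<^bsub>K\<^esub> = \<zero>\<^bsub>K\<^esub>"
    and d: "\<And>s. s < n \<Longrightarrow> ord_ge 0 (d s)" and b: "ord_ge 0 b"
    and aniso: "block_anisotropic K (\<lambda>s. coeff (d s) 0) \<one>\<^bsub>K\<^esub> (coeff b 0) n"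
    and d': "\<And>s. s < n \<Longrightarrow> ord_ge 0 (d' s)" and b': "ord_ge (-1) b'" "coeff b' (-1) = \<one>\<^bsub>K\<^esub>"
    and aniso': "sq_anisotropic K (\<lambda>s. coeff (d' s) 0) n"
    and T: "linear_map F n (2 * n) T" "inj_on T (coord_space F n)" and T': "linear_map F n (2 * n) T'"
    and eq: "\<And>v. v \<in> coord_space F n \<Longrightarrow>
      block_form F d \<one>\<^bsub>F\<^esub> b n (\<lambda>s. T v (2 * s)) (\<lambda>s. T v (2 * s + 1)) =
      block_form F d' \<one>\<^bsub>F\<^esub> b' n (\<lambda>s. T' v (2 * s)) (\<lambda>s. T' v (2 * s + 1))"
    and ij: "i < n" "j < n"
  shows "\<exists>a x y a' x' y'. (\<forall>s<n. x s \<in> carrier K \<and> y s \<in> carrier K \<and> x' s \<in> carrier K \<and> y' s \<in> carrier K) \<and>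
    a \<in> carrier K \<and> a \<noteq> \<zero>\<^bsub>K\<^esub> \<and> a' \<in> carrier K \<and> a' \<noteq> \<zero>\<^bsub>K\<^esub> \<and>
    block_form K (\<lambda>s. coeff (d s) 0) \<one>\<^bsub>K\<^esub> (coeff b 0) n x y = coeff (d' i) 0 \<otimes>\<^bsub>K\<^esub> (a \<otimes>\<^bsub>K\<^esub> a) \<and>
    block_form K (\<lambda>s. coeff (d s) 0) \<one>\<^bsub>K\<^esub> (coeff b 0) n x' y' = coeff (d' j) 0 \<otimes>\<^bsub>K\<^esub> (a' \<otimes>\<^bsub>K\<^esub> a') \<and>
    block_form K (\<lambda>s. coeff (d s) 0) \<one>\<^bsub>K\<^esub> (coeff b 0) n (\<lambda>s. x s \<oplus>\<^bsub>K\<^esub> x' s) (\<lambda>s. y s \<oplus>\<^bsub>K\<^esub> y' s) =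
      coeff (d' i) 0 \<otimes>\<^bsub>K\<^esub> (a \<otimes>\<^bsub>K\<^esub> a) \<oplus>\<^bsub>K\<^esub> coeff (d' j) 0 \<otimes>\<^bsub>K\<^esub> (a' \<otimes>\<^bsub>K\<^esub> a')"
proof -
  note Tcl = coord_space_nth[OF linear_map_closed[OF T(1)]]
    and T'cl = coord_space_nth[OF linear_map_closed[OF T']]
  have d0cl: "coeff (d' s) 0 \<in> carrier K" if "s < n" for s using d'[OF that, THEN ord_ge_closed] by simp
  have ueq: "\<forall>s<n. ord_ge L (T v (2 * s)) \<and> ord_ge L (T v (2 * s + 1))"
    "block_form K (\<lambda>s. coeff (d s) 0) \<one>\<^bsub>K\<^esub> (coeff b 0) n
        (\<lambda>s. coeff (T v (2 * s)) L) (\<lambda>s. coeff (T v (2 * s + 1)) L) =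
      sq_form K (\<lambda>s. coeff (d' s) 0) n (\<lambda>s. coeff (T' v (2 * s)) L)"
    if v: "v \<in> coord_space F n" and o: "\<And>s. s < n \<Longrightarrow> ord_ge L (T' v (2 * s))" for v L
  proof -
    have cl: "T v (2 * s) \<in> carrier F" "T v (2 * s + 1) \<in> carrier F" "T' v (2 * s + 1) \<in> carrier F"
      if "s < n" for s using Tcl[OF v] T'cl[OF v] that by auto
    show "\<forall>s<n. ord_ge L (T v (2 * s)) \<and> ord_ge L (T v (2 * s + 1))"
      by (rule unramified_eq_ramified(1)[OF d b aniso d' b' aniso' cl(1,2) o cl(3) eq[OF v]])
    show "block_form K (\<lambda>s. coeff (d s) 0) \<one>\<^bsub>K\<^esub> (coeff b 0) n
        (\<lambda>s. coeff (T v (2 * s)) L) (\<lambda>s. coeff (T v (2 * s + 1)) L) =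
      sq_form K (\<lambda>s. coeff (d' s) 0) n (\<lambda>s. coeff (T' v (2 * s)) L)"
      by (rule unramified_eq_ramified(2)[OF d b aniso d' b' aniso' cl(1,2) o cl(3) eq[OF v]])
  qed
  have kernel: "v s = \<zero>\<^bsub>F\<^esub>" if v: "v \<in> coord_space F n" and z: "\<And>s. s < n \<Longrightarrow> T' v (2 * s) = \<zero>\<^bsub>F\<^esub>" and s: "s < n" for v s
  proof -
    \<comment> \<open>A vanishing \<open>x\<close>-part of \<open>T' v\<close> meets every bound
      \<open>L\<close>, so the other side \<open>T v\<close> has every order as well and is
      zero.\<close>
    have "\<forall>s<n. ord_ge L (T v (2 * s)) \<and> ord_ge L (T v (2 * s + 1))" for L
      by (rule ueq(1)[OF v]) (simp add: z)
    then have Tv0: "T v (2 * s) = \<zero>\<^bsub>F\<^esub> \<and> T v (2 * s + 1) = \<zero>\<^bsub>F\<^esub>" if "s < n" for s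
      using that ord_ge_all by blast
    have Tv: "T v l = \<zero>\<^bsub>F\<^esub>" if "l < 2 * n" for l
      using Tv0[of "l div 2"] that by (cases "even l") (auto elim!: evenE oddE)
    \<comment> \<open>The zero vector as a multiple of \<open>v\<close>, so that homogeneity
      computes \<open>T w\<close>; injectivity of \<open>T\<close> then applies.\<close>
    define w where "w = (\<lambda>i\<in>{..<n}. \<zero>\<^bsub>F\<^esub> \<otimes>\<^bsub>F\<^esub> v i)"
    have w: "w \<in> coord_space F n" unfolding w_def using coord_space_nth[OF v] by (intro coord_space_restrict) simp
    have "T w = T v"
    proof (rule PiE_ext)
      show "T w \<in> {..<2 * n} \<rightarrow>\<^sub>E carrier F" "T v \<in> {..<2 * n} \<rightarrow>\<^sub>E carrier F"
        using linear_map_closed[OF T(1) w] linear_map_closed[OF T(1) v] by (simp_all add: coord_space_def)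
      show "T w l = T v l" if "l \<in> {..<2 * n}" for l
      proof -
        have "T w l = \<zero>\<^bsub>F\<^esub> \<otimes>\<^bsub>F\<^esub> T v l"
          unfolding w_def using that by (intro linear_map_scale[OF T(1) F.zero_closed v]) simp
        then show ?thesis using Tv[of l] that by simp
      qed
    qed
    then have "w = v" using T(2) w v by (simp add: inj_on_def)
    then have "v s = w s" by simp
    also have "\<dots> = \<zero>\<^bsub>F\<^esub>" using s coord_space_nth[OF v s] by (simp add: w_def)
    finally show ?thesis .
  qed
  define A where "A = (\<lambda>s l. T' (\<lambda>m\<in>{..<n}. if m = l then \<one>\<^bsub>F\<^esub> else \<zero>\<^bsub>F\<^esub>) (2 * s))"
  have A: "T' v (2 * s) = (\<Oplus>\<^bsub>F\<^esub>l\<in>{..<n}. A s l \<otimes>\<^bsub>F\<^esub> v l)" if "v \<in> coord_space F n" "s < n" for v s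
    unfolding A_def using that by (intro F.linear_map_matrix[OF T']) auto
  have Acl: "A s l \<in> carrier F" if "s < n" for s l
    unfolding A_def by (rule T'cl[OF coord_space_restrict]) (use that in auto)
  have axis: "\<exists>v c. v \<in> coord_space F n \<and> ord_ge 0 c \<and> coeff c 0 \<noteq> \<zero>\<^bsub>K\<^esub> \<and>
      (\<forall>s<n. T' v (2 * s) = (if s = k then c else \<zero>\<^bsub>F\<^esub>))" for k
  proof -
    have "\<exists>x c. (\<forall>l<n. x l \<in> carrier F) \<and> c \<in> carrier F \<and> c \<noteq> \<zero>\<^bsub>F\<^esub> \<and>
        (\<forall>s<n. (\<Oplus>\<^bsub>F\<^esub>l\<in>{..<n}. A s l \<otimes>\<^bsub>F\<^esub> x l) = (if s = k then c else \<zero>\<^bsub>F\<^esub>))"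
    proof (rule F.injective_matrix_hits_axis)
      fix x assume x: "\<And>l. l < n \<Longrightarrow> x l \<in> carrier F"
        and z: "\<And>s. s < n \<Longrightarrow> (\<Oplus>\<^bsub>F\<^esub>l\<in>{..<n}. A s l \<otimes>\<^bsub>F\<^esub> x l) = \<zero>\<^bsub>F\<^esub>"
      let ?v = "\<lambda>l\<in>{..<n}. x l"
      have v: "?v \<in> coord_space F n" by (rule coord_space_restrict[OF x])
      have "T' ?v (2 * s) = \<zero>\<^bsub>F\<^esub>" if s: "s < n" for s
      proof -
        have "T' ?v (2 * s) = (\<Oplus>\<^bsub>F\<^esub>l\<in>{..<n}. A s l \<otimes>\<^bsub>F\<^esub> ?v l)" by (rule A[OF v s])
        also have "\<dots> = (\<Oplus>\<^bsub>F\<^esub>l\<in>{..<n}. A s l \<otimes>\<^bsub>F\<^esub> x l)"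
          using Acl[OF s] x by (intro F.finsum_cong') auto
        finally show ?thesis using z[OF s] by simp
      qed
      then have "?v l = \<zero>\<^bsub>F\<^esub>" if "l < n" for l by (rule kernel[OF v]) (use that in auto)
      then show "\<forall>l<n. x l = \<zero>\<^bsub>F\<^esub>" by simp
    qed (use Acl in auto)
    then obtain x c where x: "\<And>l. l < n \<Longrightarrow> x l \<in> carrier F" and c: "c \<in> carrier F" "c \<noteq> \<zero>\<^bsub>F\<^esub>"
      and xc: "\<And>s. s < n \<Longrightarrow> (\<Oplus>\<^bsub>F\<^esub>l\<in>{..<n}. A s l \<otimes>\<^bsub>F\<^esub> x l) = (if s = k then c else \<zero>\<^bsub>F\<^esub>)"
      by blast
    obtain N where N: "ord_ge N c" "coeff c N \<noteq> \<zero>\<^bsub>K\<^esub>" using ord_ge_lead_ex c by blast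
    let ?v = "\<lambda>l\<in>{..<n}. x l"
    have v: "?v \<in> coord_space F n" by (rule coord_space_restrict[OF x])
    \<comment> \<open>Scaling by this monomial shifts \<open>c\<close> to order exactly 0. Both axis
      vectors are then compared at the same level \<open>L = 0\<close>, and so is their sum.\<close>
    let ?m = "monom \<one>\<^bsub>K\<^esub> (-N)"
    have m: "?m \<in> carrier F" "ord_ge (-N) ?m" by simp_all
    have T'v: "T' ?v (2 * s) = (if s = k then c else \<zero>\<^bsub>F\<^esub>)" if s: "s < n" for s
    proof -
      have "T' ?v (2 * s) = (\<Oplus>\<^bsub>F\<^esub>l\<in>{..<n}. A s l \<otimes>\<^bsub>F\<^esub> ?v l)" by (rule A[OF v s])
      also have "\<dots> = (\<Oplus>\<^bsub>F\<^esub>l\<in>{..<n}. A s l \<otimes>\<^bsub>F\<^esub> x l)"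
        using Acl[OF s] x by (intro F.finsum_cong') auto
      finally show ?thesis using xc[OF s] by simp
    qed
    show ?thesis
    proof (intro exI conjI allI impI)
      show "(\<lambda>l\<in>{..<n}. ?m \<otimes>\<^bsub>F\<^esub> ?v l) \<in> coord_space F n"
        using coord_space_nth[OF v] m(1) by (intro coord_space_restrict) simp
      show "ord_ge 0 (?m \<otimes>\<^bsub>F\<^esub> c)" using ord_ge_mult[OF m(2) N(1)] by simp
      show "coeff (?m \<otimes>\<^bsub>F\<^esub> c) 0 \<noteq> \<zero>\<^bsub>K\<^esub>" using coeff_mult_lead[OF m(2) N(1)] N(2) c(1) by simp
      show "T' (\<lambda>l\<in>{..<n}. ?m \<otimes>\<^bsub>F\<^esub> ?v l) (2 * s) = (if s = k then ?m \<otimes>\<^bsub>F\<^esub> c else \<zero>\<^bsub>F\<^esub>)" if s: "s < n" for s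
      proof -
        have "T' (\<lambda>l\<in>{..<n}. ?m \<otimes>\<^bsub>F\<^esub> ?v l) (2 * s) = ?m \<otimes>\<^bsub>F\<^esub> T' ?v (2 * s)"
          using s by (intro linear_map_scale[OF T' m(1) v]) simp
        also have "\<dots> = (if s = k then ?m \<otimes>\<^bsub>F\<^esub> c else \<zero>\<^bsub>F\<^esub>)"
          unfolding T'v[OF s] using m(1) by simp
        finally show ?thesis .
      qed
    qed
  qed
  obtain v a where v: "v \<in> coord_space F n" and a: "ord_ge 0 a" "coeff a 0 \<noteq> \<zero>\<^bsub>K\<^esub>"
    and va: "\<And>s. s < n \<Longrightarrow> T' v (2 * s) = (if s = i then a else \<zero>\<^bsub>F\<^esub>)"
    using axis[of i] by blast
  obtain w a' where w: "w \<in> coord_space F n" and a': "ord_ge 0 a'" "coeff a' 0 \<noteq> \<zero>\<^bsub>K\<^esub>"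
    and wa': "\<And>s. s < n \<Longrightarrow> T' w (2 * s) = (if s = j then a' else \<zero>\<^bsub>F\<^esub>)"
    using axis[of j] by blast
  note acl = a(1)[THEN ord_ge_closed] a'(1)[THEN ord_ge_closed]
  let ?u = "\<lambda>l\<in>{..<n}. v l \<oplus>\<^bsub>F\<^esub> w l"
  have u: "?u \<in> coord_space F n"
    using coord_space_nth[OF v] coord_space_nth[OF w] by (intro coord_space_restrict) simp
  have Tu: "T ?u l = T v l \<oplus>\<^bsub>F\<^esub> T w l" "T' ?u l = T' v l \<oplus>\<^bsub>F\<^esub> T' w l" if "l < 2 * n" for l
    using linear_map_add[OF T(1) v w that] linear_map_add[OF T' v w that] .
  let ?Q = "\<lambda>v. block_form K (\<lambda>s. coeff (d s) 0) \<one>\<^bsub>K\<^esub> (coeff b 0) n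
        (\<lambda>s. coeff (T v (2 * s)) 0) (\<lambda>s. coeff (T v (2 * s + 1)) 0)"
  let ?S = "\<lambda>v. sq_form K (\<lambda>s. coeff (d' s) 0) n (\<lambda>s. coeff (T' v (2 * s)) 0)"
  have S_axis: "?S v' = coeff (d' k) 0 \<otimes>\<^bsub>K\<^esub> (coeff c 0 \<otimes>\<^bsub>K\<^esub> coeff c 0)"
    if "\<And>s. s < n \<Longrightarrow> T' v' (2 * s) = (if s = k then c else \<zero>\<^bsub>F\<^esub>)" "c \<in> carrier F" "k < n" for v' c k
  proof -
    have "?S v' = sq_form K (\<lambda>s. coeff (d' s) 0) n (\<lambda>s. if s = k then coeff c 0 else \<zero>\<^bsub>K\<^esub>)"
      unfolding sq_form_def using that d0cl by (intro K.finsum_cong') auto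
    also have "\<dots> = coeff (d' k) 0 \<otimes>\<^bsub>K\<^esub> (coeff c 0 \<otimes>\<^bsub>K\<^esub> coeff c 0)"
      using that d0cl by (intro K.sq_form_axis[OF two]) auto
    finally show ?thesis .
  qed
  have Sv: "?S v = coeff (d' i) 0 \<otimes>\<^bsub>K\<^esub> (coeff a 0 \<otimes>\<^bsub>K\<^esub> coeff a 0)"
    by (rule S_axis) (use va acl ij in auto)
  have Sw: "?S w = coeff (d' j) 0 \<otimes>\<^bsub>K\<^esub> (coeff a' 0 \<otimes>\<^bsub>K\<^esub> coeff a' 0)"
    by (rule S_axis) (use wa' acl ij in auto)
  have Q: "?Q v = ?S v" "?Q w = ?S w"
    by (rule ueq(2)[OF v], use va a in simp) (rule ueq(2)[OF w], use wa' a' in simp)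
  \<comment> \<open>The sum of the two vectors also satisfies the bound 0, so additivity of the
    totally singular side passes to the residue form of the unramified side.\<close>
  have "?Q ?u = ?S ?u"
    by (rule ueq(2)[OF u]) (simp add: Tu va wa' a a' ord_ge_add)
  also have "\<dots> = sq_form K (\<lambda>s. coeff (d' s) 0) n (\<lambda>s. coeff (T' v (2 * s)) 0 \<oplus>\<^bsub>K\<^esub> coeff (T' w (2 * s)) 0)"
    unfolding sq_form_def using T'cl[OF v] T'cl[OF w] d0cl
    by (intro K.finsum_cong') (auto simp: Tu(2))
  also have "\<dots> = ?S v \<oplus>\<^bsub>K\<^esub> ?S w"
    using T'cl[OF v] T'cl[OF w] d0cl by (intro K.sq_form_add[OF two]) auto
  finally have "?Q ?u = ?S v \<oplus>\<^bsub>K\<^esub> ?S w" .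
  moreover have "?Q ?u = block_form K (\<lambda>s. coeff (d s) 0) \<one>\<^bsub>K\<^esub> (coeff b 0) n
      (\<lambda>s. coeff (T v (2 * s)) 0 \<oplus>\<^bsub>K\<^esub> coeff (T w (2 * s)) 0)
      (\<lambda>s. coeff (T v (2 * s + 1)) 0 \<oplus>\<^bsub>K\<^esub> coeff (T w (2 * s + 1)) 0)"
    unfolding block_form_def using Tcl[OF v] Tcl[OF w] d[THEN ord_ge_closed] b[THEN ord_ge_closed]
    by (intro K.finsum_cong') (auto simp: Tu(1))
  ultimately have Qu: "block_form K (\<lambda>s. coeff (d s) 0) \<one>\<^bsub>K\<^esub> (coeff b 0) n
      (\<lambda>s. coeff (T v (2 * s)) 0 \<oplus>\<^bsub>K\<^esub> coeff (T w (2 * s)) 0)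
      (\<lambda>s. coeff (T v (2 * s + 1)) 0 \<oplus>\<^bsub>K\<^esub> coeff (T w (2 * s + 1)) 0) = ?S v \<oplus>\<^bsub>K\<^esub> ?S w"
    by (rule trans[OF sym, rotated])
  have cl: "\<forall>s<n. coeff (T v (2 * s)) 0 \<in> carrier K \<and> coeff (T v (2 * s + 1)) 0 \<in> carrier K \<and>
      coeff (T w (2 * s)) 0 \<in> carrier K \<and> coeff (T w (2 * s + 1)) 0 \<in> carrier K"
    using Tcl[OF v] Tcl[OF w] by auto
  show ?thesis
    by (rule exI[of _ "coeff a 0"], rule exI[of _ "\<lambda>s. coeff (T v (2 * s)) 0"],
        rule exI[of _ "\<lambda>s. coeff (T v (2 * s + 1)) 0"], rule exI[of _ "coeff a' 0"],
        rule exI[of _ "\<lambda>s. coeff (T w (2 * s)) 0"], rule exI[of _ "\<lambda>s. coeff (T w (2 * s + 1)) 0"],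
        intro conjI cl coeff_closed acl a(2) a'(2) Q[unfolded Sv Sw] Qu[unfolded Sv Sw])
qed

end

section \<open>Coordinates of Pfister forms\<close>

text \<open>Entry \<open>s\<close> is the product of the list elements selected by the binary digits
  of \<open>s\<close>, the head belonging to the highest digit. This is the order that the nested
  Kronecker products produce.\<close>

fun pfister_diag :: "('a, 'm) ring_scheme \<Rightarrow> 'a list \<Rightarrow> nat \<Rightarrow> 'a" where
  "pfister_diag R [] s = \<one>\<^bsub>R\<^esub>"
| "pfister_diag R (a # as) s =
     (if s < 2 ^ length as then pfister_diag R as s
      else a \<otimes>\<^bsub>R\<^esub> pfister_diag R as (s - 2 ^ length as))"

lemma bil_pfister_dim [simp]: "fst (bil_pfister R as) = 2 ^ length as"
  by (induction as) (simp_all add: bil_pfister_def form_tensor_def diag_form_def)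

lemma bil_pfister_Cons:
  "bil_pfister R (a # as) = form_tensor R (diag_form R [\<one>\<^bsub>R\<^esub>, a]) (bil_pfister R as)"
  by (simp add: bil_pfister_def)

lemma quad_pfister_dim [simp]: "fst (quad_pfister R as b) = 2 ^ length as * 2"
  by (simp add: quad_pfister_def form_tensor_def binary_quad_def)

lemma (in cring) pfister_diag_closed [simp]:
  "set as \<subseteq> carrier R \<Longrightarrow> pfister_diag R as s \<in> carrier R"
  by (induction as arbitrary: s) auto

lemma (in cring) bil_pfister_nth:
  assumes "set as \<subseteq> carrier R" "i < 2 ^ length as" "j < 2 ^ length as"
  shows "snd (bil_pfister R as) i j = (if i = j then pfister_diag R as i else \<zero>)"
  using assms
proof (induction as arbitrary: i j)
  case Nil
  then show ?case by (simp add: bil_pfister_def diag_form_def)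
next
  case (Cons a as)
  let ?m = "2 ^ length as :: nat"
  have m: "0 < ?m" by simp
  have dm: "k div ?m = (if k < ?m then 0 else 1)" "k mod ?m = (if k < ?m then k else k - ?m)"
    if "k < 2 ^ length (a # as)" for k
    using that by (auto simp: div_if le_mod_geq)
  have IH: "snd (bil_pfister R as) (i mod ?m) (j mod ?m) =
      (if i mod ?m = j mod ?m then pfister_diag R as (i mod ?m) else \<zero>)"
    using Cons.prems by (intro Cons.IH) simp_all
  have "snd (bil_pfister R (a # as)) i j =
      (if i div ?m = j div ?m then [\<one>, a] ! (i div ?m) else \<zero>) \<otimes>
      snd (bil_pfister R as) (i mod ?m) (j mod ?m)"
    by (simp add: bil_pfister_Cons form_tensor_def diag_form_def)
  then show ?case
    using Cons.prems unfolding IH unfolding dm[OF Cons.prems(2)] dm[OF Cons.prems(3)] by auto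
qed

lemma (in cring) bil_pfister_closed:
  "set as \<subseteq> carrier R \<Longrightarrow> i < 2 ^ length as \<Longrightarrow> j < 2 ^ length as \<Longrightarrow>
    snd (bil_pfister R as) i j \<in> carrier R"
  by (simp add: bil_pfister_nth)

lemma (in cring) quad_pfister_closed:
  assumes "set as \<subseteq> carrier R" "b \<in> carrier R" "i < 2 ^ length as * 2" "j < 2 ^ length as * 2"
  shows "snd (quad_pfister R as b) i j \<in> carrier R"
proof -
  have "i div 2 < 2 ^ length as" "j div 2 < 2 ^ length as" using assms(3,4) by auto
  then show ?thesis
    using assms(1,2) by (simp add: quad_pfister_def form_tensor_def binary_quad_def bil_pfister_closed)
qed

lemma (in abelian_monoid) finsum_double:
  fixes f :: "nat \<Rightarrow> 'a"
  assumes "\<And>i. i < n * 2 \<Longrightarrow> f i \<in> carrier G"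
  shows "(\<Oplus>i\<in>{..<n * 2}. f i) = (\<Oplus>s\<in>{..<n}. f (2 * s) \<oplus> f (2 * s + 1))"
  using assms
proof (induction n)
  case (Suc n)
  have "{..<Suc n * 2} = insert (2 * n + 1) (insert (2 * n) {..<n * 2})" by auto
  then have "(\<Oplus>i\<in>{..<Suc n * 2}. f i) = f (2 * n + 1) \<oplus> (f (2 * n) \<oplus> (\<Oplus>i\<in>{..<n * 2}. f i))"
    using Suc.prems by (simp add: Pi_iff)
  also have "(\<Oplus>i\<in>{..<n * 2}. f i) = (\<Oplus>s\<in>{..<n}. f (2 * s) \<oplus> f (2 * s + 1))"
    using Suc by simp
  also have "f (2 * n + 1) \<oplus> (f (2 * n) \<oplus> \<dots>) = (f (2 * n) \<oplus> f (2 * n + 1)) \<oplus> \<dots>"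
    using Suc.prems by (subst a_assoc[symmetric]) (auto simp: a_comm intro!: finsum_closed)
  also have "\<dots> = (\<Oplus>s\<in>{..<Suc n}. f (2 * s) \<oplus> f (2 * s + 1))"
    unfolding lessThan_Suc using Suc.prems by (intro finsum_insert[symmetric]) auto
  finally show ?case .
qed simp

text \<open>The coefficient matrix is block diagonal: block \<open>s\<close> occupies the indices
  \<open>2 * s\<close> and \<open>2 * s + 1\<close> and is the entry \<open>s\<close> of the
  diagonal times the upper triangular matrix of [1, b].\<close>

lemma (in cring) quad_pfister_value:
  assumes as: "set as \<subseteq> carrier R" and b: "b \<in> carrier R"
    and z: "\<And>i. i < 2 ^ length as * 2 \<Longrightarrow> z i \<in> carrier R"
  shows "quad_value R (quad_pfister R as b) z =
    block_form R (pfister_diag R as) \<one> b (2 ^ length as) (\<lambda>s. z (2 * s)) (\<lambda>s. z (2 * s + 1))"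
proof -
  let ?n = "2 ^ length as :: nat" and ?d = "pfister_diag R as"
  let ?M = "snd (quad_pfister R as b)"
  have M: "?M (2 * s) (2 * t) = (if s = t then ?d s else \<zero>)"
    "?M (2 * s) (2 * t + 1) = (if s = t then ?d s else \<zero>)"
    "?M (2 * s + 1) (2 * t) = \<zero>"
    "?M (2 * s + 1) (2 * t + 1) = (if s = t then ?d s \<otimes> b else \<zero>)" if "s < ?n" "t < ?n" for s t
    using that as b by (simp_all add: quad_pfister_def form_tensor_def binary_quad_def bil_pfister_nth)
  have zs: "z (2 * s) \<in> carrier R" "z (2 * s + 1) \<in> carrier R" if "s < ?n" for s
    using z that by auto
  have cl: "?M i j \<otimes> z i \<otimes> z j \<in> carrier R" if "i < ?n * 2" "j < ?n * 2" for i j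
    using quad_pfister_closed[OF as b that] z that by simp
  define row where "row i = (\<Oplus>j\<in>{..<?n * 2}. ?M i j \<otimes> z i \<otimes> z j)" for i
  have row_closed: "row i \<in> carrier R" if "i < ?n * 2" for i
    unfolding row_def using cl that by (intro finsum_closed) auto
  have row: "row i = ?M i (2 * s) \<otimes> z i \<otimes> z (2 * s) \<oplus> ?M i (2 * s + 1) \<otimes> z i \<otimes> z (2 * s + 1)"
    if s: "s < ?n" and i: "i = 2 * s \<or> i = 2 * s + 1" for s i
  proof -
    have i': "i < ?n * 2" using s i by auto
    have "row i = (\<Oplus>t\<in>{..<?n}. ?M i (2 * t) \<otimes> z i \<otimes> z (2 * t) \<oplus> ?M i (2 * t + 1) \<otimes> z i \<otimes> z (2 * t + 1))"
      unfolding row_def using cl[OF i'] by (rule finsum_double)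
    also have "\<dots> = ?M i (2 * s) \<otimes> z i \<otimes> z (2 * s) \<oplus> ?M i (2 * s + 1) \<otimes> z i \<otimes> z (2 * s + 1)"
    proof (rule finsum_eq_single)
      show "?M i (2 * s) \<otimes> z i \<otimes> z (2 * s) \<oplus> ?M i (2 * s + 1) \<otimes> z i \<otimes> z (2 * s + 1) \<in> carrier R"
        using cl[OF i', of "2 * s"] cl[OF i', of "2 * s + 1"] s by simp
      fix t assume t: "t \<in> {..<?n}" "t \<noteq> s"
      then have "?M i (2 * t) = \<zero>" "?M i (2 * t + 1) = \<zero>"
        using i M[OF s, of t] by auto
      moreover have "z i \<in> carrier R" "z (2 * t) \<in> carrier R" "z (2 * t + 1) \<in> carrier R"
        using z[OF i'] zs t by auto
      ultimately show "?M i (2 * t) \<otimes> z i \<otimes> z (2 * t) \<oplus> ?M i (2 * t + 1) \<otimes> z i \<otimes> z (2 * t + 1) = \<zero>"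
        by simp
    qed (use s in auto)
    finally show ?thesis .
  qed
  have "quad_value R (quad_pfister R as b) z = (\<Oplus>i\<in>{..<?n * 2}. row i)"
    by (simp add: quad_value_def row_def)
  also have "\<dots> = (\<Oplus>s\<in>{..<?n}. row (2 * s) \<oplus> row (2 * s + 1))"
    using row_closed by (rule finsum_double)
  also have "\<dots> = block_form R ?d \<one> b ?n (\<lambda>s. z (2 * s)) (\<lambda>s. z (2 * s + 1))"
    unfolding block_form_def
  proof (intro finsum_cong')
    fix s assume "s \<in> {..<?n}"
    then have s: "s < ?n" by simp
    have ds: "?d s \<in> carrier R" using as by simp
    have "row (2 * s) \<oplus> row (2 * s + 1) =
        (?d s \<otimes> z (2 * s) \<otimes> z (2 * s) \<oplus> ?d s \<otimes> z (2 * s) \<otimes> z (2 * s + 1)) \<oplus>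
        (\<zero> \<otimes> z (2 * s + 1) \<otimes> z (2 * s) \<oplus> ?d s \<otimes> b \<otimes> z (2 * s + 1) \<otimes> z (2 * s + 1))"
      using row[OF s, of "2 * s"] row[OF s, of "2 * s + 1"] M[OF s s] by simp
    also have "\<dots> = ?d s \<otimes> (z (2 * s) \<otimes> z (2 * s) \<oplus> z (2 * s) \<otimes> z (2 * s + 1) \<oplus>
        b \<otimes> (z (2 * s + 1) \<otimes> z (2 * s + 1)))"
      using zs[OF s] b ds by algebra
    finally show "row (2 * s) \<oplus> row (2 * s + 1) = block R (?d s) \<one> b (z (2 * s)) (z (2 * s + 1))"
      using zs[OF s] by (simp add: block_def)
  qed (use zs as b in auto)
  finally show ?thesis .
qed

section \<open>Common subforms of linked forms\<close>

text \<open>The inclusion of a coordinate subspace: coordinate \<open>i\<close> moves to position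
  \<open>h i\<close>. The common factor will be found on such a subspace of each tensor
  product.\<close>

definition coord_embed ::
    "('a, 'm) ring_scheme \<Rightarrow> (nat \<Rightarrow> nat) \<Rightarrow> nat \<Rightarrow> nat \<Rightarrow> (nat \<Rightarrow> 'a) \<Rightarrow> (nat \<Rightarrow> 'a)" where
  "coord_embed R h m e v =
     (\<lambda>i\<in>{..<e}. if i \<in> h ` {..<m} then v (inv_into {..<m} h i) else \<zero>\<^bsub>R\<^esub>)"

lemma linear_map_comp:
  assumes S: "linear_map F d e S" and T: "linear_map F c d T"
  shows "linear_map F c e (S \<circ> T)"
  unfolding linear_map_def
proof (intro conjI ballI)
  show "S \<circ> T \<in> coord_space F c \<rightarrow> coord_space F e"
    using linear_map_closed[OF S] linear_map_closed[OF T] by auto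
next
  fix x y assume xy: "x \<in> coord_space F c" "y \<in> coord_space F c"
  then have "T (\<lambda>i\<in>{..<c}. x i \<oplus>\<^bsub>F\<^esub> y i) = (\<lambda>i\<in>{..<d}. T x i \<oplus>\<^bsub>F\<^esub> T y i)"
    using T unfolding linear_map_def by blast
  moreover have "S (\<lambda>i\<in>{..<d}. T x i \<oplus>\<^bsub>F\<^esub> T y i) = (\<lambda>i\<in>{..<e}. S (T x) i \<oplus>\<^bsub>F\<^esub> S (T y) i)"
    using S linear_map_closed[OF T] xy unfolding linear_map_def by blast
  ultimately show "(S \<circ> T) (\<lambda>i\<in>{..<c}. x i \<oplus>\<^bsub>F\<^esub> y i) = (\<lambda>i\<in>{..<e}. (S \<circ> T) x i \<oplus>\<^bsub>F\<^esub> (S \<circ> T) y i)"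
    by (simp only: comp_def)
next
  fix a x assume ax: "a \<in> carrier F" "x \<in> coord_space F c"
  then have "T (\<lambda>i\<in>{..<c}. a \<otimes>\<^bsub>F\<^esub> x i) = (\<lambda>i\<in>{..<d}. a \<otimes>\<^bsub>F\<^esub> T x i)"
    using T unfolding linear_map_def by blast
  moreover have "S (\<lambda>i\<in>{..<d}. a \<otimes>\<^bsub>F\<^esub> T x i) = (\<lambda>i\<in>{..<e}. a \<otimes>\<^bsub>F\<^esub> S (T x) i)"
    using S linear_map_closed[OF T] ax unfolding linear_map_def by blast
  ultimately show "(S \<circ> T) (\<lambda>i\<in>{..<c}. a \<otimes>\<^bsub>F\<^esub> x i) = (\<lambda>i\<in>{..<e}. a \<otimes>\<^bsub>F\<^esub> (S \<circ> T) x i)"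
    by (simp only: comp_def)
qed

context cring
begin

lemma linear_bij_inverse:
  assumes T: "linear_bij R d e T"
  shows "linear_map R e d (inv_into (coord_space R d) T)"
proof -
  let ?S = "inv_into (coord_space R d) T"
  have bij: "bij_betw T (coord_space R d) (coord_space R e)" using T by (simp add: linear_bij_def)
  have S: "?S x \<in> coord_space R d" "T (?S x) = x" if "x \<in> coord_space R e" for x
    using that bij by (auto simp: bij_betw_def inv_into_into f_inv_into_f)
  have ST: "?S (T x) = x" if "x \<in> coord_space R d" for x
    using that bij by (simp add: bij_betw_def)
  show ?thesis unfolding linear_map_def
  proof (intro conjI ballI)
    show "?S \<in> coord_space R e \<rightarrow> coord_space R d" using S by auto
  next
    fix x y assume xy: "x \<in> coord_space R e" "y \<in> coord_space R e"
    have sum: "(\<lambda>i\<in>{..<d}. ?S x i \<oplus> ?S y i) \<in> coord_space R d"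
      using coord_space_nth[OF S(1)[OF xy(1)]] coord_space_nth[OF S(1)[OF xy(2)]]
      by (intro coord_space_restrict) simp
    have "T (\<lambda>i\<in>{..<d}. ?S x i \<oplus> ?S y i) = (\<lambda>i\<in>{..<e}. T (?S x) i \<oplus> T (?S y) i)"
      using T S(1)[OF xy(1)] S(1)[OF xy(2)] unfolding linear_bij_def by blast
    also have "\<dots> = (\<lambda>i\<in>{..<e}. x i \<oplus> y i)" by (simp only: S(2)[OF xy(1)] S(2)[OF xy(2)])
    finally show "?S (\<lambda>i\<in>{..<e}. x i \<oplus> y i) = (\<lambda>i\<in>{..<d}. ?S x i \<oplus> ?S y i)"
      using ST[OF sum] by simp
  next
    fix a x assume a: "a \<in> carrier R" and x: "x \<in> coord_space R e"
    have sc: "(\<lambda>i\<in>{..<d}. a \<otimes> ?S x i) \<in> coord_space R d"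
      using coord_space_nth[OF S(1)[OF x]] a by (intro coord_space_restrict) simp
    have "T (\<lambda>i\<in>{..<d}. a \<otimes> ?S x i) = (\<lambda>i\<in>{..<e}. a \<otimes> T (?S x) i)"
      using T a S(1)[OF x] unfolding linear_bij_def by blast
    also have "\<dots> = (\<lambda>i\<in>{..<e}. a \<otimes> x i)" by (simp only: S(2)[OF x])
    finally show "?S (\<lambda>i\<in>{..<e}. a \<otimes> x i) = (\<lambda>i\<in>{..<d}. a \<otimes> ?S x i)"
      using ST[OF sc] by simp
  qed
qed

context
  fixes h :: "nat \<Rightarrow> nat" and m e :: nat
  assumes h: "inj_on h {..<m}" "\<And>i. i < m \<Longrightarrow> h i < e"
begin

lemma inv_h: "i \<in> h ` {..<m} \<Longrightarrow> inv_into {..<m} h i < m"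
  using inv_into_into[of i h "{..<m}"] by simp

lemma coord_embed_nth [simp]: "i < m \<Longrightarrow> coord_embed R h m e v (h i) = v i"
  using h by (simp add: coord_embed_def)

lemma coord_embed_other: "i < e \<Longrightarrow> i \<notin> h ` {..<m} \<Longrightarrow> coord_embed R h m e v i = \<zero>"
  by (simp add: coord_embed_def)

lemma coord_embed_closed: "v \<in> coord_space R m \<Longrightarrow> coord_embed R h m e v \<in> coord_space R e"
  unfolding coord_embed_def by (intro coord_space_restrict) (auto simp: coord_space_nth inv_h)

lemma coord_embed_linear: "linear_map R m e (coord_embed R h m e)"
  unfolding linear_map_def
proof (intro conjI ballI)
  show "coord_embed R h m e \<in> coord_space R m \<rightarrow> coord_space R e" by (simp add: coord_embed_closed)
next
  fix x y
  show "coord_embed R h m e (\<lambda>i\<in>{..<m}. x i \<oplus> y i) =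
      (\<lambda>i\<in>{..<e}. coord_embed R h m e x i \<oplus> coord_embed R h m e y i)"
    by (auto simp: coord_embed_def inv_h fun_eq_iff)
next
  fix a x assume "a \<in> carrier R"
  then show "coord_embed R h m e (\<lambda>i\<in>{..<m}. a \<otimes> x i) = (\<lambda>i\<in>{..<e}. a \<otimes> coord_embed R h m e x i)"
    by (auto simp: coord_embed_def inv_h fun_eq_iff)
qed

lemma coord_embed_inj: "inj_on (coord_embed R h m e) (coord_space R m)"
proof (rule inj_onI)
  fix v w assume vw: "v \<in> coord_space R m" "w \<in> coord_space R m"
    and eq: "coord_embed R h m e v = coord_embed R h m e w"
  show "v = w"
  proof (rule PiE_ext)
    show "v i = w i" if "i \<in> {..<m}" for i
      using that coord_embed_nth[of i v] coord_embed_nth[of i w] eq by simp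
  qed (use vw in \<open>simp_all add: coord_space_def\<close>)
qed

lemma quad_value_coord_embed:
  assumes v: "v \<in> coord_space R m" and q: "fst q = e" "\<And>i j. i < e \<Longrightarrow> j < e \<Longrightarrow> snd q i j \<in> carrier R"
  shows "quad_value R q (coord_embed R h m e v) = quad_value R (m, \<lambda>i j. snd q (h i) (h j)) v"
proof -
  let ?w = "coord_embed R h m e v"
  have w: "?w i \<in> carrier R" if "i < e" for i using coord_space_nth[OF coord_embed_closed[OF v] that] .
  have sub: "(\<Oplus>i\<in>{..<e}. f i) = (\<Oplus>i\<in>{..<m}. f (h i))"
    if f: "\<And>i. i < e \<Longrightarrow> f i \<in> carrier R" "\<And>i. i < e \<Longrightarrow> i \<notin> h ` {..<m} \<Longrightarrow> f i = \<zero>" for f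
  proof -
    have "(\<Oplus>i\<in>{..<e}. f i) = (\<Oplus>i\<in>h ` {..<m}. f i)"
      using f h(2) by (intro add.finprod_mono_neutral_cong_right) auto
    also have "\<dots> = (\<Oplus>i\<in>{..<m}. f (h i))"
      using f h by (intro finsum_reindex) auto
    finally show ?thesis .
  qed
  have "quad_value R q ?w = (\<Oplus>i\<in>{..<e}. \<Oplus>j\<in>{..<e}. snd q i j \<otimes> ?w i \<otimes> ?w j)"
    by (simp add: quad_value_def q(1))
  also have "\<dots> = (\<Oplus>i\<in>{..<m}. \<Oplus>j\<in>{..<e}. snd q (h i) j \<otimes> ?w (h i) \<otimes> ?w j)"
    by (rule sub) (use q w in \<open>auto intro!: finsum_closed add.finprod_one_eqI simp: coord_embed_other\<close>)
  also have "\<dots> = (\<Oplus>i\<in>{..<m}. \<Oplus>j\<in>{..<m}. snd q (h i) (h j) \<otimes> v i \<otimes> v j)"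
  proof (rule finsum_cong')
    fix i assume "i \<in> {..<m}"
    then have i: "i < m" "h i < e" using h by auto
    have "(\<Oplus>j\<in>{..<e}. snd q (h i) j \<otimes> ?w (h i) \<otimes> ?w j) = (\<Oplus>j\<in>{..<m}. snd q (h i) (h j) \<otimes> ?w (h i) \<otimes> ?w (h j))"
      by (rule sub) (use q w i coord_space_nth[OF v i(1)] in \<open>auto simp: coord_embed_other\<close>)
    also have "\<dots> = (\<Oplus>j\<in>{..<m}. snd q (h i) (h j) \<otimes> v i \<otimes> v j)"
      using q h i coord_space_nth[OF v] by (intro finsum_cong') auto
    finally show "(\<Oplus>j\<in>{..<e}. snd q (h i) j \<otimes> ?w (h i) \<otimes> ?w j) = (\<Oplus>j\<in>{..<m}. snd q (h i) (h j) \<otimes> v i \<otimes> v j)" .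
  qed (use q h coord_space_nth[OF v] in \<open>auto intro!: finsum_closed\<close>)
  also have "\<dots> = quad_value R (m, \<lambda>i j. snd q (h i) (h j)) v"
    by (simp add: quad_value_def)
  finally show ?thesis .
qed

text \<open>A subform given by a submatrix of \<open>r\<close> is carried into \<open>q\<close> by
  the coordinate inclusion followed by the inverse isometry.\<close>

lemma isometric_subform:
  assumes iso: "quad_isometric R q r"
    and r: "fst r = e" "\<And>i j. i < e \<Longrightarrow> j < e \<Longrightarrow> snd r i j \<in> carrier R"
    and sub: "\<And>i j. i < m \<Longrightarrow> j < m \<Longrightarrow> snd r (h i) (h j) = M i j"
  shows "\<exists>T. linear_map R m (fst q) T \<and> inj_on T (coord_space R m) \<and>
    (\<forall>v\<in>coord_space R m. quad_value R q (T v) = quad_value R (m, M) v)"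
proof -
  obtain T where T: "linear_bij R (fst q) e T"
    and val: "\<And>x. x \<in> coord_space R (fst q) \<Longrightarrow> quad_value R r (T x) = quad_value R q x"
    using iso r(1) by (auto simp: quad_isometric_def)
  let ?S = "inv_into (coord_space R (fst q)) T" and ?E = "coord_embed R h m e"
  have surj: "T ` coord_space R (fst q) = coord_space R e"
    using T by (simp add: linear_bij_def bij_betw_def)
  have M: "M i j \<in> carrier R" if "i < m" "j < m" for i j
    using sub[OF that] r(2)[OF h(2)[OF that(1)] h(2)[OF that(2)]] by simp
  show ?thesis
  proof (intro exI[of _ "?S \<circ> ?E"] conjI ballI)
    show "linear_map R m (fst q) (?S \<circ> ?E)"
      by (rule linear_map_comp[OF linear_bij_inverse[OF T] coord_embed_linear])
    have "inj_on ?S (?E ` coord_space R m)"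
      by (rule inj_on_inv_into) (use surj coord_embed_closed in auto)
    then show "inj_on (?S \<circ> ?E) (coord_space R m)"
      by (rule comp_inj_on[OF coord_embed_inj])
    fix v assume v: "v \<in> coord_space R m"
    have Ev: "?E v \<in> T ` coord_space R (fst q)" using coord_embed_closed[OF v] surj by simp
    have "quad_value R q (?S (?E v)) = quad_value R r (T (?S (?E v)))"
      using inv_into_into[OF Ev] by (simp add: val)
    also have "T (?S (?E v)) = ?E v" using Ev by (rule f_inv_into_f)
    also have "quad_value R r (?E v) = quad_value R (m, \<lambda>i j. snd r (h i) (h j)) v"
      by (rule quad_value_coord_embed[OF v r])
    also have "\<dots> = quad_value R (m, M) v"
      unfolding quad_value_def fst_conv snd_conv using M coord_space_nth[OF v]
      by (intro finsum_cong') (auto simp: sub intro!: finsum_cong' finsum_closed)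
    finally show "quad_value R q ((?S \<circ> ?E) v) = quad_value R (m, M) v" by simp
  qed
qed

end

lemma is_bil_pfister_1: "is_bil_pfister R 1 C \<Longrightarrow> \<exists>c\<in>carrier R. C = bil_pfister R [c]"
proof -
  assume "is_bil_pfister R 1 C"
  then obtain as where as: "length as = 1" "set as \<subseteq> carrier R - {\<zero>}" "C = bil_pfister R as"
    unfolding is_bil_pfister_def by blast
  moreover from as(1) obtain c where "as = [c]" by (cases as) auto
  ultimately show ?thesis by (intro bexI[of _ c]) simp_all
qed

lemma is_quad_pfister_1: "is_quad_pfister R 1 q \<Longrightarrow> \<exists>b\<in>carrier R. q = quad_pfister R [] b"
proof -
  assume "is_quad_pfister R 1 q"
  then obtain as b where "Suc (length as) = 1" "b \<in> carrier R" "q = quad_pfister R as b"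
    unfolding is_quad_pfister_def by blast
  then show ?thesis by (intro bexI[of _ b]) simp_all
qed

text \<open>The product of <1, c> with \<open>p\<close> restricts to \<open>p\<close> on the first
  half of the coordinates, whatever \<open>c\<close> is; hence \<open>h = id\<close> for both
  forms.\<close>

lemma share_quad_factor_common_subform:
  assumes "share_quad_factor R n q1 q2"
  shows "\<exists>T1 T2. linear_map R (2 ^ (n - 1)) (fst q1) T1 \<and> inj_on T1 (coord_space R (2 ^ (n - 1))) \<and>
    linear_map R (2 ^ (n - 1)) (fst q2) T2 \<and>
    (\<forall>v\<in>coord_space R (2 ^ (n - 1)). quad_value R q1 (T1 v) = quad_value R q2 (T2 v))"
proof -
  let ?m = "2 ^ (n - 1) :: nat"
  obtain p C1 C2 where p: "is_quad_pfister R (n - 1) p"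
    and C: "is_bil_pfister R 1 C1" "is_bil_pfister R 1 C2"
    and iso': "quad_isometric R q1 (form_tensor R C1 p)" "quad_isometric R q2 (form_tensor R C2 p)"
    using assms unfolding share_quad_factor_def by blast
  obtain as b where as: "Suc (length as) = n - 1" "set as \<subseteq> carrier R" "b \<in> carrier R"
    and p': "p = quad_pfister R as b"
    using p unfolding is_quad_pfister_def by blast
  obtain c1 c2 where c: "c1 \<in> carrier R" "c2 \<in> carrier R"
    and C': "C1 = bil_pfister R [c1]" "C2 = bil_pfister R [c2]"
    using is_bil_pfister_1[OF C(1)] is_bil_pfister_1[OF C(2)] by blast
  note iso = iso'[unfolded p' C']
  let ?p = "quad_pfister R as b"
  have m: "?m = 2 ^ length as * 2" unfolding as(1)[symmetric] by simp
  have p: "fst ?p = ?m" "\<And>i j. i < ?m \<Longrightarrow> j < ?m \<Longrightarrow> snd ?p i j \<in> carrier R"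
    using as quad_pfister_closed unfolding m by auto
  have "\<exists>T. linear_map R ?m (fst q) T \<and> inj_on T (coord_space R ?m) \<and>
      (\<forall>v\<in>coord_space R ?m. quad_value R q (T v) = quad_value R (?m, snd ?p) v)"
    if q: "quad_isometric R q (form_tensor R (bil_pfister R [c]) ?p)" and c: "c \<in> carrier R" for q c
  proof (rule isometric_subform[OF _ _ q, where h = id and e = "2 * ?m"])
    show "snd (form_tensor R (bil_pfister R [c]) ?p) i j \<in> carrier R" if "i < 2 * ?m" "j < 2 * ?m" for i j
    proof -
      have "i div ?m < 2" "j div ?m < 2" using that by (simp_all add: less_mult_imp_div_less)
      then show ?thesis using c p bil_pfister_closed[of "[c]" "i div ?m" "j div ?m"]
        by (simp add: form_tensor_def)
    qed
    show "snd (form_tensor R (bil_pfister R [c]) ?p) (id i) (id j) = snd ?p i j" if "i < ?m" "j < ?m" for i j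
      using that p c bil_pfister_nth[of "[c]" 0 0] by (simp add: form_tensor_def)
  qed (use p in \<open>auto simp: form_tensor_def\<close>)
  note sub = this
  obtain T1 where T1: "linear_map R ?m (fst q1) T1" "inj_on T1 (coord_space R ?m)"
    "\<And>v. v \<in> coord_space R ?m \<Longrightarrow> quad_value R q1 (T1 v) = quad_value R (?m, snd ?p) v"
    using sub[OF iso(1) c(1)] by blast
  obtain T2 where T2: "linear_map R ?m (fst q2) T2"
    "\<And>v. v \<in> coord_space R ?m \<Longrightarrow> quad_value R q2 (T2 v) = quad_value R (?m, snd ?p) v"
    using sub[OF iso(2) c(2)] by blast
  show ?thesis
    by (intro exI[of _ T1] exI[of _ T2] conjI ballI) (simp_all only: T1 T2)
qed

text \<open>On the vectors without \<open>y\<close>-coordinates, that is on the even positions, the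
  product of \<open>B\<close> with [1, b] takes the values B(v, v), which do not depend on
  \<open>b\<close>. This common subform is totally singular and again has half the
  dimension.\<close>

lemma share_bil_factor_common_subform:
  assumes "share_bil_factor R n q1 q2"
  shows "\<exists>T1 T2. linear_map R (2 ^ (n - 1)) (fst q1) T1 \<and> inj_on T1 (coord_space R (2 ^ (n - 1))) \<and>
    linear_map R (2 ^ (n - 1)) (fst q2) T2 \<and>
    (\<forall>v\<in>coord_space R (2 ^ (n - 1)). quad_value R q1 (T1 v) = quad_value R q2 (T2 v))"
proof -
  let ?m = "2 ^ (n - 1) :: nat"
  obtain B r1 r2 where B: "is_bil_pfister R (n - 1) B"
    and r: "is_quad_pfister R 1 r1" "is_quad_pfister R 1 r2"
    and iso': "quad_isometric R q1 (form_tensor R B r1)" "quad_isometric R q2 (form_tensor R B r2)"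
    using assms unfolding share_bil_factor_def by blast
  obtain as where as: "length as = n - 1" "set as \<subseteq> carrier R" and B': "B = bil_pfister R as"
    using B unfolding is_bil_pfister_def by blast
  obtain b1 b2 where b: "b1 \<in> carrier R" "b2 \<in> carrier R"
    and r': "r1 = quad_pfister R [] b1" "r2 = quad_pfister R [] b2"
    using is_quad_pfister_1[OF r(1)] is_quad_pfister_1[OF r(2)] by blast
  note iso = iso'[unfolded B' r']
  let ?B = "bil_pfister R as"
  have B: "fst ?B = ?m" "\<And>i j. i < ?m \<Longrightarrow> j < ?m \<Longrightarrow> snd ?B i j \<in> carrier R"
    using as bil_pfister_closed by auto
  have "\<exists>T. linear_map R ?m (fst q) T \<and> inj_on T (coord_space R ?m) \<and>
      (\<forall>v\<in>coord_space R ?m. quad_value R q (T v) = quad_value R (?m, snd ?B) v)"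
    if q: "quad_isometric R q (form_tensor R ?B (quad_pfister R [] b))" and b: "b \<in> carrier R" for q b
  proof (rule isometric_subform[OF _ _ q, where h = "\<lambda>i. 2 * i" and e = "?m * 2"])
    show "snd (form_tensor R ?B (quad_pfister R [] b)) i j \<in> carrier R" if "i < ?m * 2" "j < ?m * 2" for i j
    proof -
      have "i div 2 < ?m" "j div 2 < ?m" using that by (simp_all add: less_mult_imp_div_less)
      then show ?thesis using b B quad_pfister_closed[of "[]" b "i mod 2" "j mod 2"]
        by (simp add: form_tensor_def)
    qed
    show "snd (form_tensor R ?B (quad_pfister R [] b)) (2 * i) (2 * j) = snd ?B i j"
      if "i < ?m" "j < ?m" for i j
      using that B bil_pfister_nth[of "[]" 0 0]
      by (simp add: form_tensor_def quad_pfister_def binary_quad_def)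
  qed (use B in \<open>auto simp: form_tensor_def inj_on_def\<close>)
  note sub = this
  obtain T1 where T1: "linear_map R ?m (fst q1) T1" "inj_on T1 (coord_space R ?m)"
    "\<And>v. v \<in> coord_space R ?m \<Longrightarrow> quad_value R q1 (T1 v) = quad_value R (?m, snd ?B) v"
    using sub[OF iso(1) b(1)] by blast
  obtain T2 where T2: "linear_map R ?m (fst q2) T2"
    "\<And>v. v \<in> coord_space R ?m \<Longrightarrow> quad_value R q2 (T2 v) = quad_value R (?m, snd ?B) v"
    using sub[OF iso(2) b(2)] by blast
  show ?thesis
    by (intro exI[of _ T1] exI[of _ T2] conjI ballI) (simp_all only: T1 T2)
qed

end

section \<open>The iterated Laurent series fields\<close>

definition series_coeff :: "'a iterated \<Rightarrow> int \<Rightarrow> 'a iterated" where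
  "series_coeff x = (case x of Series f \<Rightarrow> f | Const _ \<Rightarrow> undefined)"

definition series_monom :: "'a iterated ring \<Rightarrow> 'a iterated \<Rightarrow> int \<Rightarrow> 'a iterated" where
  "series_monom R a i = Series (\<lambda>j. if j = i then a else \<zero>\<^bsub>R\<^esub>)"

lemma series_coeff_Series [simp]: "series_coeff (Series f) = f"
  by (simp add: series_coeff_def)

text \<open>The constructor \<open>Series\<close> is an isomorphism onto its image, so each
  assumption reduces to one on coefficient functions; the one on products is
  \<open>laurent_mult_lead\<close>.\<close>

lemma laurent_extension_iterated:
  assumes "domain K"
  shows "laurent_extension K (image_ring Series (laurent_ring K)) series_coeff (series_monom K)"
    (is "laurent_extension K ?F _ _")
proof -
  interpret K: "domain" K by fact
  interpret L: "domain" "laurent_ring K" by (rule K.laurent_domain)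
  have inj: "inj_on Series (carrier (laurent_ring K))" by (simp add: inj_on_def)
  interpret F: "domain" ?F by (rule L.inj_imp_image_ring_is_domain[OF inj])
  have hom: "Series \<in> ring_hom (laurent_ring K) ?F"
    using inj_imp_image_ring_iso[OF inj] by (simp add: ring_iso_def)
  have F: "f \<in> carrier ?F \<longleftrightarrow> (\<exists>g\<in>carrier (laurent_ring K). f = Series g)" for f
    by (auto simp: image_ring_carrier)
  have nth: "g i \<in> carrier K" if "g \<in> carrier (laurent_ring K)" for g i
    using that by (simp add: laurent_ring_simps(1))
  show ?thesis
  proof unfold_locales
    show "series_coeff f i \<in> carrier K" if "f \<in> carrier ?F" for f i
      using that nth by (auto simp: F)
    show "series_coeff (f \<oplus>\<^bsub>?F\<^esub> g) i = series_coeff f i \<oplus>\<^bsub>K\<^esub> series_coeff g i"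
      if fg: "f \<in> carrier ?F" "g \<in> carrier ?F" for f g i
    proof -
      obtain f' g' where f: "f = Series f'" "f' \<in> carrier (laurent_ring K)"
        and g: "g = Series g'" "g' \<in> carrier (laurent_ring K)" using fg by (auto simp: F)
      show ?thesis
        unfolding f g ring_hom_add[OF hom f(2) g(2), symmetric] by (simp add: laurent_ring_simps(5))
    qed
    show "\<exists>N. \<forall>i<N. series_coeff f i = \<zero>\<^bsub>K\<^esub>" if "f \<in> carrier ?F" for f
      using that unfolding F laurent_ring_simps(1) by fastforce
    show "f = \<zero>\<^bsub>?F\<^esub>" if "f \<in> carrier ?F" "\<And>i. series_coeff f i = \<zero>\<^bsub>K\<^esub>" for f
      using that by (auto simp: F image_ring_zero laurent_ring_simps(4) fun_eq_iff)
    show "series_coeff (f \<otimes>\<^bsub>?F\<^esub> g) (M + N) = series_coeff f M \<otimes>\<^bsub>K\<^esub> series_coeff g N \<and>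
        (\<forall>i<M + N. series_coeff (f \<otimes>\<^bsub>?F\<^esub> g) i = \<zero>\<^bsub>K\<^esub>)"
      if fg: "f \<in> carrier ?F" "g \<in> carrier ?F"
        and z: "\<And>i. i < M \<Longrightarrow> series_coeff f i = \<zero>\<^bsub>K\<^esub>" "\<And>i. i < N \<Longrightarrow> series_coeff g i = \<zero>\<^bsub>K\<^esub>" for f g M N
    proof -
      obtain f' g' where f: "f = Series f'" "f' \<in> carrier (laurent_ring K)"
        and g: "g = Series g'" "g' \<in> carrier (laurent_ring K)" using fg by (auto simp: F)
      have z': "f' i = \<zero>\<^bsub>K\<^esub>" if "i < M" for i using z(1)[OF that] by (simp add: f)
      have z'': "g' i = \<zero>\<^bsub>K\<^esub>" if "i < N" for i using z(2)[OF that] by (simp add: g)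
      show ?thesis
        unfolding f g ring_hom_mult[OF hom f(2) g(2), symmetric] series_coeff_Series
      proof (intro conjI allI impI)
        show "(f' \<otimes>\<^bsub>laurent_ring K\<^esub> g') (M + N) = f' M \<otimes>\<^bsub>K\<^esub> g' N"
          by (rule K.laurent_mult_lead(1)) (use nth f g z' z'' in auto)
        show "(f' \<otimes>\<^bsub>laurent_ring K\<^esub> g') i = \<zero>\<^bsub>K\<^esub>" if "i < M + N" for i
          by (rule K.laurent_mult_lead(2)[of f' g' M N]) (use nth f g z' z'' that in auto)
      qed
    qed
    show "series_monom K a i \<in> carrier ?F" if "a \<in> carrier K" for a i
      using that by (auto simp: F series_monom_def laurent_ring_simps(1) intro!: exI[of _ i])
    show "series_coeff (series_monom K a i) j = (if j = i then a else \<zero>\<^bsub>K\<^esub>)" for a i j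
      by (simp add: series_monom_def)
    show "series_monom K \<one>\<^bsub>K\<^esub> 0 = \<one>\<^bsub>?F\<^esub>"
      by (simp add: series_monom_def image_ring_one laurent_ring_simps(3))
  qed
qed

lemma iterated_laurent_domain:
  assumes "domain k" shows "domain (iterated_laurent k m)"
proof (induction m)
  case 0
  interpret "domain" k by fact
  show ?case using inj_imp_image_ring_is_domain[of Const] by (simp add: inj_on_def)
next
  case (Suc m)
  then interpret "domain" "iterated_laurent k m" .
  interpret L: "domain" "laurent_ring (iterated_laurent k m)" by (rule laurent_domain)
  show ?case using L.inj_imp_image_ring_is_domain[of Series] by (simp add: inj_on_def)
qed

lemma (in laurent_extension) two_eq_zero:
  assumes "\<one>\<^bsub>K\<^esub> \<oplus>\<^bsub>K\<^esub> \<one>\<^bsub>K\<^esub> = \<zero>\<^bsub>K\<^esub>" shows "\<one>\<^bsub>F\<^esub> \<oplus>\<^bsub>F\<^esub> \<one>\<^bsub>F\<^esub> = \<zero>\<^bsub>F\<^esub>"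
  by (rule coeff_eq_zero_imp) (simp_all add: coeff_one assms)

lemma iterated_laurent_two_eq_zero:
  assumes "domain k" "\<one>\<^bsub>k\<^esub> \<oplus>\<^bsub>k\<^esub> \<one>\<^bsub>k\<^esub> = \<zero>\<^bsub>k\<^esub>"
  shows "\<one>\<^bsub>iterated_laurent k m\<^esub> \<oplus>\<^bsub>iterated_laurent k m\<^esub> \<one>\<^bsub>iterated_laurent k m\<^esub> = \<zero>\<^bsub>iterated_laurent k m\<^esub>"
proof (induction m)
  case 0
  interpret "domain" k by fact
  have hom: "Const \<in> ring_hom k (image_ring Const k)"
    using inj_imp_image_ring_iso[of Const k] by (simp add: inj_on_def ring_iso_def)
  show ?case
    using ring_hom_add[OF hom one_closed one_closed] assms(2)
    by (simp add: image_ring_one image_ring_zero)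
next
  case (Suc m)
  interpret laurent_extension "iterated_laurent k m" "iterated_laurent k (Suc m)" series_coeff
    "series_monom (iterated_laurent k m)"
    using laurent_extension_iterated[OF iterated_laurent_domain[OF assms(1)]] by simp
  show ?case by (rule two_eq_zero[OF Suc])
qed

lemma ring_char_2:
  assumes "ring k" "ring_char k = 2" shows "\<one>\<^bsub>k\<^esub> \<oplus>\<^bsub>k\<^esub> \<one>\<^bsub>k\<^esub> = \<zero>\<^bsub>k\<^esub>"
proof -
  interpret ring k by fact
  let ?P = "\<lambda>n::nat. n > 0 \<and> [n] \<cdot>\<^bsub>k\<^esub> \<one>\<^bsub>k\<^esub> = \<zero>\<^bsub>k\<^esub>"
  have ex: "\<exists>n. ?P n" and L: "(LEAST n. ?P n) = 2"
    using assms(2) unfolding ring_char_def by (auto split: if_splits)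
  have "?P 2" using LeastI_ex[OF ex] unfolding L .
  then show ?thesis by (simp add: numeral_2_eq_2)
qed

lemma (in cring) pfister_diag_0 [simp]: "pfister_diag R as 0 = \<one>"
  by (induction as) auto

section \<open>Diagonals of the bilinear factors and their anisotropy\<close>

context laurent_extension
begin

text \<open>Constants have order at least 0, and coefficients at 0 multiply on such
  elements.\<close>

lemma pfister_diag_lift:
  assumes "set as \<subseteq> carrier K"
  shows "ord_ge 0 (pfister_diag F (map (\<lambda>a. monom a 0) as) s)"
    and "coeff (pfister_diag F (map (\<lambda>a. monom a 0) as) s) 0 = pfister_diag K as s"
proof -
  have "ord_ge 0 (pfister_diag F (map (\<lambda>a. monom a 0) as) s) \<and>
      coeff (pfister_diag F (map (\<lambda>a. monom a 0) as) s) 0 = pfister_diag K as s"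
    using assms
  proof (induction as arbitrary: s)
    case (Cons a as)
    have IH: "ord_ge 0 (pfister_diag F (map (\<lambda>a. monom a 0) as) s)"
      "coeff (pfister_diag F (map (\<lambda>a. monom a 0) as) s) 0 = pfister_diag K as s" for s
      using Cons by auto
    have a: "a \<in> carrier K" "ord_ge 0 (monom a 0)" using Cons.prems by auto
    show ?case
      using ord_ge_mult[OF a(2) IH(1)] coeff_mult_lead[OF a(2) IH(1)] a(1) IH by simp
  qed (simp add: coeff_one)
  then show "ord_ge 0 (pfister_diag F (map (\<lambda>a. monom a 0) as) s)"
    "coeff (pfister_diag F (map (\<lambda>a. monom a 0) as) s) 0 = pfister_diag K as s" by auto
qed

lemma monom_nonzero: "a \<in> carrier K \<Longrightarrow> a \<noteq> \<zero>\<^bsub>K\<^esub> \<Longrightarrow> monom a i \<noteq> \<zero>\<^bsub>F\<^esub>"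
  by (metis coeff_monom coeff_zero)

text \<open>A new head of order -1 doubles the lifted diagonal in the way treated by
  \<open>sq_anisotropic_extend\<close>.\<close>

lemma pfister_diag_anisotropic:
  assumes as: "set as \<subseteq> carrier K" and aniso: "sq_anisotropic K (pfister_diag K as) (2 ^ length as)"
  shows "sq_anisotropic F (pfister_diag F (monom \<one>\<^bsub>K\<^esub> (-1) # map (\<lambda>a. monom a 0) as)) (2 ^ Suc (length as))"
proof -
  let ?d = "pfister_diag F (map (\<lambda>a. monom a 0) as)"
  have "(\<lambda>s. coeff (?d s) 0) = pfister_diag K as" by (simp add: pfister_diag_lift(2)[OF as])
  then have "sq_anisotropic F (pfister_diag F (monom \<one>\<^bsub>K\<^esub> (-1) # map (\<lambda>a. monom a 0) as))
      (2 ^ length as + 2 ^ length as)"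
    using pfister_diag_lift(1)[OF as] aniso
    by (intro sq_anisotropic_extend[where d = ?d and b = "monom \<one>\<^bsub>K\<^esub> (-1)"]) auto
  then show ?thesis by (simp add: mult_2)
qed

end

text \<open>The inverses of the indeterminates \<open>\<alpha>\<^bsub>j+1\<^esub>, \<dots>, \<alpha>\<^bsub>m\<^esub>\<close>, the last one first.\<close>

primrec inverse_indets :: "('a, 'm) ring_scheme \<Rightarrow> nat \<Rightarrow> nat \<Rightarrow> 'a iterated list" where
  "inverse_indets k j 0 = []"
| "inverse_indets k j (Suc m) =
     (if j \<le> m then [series_monom (iterated_laurent k m) \<one>\<^bsub>iterated_laurent k m\<^esub> (-1)] else []) @
     map (\<lambda>a. series_monom (iterated_laurent k m) a 0) (inverse_indets k j m)"

lemma inverse_indets_length [simp]: "length (inverse_indets k j m) = m - j"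
  by (induction m) auto

lemma inverse_indets:
  assumes "domain k"
  shows "set (inverse_indets k j m) \<subseteq> carrier (iterated_laurent k m) - {\<zero>\<^bsub>iterated_laurent k m\<^esub>}"
    and "sq_anisotropic (iterated_laurent k m)
      (pfister_diag (iterated_laurent k m) (inverse_indets k j m)) (2 ^ (m - j))"
proof -
  let ?K = "iterated_laurent k"
  \<comment> \<open>The form x^2 is the start of the induction at 0, and it remains the form in
    question for as long as no indeterminate beyond \<open>j\<close> has been adjoined.\<close>
  have empty: "sq_anisotropic (?K m) (pfister_diag (?K m) []) 1" for m
  proof -
    interpret "domain" "?K m" by (rule iterated_laurent_domain[OF assms])
    show ?thesis
      unfolding sq_anisotropic_def
    proof (intro ballI impI allI)
      fix x and s :: nat assume x: "x \<in> {..<1::nat} \<rightarrow> carrier (?K m)" and s: "s < 1"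
        and z: "sq_form (?K m) (pfister_diag (?K m) []) 1 x = \<zero>\<^bsub>?K m\<^esub>"
      have x0: "x 0 \<in> carrier (?K m)" using x by auto
      have "sq_form (?K m) (pfister_diag (?K m) []) 1 x = x 0 \<otimes>\<^bsub>?K m\<^esub> x 0"
        unfolding sq_form_def using x0 by (subst finsum_eq_single[of _ 0]) auto
      then show "x s = \<zero>\<^bsub>?K m\<^esub>" using integral[of "x 0" "x 0"] x0 z s by auto
    qed
  qed
  have "set (inverse_indets k j m) \<subseteq> carrier (?K m) - {\<zero>\<^bsub>?K m\<^esub>} \<and>
    sq_anisotropic (?K m) (pfister_diag (?K m) (inverse_indets k j m)) (2 ^ (m - j))"
  proof (induction m)
    case 0
    show ?case using empty[of 0] by (simp del: pfister_diag.simps)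
  next
    case (Suc m)
    let ?as = "inverse_indets k j m"
    interpret laurent_extension "?K m" "?K (Suc m)" series_coeff "series_monom (?K m)"
      using laurent_extension_iterated[OF iterated_laurent_domain[OF assms]] by simp
    have as: "set ?as \<subseteq> carrier (?K m) - {\<zero>\<^bsub>?K m\<^esub>}" using Suc.IH by blast
    then have map: "set (map (\<lambda>a. series_monom (?K m) a 0) ?as) \<subseteq> carrier (?K (Suc m)) - {\<zero>\<^bsub>?K (Suc m)\<^esub>}"
      using monom_nonzero by (auto simp del: iterated_laurent.simps)
    show ?case
    proof (cases "j \<le> m")
      case True
      have "series_monom (?K m) \<one>\<^bsub>?K m\<^esub> (-1) \<in> carrier (?K (Suc m)) - {\<zero>\<^bsub>?K (Suc m)\<^esub>}"
        using monom_nonzero by (simp del: iterated_laurent.simps)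
      moreover have "sq_anisotropic (?K (Suc m)) (pfister_diag (?K (Suc m))
          (series_monom (?K m) \<one>\<^bsub>?K m\<^esub> (-1) # map (\<lambda>a. series_monom (?K m) a 0) ?as)) (2 ^ Suc (length ?as))"
        using as Suc.IH by (intro pfister_diag_anisotropic) auto
      ultimately show ?thesis
        using map True by (simp add: Suc_diff_le del: iterated_laurent.simps pfister_diag.simps)
    next
      case False
      then have "inverse_indets k j (Suc m) = []"
        using inverse_indets_length[of k j "Suc m"] by (metis diff_is_0_eq length_0_conv not_less_eq_eq)
      then show ?thesis using empty[of "Suc m"] False by (simp del: iterated_laurent.simps inverse_indets.simps pfister_diag.simps)
    qed
  qed
  then show "set (inverse_indets k j m) \<subseteq> carrier (iterated_laurent k m) - {\<zero>\<^bsub>iterated_laurent k m\<^esub>}"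
    "sq_anisotropic (iterated_laurent k m)
      (pfister_diag (iterated_laurent k m) (inverse_indets k j m)) (2 ^ (m - j))" by auto
qed

theorem theorem4p2:
  fixes k :: "('a, 'm) ring_scheme" and n :: nat
  assumes "field k" and "ring_char k = 2" and "n \<ge> 2"
  shows "\<not> Iq_linked (iterated_laurent k (n + 1)) n"
proof
  assume linked: "Iq_linked (iterated_laurent k (n + 1)) n"
  \<comment> \<open>For \<open>n = 1\<close> any two forms share the bilinear factor <1>. From
    \<open>n = 2\<close> on, pi_2 has a bilinear slot to hold u_n, which is the use of
    \<open>1 \<le> m\<close>.\<close>
  obtain m where n: "n = Suc m" "1 \<le> m" using \<open>n \<ge> 2\<close> by (cases n) auto
  have k: "domain k" using \<open>field k\<close> by (rule field.axioms)
  have two: "\<one>\<^bsub>k\<^esub> \<oplus>\<^bsub>k\<^esub> \<one>\<^bsub>k\<^esub> = \<zero>\<^bsub>k\<^esub>"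
    using k \<open>ring_char k = 2\<close> by (intro ring_char_2) (auto simp: domain_def cring_def)
  define L K F where LKF: "L = iterated_laurent k m" "K = iterated_laurent k n" "F = iterated_laurent k (n + 1)"
  have two': "\<one>\<^bsub>L\<^esub> \<oplus>\<^bsub>L\<^esub> \<one>\<^bsub>L\<^esub> = \<zero>\<^bsub>L\<^esub>" "\<one>\<^bsub>K\<^esub> \<oplus>\<^bsub>K\<^esub> \<one>\<^bsub>K\<^esub> = \<zero>\<^bsub>K\<^esub>"
    unfolding LKF by (rule iterated_laurent_two_eq_zero[OF k two])+
  interpret LK: laurent_extension L K series_coeff "series_monom L"
    using laurent_extension_iterated[OF iterated_laurent_domain[OF k]] by (simp add: LKF n)
  interpret KF: laurent_extension K F series_coeff "series_monom K"
    using laurent_extension_iterated[OF iterated_laurent_domain[OF k], of n] by (simp add: LKF)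
  let ?M = "2 ^ m :: nat"
  \<comment> \<open>Over \<open>L\<close>, \<open>as\<close> lists u_m, ..., u_1 and
    \<open>bs\<close> lists u_m, ..., u_2. The elements \<open>u\<close> and \<open>v\<close> are
    u_n over \<open>K\<close> and u_(n+1) over \<open>F\<close>; all others enter as
    constants.\<close>
  define as where "as = inverse_indets k 0 m"
  define bs where "bs = inverse_indets k 1 m"
  define u where "u = series_monom L \<one>\<^bsub>L\<^esub> (-1)"
  define v where "v = series_monom K \<one>\<^bsub>K\<^esub> (-1)"
  let ?as = "map (\<lambda>a. series_monom L a 0) as" and ?bs = "u # map (\<lambda>a. series_monom L a 0) bs"
  have len: "length as = m" "length bs = m - 1" "length ?bs = m"
    using n by (simp_all add: as_def bs_def)
  have as: "set as \<subseteq> carrier L - {\<zero>\<^bsub>L\<^esub>}" "sq_anisotropic L (pfister_diag L as) ?M"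
    using inverse_indets[OF k, where j = 0 and m = m] by (simp_all add: as_def LKF)
  have bs: "?bs = inverse_indets k 1 n" using n by (simp add: bs_def u_def LKF)
  have bs': "set ?bs \<subseteq> carrier K - {\<zero>\<^bsub>K\<^esub>}" "sq_anisotropic K (pfister_diag K ?bs) ?M"
    unfolding bs using inverse_indets[OF k, where j = 1 and m = n] by (simp_all add: n LKF del: iterated_laurent.simps inverse_indets.simps)
  have u: "u \<in> carrier K" "LK.ord_ge (-1) u" "series_coeff u (-1) = \<one>\<^bsub>L\<^esub>" unfolding u_def by simp_all
  have v: "v \<in> carrier F" "KF.ord_ge (-1) v" "series_coeff v (-1) = \<one>\<^bsub>K\<^esub>" unfolding v_def by simp_all
  have as': "set ?as \<subseteq> carrier K - {\<zero>\<^bsub>K\<^esub>}" using as(1) LK.monom_nonzero by auto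
  let ?as2 = "map (\<lambda>a. series_monom K a 0) ?as" and ?bs2 = "map (\<lambda>a. series_monom K a 0) ?bs"
  let ?u = "series_monom K u 0"
  have u2: "?u \<in> carrier F" "KF.ord_ge 0 ?u" "series_coeff ?u 0 = u" using u(1) by simp_all
  have as2: "set ?as2 \<subseteq> carrier F - {\<zero>\<^bsub>F\<^esub>}" using as' KF.monom_nonzero by auto
  have bs2: "set ?bs2 \<subseteq> carrier F - {\<zero>\<^bsub>F\<^esub>}" using bs' KF.monom_nonzero by auto
  let ?q1 = "quad_pfister F ?as2 ?u" and ?q2 = "quad_pfister F ?bs2 v"
  have len2: "length ?as2 = m" "length ?bs2 = m" using len by simp_all
  have "is_quad_pfister F n (quad_pfister F cs c)"
    if "length cs = m" "set cs \<subseteq> carrier F - {\<zero>\<^bsub>F\<^esub>}" "c \<in> carrier F" for cs c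
    unfolding is_quad_pfister_def n(1) using that by blast
  from this[OF len2(1) as2 u2(1)] this[OF len2(2) bs2 v(1)]
  have "share_quad_factor F n ?q1 ?q2 \<or> share_bil_factor F n ?q1 ?q2"
    using linked unfolding Iq_linked_def LKF(3) by blast
  then have "\<exists>T1 T2. linear_map F (2 ^ (n - 1)) (fst ?q1) T1 \<and> inj_on T1 (coord_space F (2 ^ (n - 1))) \<and>
      linear_map F (2 ^ (n - 1)) (fst ?q2) T2 \<and>
      (\<forall>v\<in>coord_space F (2 ^ (n - 1)). quad_value F ?q1 (T1 v) = quad_value F ?q2 (T2 v))"
  proof
    assume "share_quad_factor F n ?q1 ?q2"
    then show ?thesis by (rule KF.F.share_quad_factor_common_subform)
  next
    assume "share_bil_factor F n ?q1 ?q2"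
    then show ?thesis by (rule KF.F.share_bil_factor_common_subform)
  qed
  moreover have dim: "n - 1 = m" "fst ?q1 = 2 * ?M" "fst ?q2 = 2 * ?M"
    by (simp_all only: quad_pfister_dim len2 n mult.commute diff_Suc_1)
  ultimately obtain T1 T2 where T1: "linear_map F ?M (2 * ?M) T1" "inj_on T1 (coord_space F ?M)"
    and T2: "linear_map F ?M (2 * ?M) T2"
    and val: "\<And>x. x \<in> coord_space F ?M \<Longrightarrow> quad_value F ?q1 (T1 x) = quad_value F ?q2 (T2 x)"
    unfolding dim by blast
  let ?d = "pfister_diag F ?as2" and ?d' = "pfister_diag F ?bs2"
  note sub = subset_trans[OF as' Diff_subset] subset_trans[OF bs'(1) Diff_subset]
    subset_trans[OF as(1) Diff_subset] subset_trans[OF as2 Diff_subset] subset_trans[OF bs2 Diff_subset]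
  have d: "KF.ord_ge 0 (?d s)" "series_coeff (?d s) 0 = pfister_diag K ?as s" for s
    by (rule KF.pfister_diag_lift[OF sub(1)])+
  have d': "KF.ord_ge 0 (?d' s)" "series_coeff (?d' s) 0 = pfister_diag K ?bs s" for s
    by (rule KF.pfister_diag_lift[OF sub(2)])+
  have e: "LK.ord_ge 0 (pfister_diag K ?as s)" "series_coeff (pfister_diag K ?as s) 0 = pfister_diag L as s" for s
    by (rule LK.pfister_diag_lift[OF sub(3)])+
  \<comment> \<open>The residue form of pi_1 is itself ramified with respect to the indeterminate
    before the last one, since its slot \<open>u\<close> has order -1 there; its diagonal has the
    anisotropic residue form given by \<open>as\<close>.\<close>
  have aniso: "block_anisotropic K (pfister_diag K ?as) \<one>\<^bsub>K\<^esub> u ?M"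
    using LK.block_form_anisotropic[of ?M "pfister_diag K ?as" "\<one>\<^bsub>K\<^esub>" u] e u as(2) by simp
  have eq: "block_form F ?d \<one>\<^bsub>F\<^esub> ?u ?M (\<lambda>s. T1 x (2 * s)) (\<lambda>s. T1 x (2 * s + 1)) =
      block_form F ?d' \<one>\<^bsub>F\<^esub> v ?M (\<lambda>s. T2 x (2 * s)) (\<lambda>s. T2 x (2 * s + 1))"
    if x: "x \<in> coord_space F ?M" for x
  proof -
    have "T1 x l \<in> carrier F" "T2 x l \<in> carrier F" if "l < 2 ^ m * 2" for l
      using coord_space_nth[OF linear_map_closed[OF T1(1) x]] coord_space_nth[OF linear_map_closed[OF T2 x]]
        that by (simp_all add: mult.commute)
    then have "quad_value F ?q1 (T1 x) =
        block_form F ?d \<one>\<^bsub>F\<^esub> ?u (2 ^ length ?as2) (\<lambda>s. T1 x (2 * s)) (\<lambda>s. T1 x (2 * s + 1))"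
      "quad_value F ?q2 (T2 x) =
        block_form F ?d' \<one>\<^bsub>F\<^esub> v (2 ^ length ?bs2) (\<lambda>s. T2 x (2 * s)) (\<lambda>s. T2 x (2 * s + 1))"
      unfolding len2[symmetric]
      by (intro KF.F.quad_pfister_value sub u2(1) v(1); simp only: len2)+
    then show ?thesis using val[OF x] by (simp only: len2)
  qed
  have j: "0 < ?M" "2 ^ (m - 1) < ?M" using n by simp_all
  \<comment> \<open>As \<open>bs\<close> has length \<open>m - 1\<close>, the index
    \<open>2 ^ (m - 1)\<close> selects only the head \<open>u\<close> of \<open>?bs\<close>. These
    are the coefficients 1 and u_n whose basis vectors are orthogonal in pi_2.\<close>
  have dj: "pfister_diag K ?bs 0 = \<one>\<^bsub>K\<^esub>" "pfister_diag K ?bs (2 ^ (m - 1)) = u"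
    using len u(1) by simp_all
  have "\<exists>a x y a' x' y'. (\<forall>s<?M. x s \<in> carrier K \<and> y s \<in> carrier K \<and> x' s \<in> carrier K \<and> y' s \<in> carrier K) \<and>
    a \<in> carrier K \<and> a \<noteq> \<zero>\<^bsub>K\<^esub> \<and> a' \<in> carrier K \<and> a' \<noteq> \<zero>\<^bsub>K\<^esub> \<and>
    block_form K (\<lambda>s. series_coeff (?d s) 0) \<one>\<^bsub>K\<^esub> (series_coeff ?u 0) ?M x y =
      series_coeff (?d' 0) 0 \<otimes>\<^bsub>K\<^esub> (a \<otimes>\<^bsub>K\<^esub> a) \<and>
    block_form K (\<lambda>s. series_coeff (?d s) 0) \<one>\<^bsub>K\<^esub> (series_coeff ?u 0) ?M x' y' =
      series_coeff (?d' (2 ^ (m - 1))) 0 \<otimes>\<^bsub>K\<^esub> (a' \<otimes>\<^bsub>K\<^esub> a') \<and>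
    block_form K (\<lambda>s. series_coeff (?d s) 0) \<one>\<^bsub>K\<^esub> (series_coeff ?u 0) ?M
        (\<lambda>s. x s \<oplus>\<^bsub>K\<^esub> x' s) (\<lambda>s. y s \<oplus>\<^bsub>K\<^esub> y' s) =
      series_coeff (?d' 0) 0 \<otimes>\<^bsub>K\<^esub> (a \<otimes>\<^bsub>K\<^esub> a) \<oplus>\<^bsub>K\<^esub> series_coeff (?d' (2 ^ (m - 1))) 0 \<otimes>\<^bsub>K\<^esub> (a' \<otimes>\<^bsub>K\<^esub> a')"
  proof (rule KF.common_subform_residue[OF two'(2) d(1) u2(2) _ d'(1) v(2,3) _ T1 T2 eq j])
    show "block_anisotropic K (\<lambda>s. series_coeff (?d s) 0) \<one>\<^bsub>K\<^esub> (series_coeff ?u 0) ?M"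
      unfolding d(2) u2(3) by (rule aniso)
    show "sq_anisotropic K (\<lambda>s. series_coeff (?d' s) 0) ?M"
      unfolding d'(2) by (rule bs'(2))
  qed
  then obtain a x y a' x' y'
    where cl: "\<forall>s<?M. x s \<in> carrier K \<and> y s \<in> carrier K \<and> x' s \<in> carrier K \<and> y' s \<in> carrier K"
      and a: "a \<in> carrier K" "a \<noteq> \<zero>\<^bsub>K\<^esub>" "a' \<in> carrier K" "a' \<noteq> \<zero>\<^bsub>K\<^esub>"
      and Q: "block_form K (pfister_diag K ?as) \<one>\<^bsub>K\<^esub> u ?M x y = \<one>\<^bsub>K\<^esub> \<otimes>\<^bsub>K\<^esub> (a \<otimes>\<^bsub>K\<^esub> a)"
        "block_form K (pfister_diag K ?as) \<one>\<^bsub>K\<^esub> u ?M x' y' = u \<otimes>\<^bsub>K\<^esub> (a' \<otimes>\<^bsub>K\<^esub> a')"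
        "block_form K (pfister_diag K ?as) \<one>\<^bsub>K\<^esub> u ?M (\<lambda>s. x s \<oplus>\<^bsub>K\<^esub> x' s) (\<lambda>s. y s \<oplus>\<^bsub>K\<^esub> y' s) =
          \<one>\<^bsub>K\<^esub> \<otimes>\<^bsub>K\<^esub> (a \<otimes>\<^bsub>K\<^esub> a) \<oplus>\<^bsub>K\<^esub> u \<otimes>\<^bsub>K\<^esub> (a' \<otimes>\<^bsub>K\<^esub> a')"
    unfolding d(2) d'(2) u2(3) dj by blast
  show False
  \<comment> \<open>The contradiction is obtained one level down, from \<open>K\<close> to
    \<open>L\<close>, where the residue form of pi_1 has its ramified slot.\<close>
  proof (rule LK.no_orthogonal_pair[OF two', of ?M "pfister_diag K ?as" u x y x' y' a a'])
    show "sq_anisotropic L (\<lambda>s. series_coeff (pfister_diag K ?as s) 0) ?M"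
      unfolding e(2) by (rule as(2))
    show "series_coeff (pfister_diag K ?as 0) 0 = \<one>\<^bsub>L\<^esub>" by (simp add: LK.coeff_one)
  qed (use e u cl a Q in auto)
qed

end
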